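(* Assuming Gap-ETH, for any constant $C\ge 1$ there exist $\rho>0$ and $d_0\in\mathbb{N}$ such that the following holds: for any $d\ge d_0$, there is no $\left(\frac{\rho}{\sqrt{d}}\right)$-approximation algorithm for $d$-dimensional knapsack that runs in $O(n^C)$ time, where $n$ is the encoding size of the input instance.
   Context: $d$-dimensional knapsack: an instance $\mathcal{I}=(I,p,c,B)$ consists of a finite set of items $I$, a profit function $p: I\to\mathbb{N}$, a cost function $c: I\to \mathbb{N}^d$, and a budget $B\in\mathbb{N}^d$ (here $0\in\mathbb{N}$). A solution is a subset $S\subseteq I$ with $c_j(S):=\sum_{i\in S}c_j(i)\le B_j$ for all $j\in[d]=\{1,\dots,d\}$; its profit is $p(S)=\sum_{i\in S}p(i)$, to be maximized. $\mathrm{OPT}(\mathcal{I})$ is the maximum profit of a solution. For $\alpha\in(0,1)$, an $\alpha$-approximation algorithm returns, on every instance, a solution of profit at least $\alpha\cdot \mathrm{OPT}(\mathcal{I})$. 3-SAT$(D)$: an instance is $\phi=(V,C)$, where $V$ is a set of variables and $C$ a set of clauses, each a disjunction of three literals (variables of $V$ or their negations), such that each variable appears in at most $D$ clauses. $\mathrm{SAT}(\phi)$ is the maximum number of clauses satisfied by a single assignment $V\to\{0,1\}$. Gap-ETH is the hypothesis: there exist constants $D\in\mathbb{N}$ and $\delta,\varepsilon'\in(0,1)$ such that no algorithm, given a 3-SAT$(D)$ instance $\phi$ with $n$ variables and $m$ clauses, distinguishes between $\mathrm{SAT}(\phi)=m$ and $\mathrm{SAT}(\phi)<(1-\varepsilon')m$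 in time $O(2^{\delta n})$. *)

theory Defs
  imports Complex_Main "HOL-Library.Landau_Symbols"
begin

section \<open>Model of computation\<close>

text \<open>
  An algorithm is a program of the WHILE language of N. D. Jones (Computability and Complexity
  from a Programming Perspective, MIT Press 1997): data are binary trees over the single atom
  nil, and every constructor, selector, variable access, assignment and test costs one time unit.
  There is no unit-cost arithmetic and no unit-cost equality test on trees.  With this cost
  measure WHILE programs and multi-tape deterministic Turing machines simulate each other with
  polynomial overhead (trees are kept as DAGs with sharing).  Both Gap-ETH, which quantifies
  existentially over the rate \<open>\<delta>\<close>, and hardness for every constant exponent \<open>C\<close> are invariant
  under such a change of the machine model.
\<close>

datatype tree = Leaf | Node tree tree

fun hd_tree :: "tree \<Rightarrow> tree" where
  "hd_tree Leaf = Leaf"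
| "hd_tree (Node l r) = l"

fun tl_tree :: "tree \<Rightarrow> tree" where
  "tl_tree Leaf = Leaf"
| "tl_tree (Node l r) = r"

datatype expr = Var nat | NilE | ConsE expr expr | HdE expr | TlE expr

type_synonym store = "nat \<Rightarrow> tree"

primrec eval_expr :: "expr \<Rightarrow> store \<Rightarrow> tree" where
  "eval_expr (Var x) s = s x"
| "eval_expr NilE s = Leaf"
| "eval_expr (ConsE e f) s = Node (eval_expr e s) (eval_expr f s)"
| "eval_expr (HdE e) s = hd_tree (eval_expr e s)"
| "eval_expr (TlE e) s = tl_tree (eval_expr e s)"

primrec expr_cost :: "expr \<Rightarrow> nat" where
  "expr_cost (Var x) = 1"
| "expr_cost NilE = 1"
| "expr_cost (ConsE e f) = 1 + expr_cost e + expr_cost f"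
| "expr_cost (HdE e) = 1 + expr_cost e"
| "expr_cost (TlE e) = 1 + expr_cost e"

datatype com =
    Assign nat expr
  | Seq com com
  | If expr com com
  | While expr com

text \<open>\<open>exec P s t s'\<close>: started in store \<open>s\<close>, \<open>P\<close> halts in store \<open>s'\<close> after exactly \<open>t\<close> time units.
  Tests read nil as false and every other tree as true.\<close>

inductive exec :: "com \<Rightarrow> store \<Rightarrow> nat \<Rightarrow> store \<Rightarrow> bool" where
  exec_Assign: "exec (Assign x e) s (1 + expr_cost e) (s(x := eval_expr e s))"
| exec_Seq: "exec P s t s' \<Longrightarrow> exec Q s' u s'' \<Longrightarrow> exec (Seq P Q) s (t + u) s''"
| exec_IfTrue: "eval_expr e s \<noteq> Leaf \<Longrightarrow> exec P s t s'
    \<Longrightarrow> exec (If e P Q) s (1 + expr_cost e + t) s'"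
| exec_IfFalse: "eval_expr e s = Leaf \<Longrightarrow> exec Q s t s'
    \<Longrightarrow> exec (If e P Q) s (1 + expr_cost e + t) s'"
| exec_WhileFalse: "eval_expr e s = Leaf \<Longrightarrow> exec (While e P) s (1 + expr_cost e) s"
| exec_WhileTrue: "eval_expr e s \<noteq> Leaf \<Longrightarrow> exec P s t s' \<Longrightarrow> exec (While e P) s' u s''
    \<Longrightarrow> exec (While e P) s (1 + expr_cost e + t + u) s''"

inductive_cases exec_AssignE: "exec (Assign x e) s t s'"
inductive_cases exec_SeqE: "exec (Seq P Q) s t s'"
inductive_cases exec_IfE: "exec (If e P Q) s t s'"
inductive_cases exec_WhileE: "exec (While e P) s t s'"

lemma exec_deterministic:
  "exec P s t s' \<Longrightarrow> exec P s u s'' \<Longrightarrow> u = t \<and> s'' = s'"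
proof (induction arbitrary: u s'' rule: exec.induct)
  case exec_Assign
  then show ?case by (auto elim: exec_AssignE)
next
  case (exec_Seq P s t s' Q t2 s2)
  from exec_Seq.prems show ?case
    by (rule exec_SeqE) (metis exec_Seq.IH)
next
  case (exec_IfTrue e s P t s' Q)
  from exec_IfTrue.prems show ?case
    by (rule exec_IfE) (simp_all add: exec_IfTrue.hyps exec_IfTrue.IH)
next
  case (exec_IfFalse e s Q t s' P)
  from exec_IfFalse.prems show ?case
    by (rule exec_IfE) (simp_all add: exec_IfFalse.hyps exec_IfFalse.IH)
next
  case (exec_WhileFalse e s P)
  from exec_WhileFalse.prems show ?case
    by (rule exec_WhileE) (simp_all add: exec_WhileFalse.hyps)
next
  case (exec_WhileTrue e s P t s' t2 s2)
  from exec_WhileTrue.prems show ?case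
    by (rule exec_WhileE) (auto simp: exec_WhileTrue.hyps(1) dest!: exec_WhileTrue.IH)
qed

fun tree_of_bits :: "bool list \<Rightarrow> tree" where
  "tree_of_bits [] = Leaf"
| "tree_of_bits (b # bs) = Node (if b then Node Leaf Leaf else Leaf) (tree_of_bits bs)"

text \<open>\<open>runs P x y t\<close>: on the input word \<open>x\<close>, \<open>P\<close> halts after \<open>t\<close> time units with output word \<open>y\<close>.
  Variable 0 holds input and output; all other variables are initially nil.\<close>

definition runs :: "com \<Rightarrow> bool list \<Rightarrow> bool list \<Rightarrow> nat \<Rightarrow> bool" where
  "runs P x y t \<longleftrightarrow> (\<exists>s. exec P ((\<lambda>_. Leaf)(0 := tree_of_bits x)) t s \<and> s 0 = tree_of_bits y)"

text \<open>Self-delimiting binary code: least significant digit first, each digit is preceded by the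
  marker \<open>True\<close>, and \<open>False\<close> ends the number.\<close>

fun encode_nat :: "nat \<Rightarrow> bool list" where
  "encode_nat n = (if n = 0 then [False] else True # odd n # encode_nat (n div 2))"

declare encode_nat.simps [simp del]


section \<open>Multidimensional knapsack\<close>

text \<open>The items are \<open>0, \<dots>, num_items - 1\<close>, the coordinates are \<open>1, \<dots>, d\<close>; values of the functions
  outside these ranges are irrelevant.\<close>

record knapsack =
  num_items :: nat
  profit :: "nat \<Rightarrow> nat"
  cost :: "nat \<Rightarrow> nat \<Rightarrow> nat"  \<comment> \<open>\<open>cost K j i\<close> is \<open>c\<^sub>j(i)\<close>\<close>
  budget :: "nat \<Rightarrow> nat"

definition is_solution :: "nat \<Rightarrow> knapsack \<Rightarrow> nat set \<Rightarrow> bool" where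
  "is_solution d K S \<longleftrightarrow>
     S \<subseteq> {..<num_items K} \<and> (\<forall>j\<in>{1..d}. (\<Sum>i\<in>S. cost K j i) \<le> budget K j)"

definition total_profit :: "knapsack \<Rightarrow> nat set \<Rightarrow> nat" where
  "total_profit K S = (\<Sum>i\<in>S. profit K i)"

definition OPT :: "nat \<Rightarrow> knapsack \<Rightarrow> nat" where
  "OPT d K = Max (total_profit K ` {S. is_solution d K S})"

text \<open>The dimension is a constant of the problem and is not part of the input word.\<close>

definition encode_knapsack :: "nat \<Rightarrow> knapsack \<Rightarrow> bool list" where
  "encode_knapsack d K =
     encode_nat (num_items K)
     @ concat (map (\<lambda>j. encode_nat (budget K j)) [1..<d + 1])
     @ concat (map (\<lambda>i. encode_nat (profit K i)
                        @ concat (map (\<lambda>j. encode_nat (cost K j i)) [1..<d + 1]))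
                [0..<num_items K])"

definition encode_item_set :: "knapsack \<Rightarrow> nat set \<Rightarrow> bool list" where
  "encode_item_set K S = map (\<lambda>i. i \<in> S) [0..<num_items K]"

definition knapsack_approximation_algorithm :: "nat \<Rightarrow> real \<Rightarrow> com \<Rightarrow> bool" where
  "knapsack_approximation_algorithm d \<alpha> P \<longleftrightarrow>
     (\<forall>K. \<exists>S t. runs P (encode_knapsack d K) (encode_item_set K S) t \<and> is_solution d K S \<and>
        real (total_profit K S) \<ge> \<alpha> * real (OPT d K))"

definition knapsack_runs_in_time :: "nat \<Rightarrow> com \<Rightarrow> (nat \<Rightarrow> real) \<Rightarrow> bool" where
  "knapsack_runs_in_time d P f \<longleftrightarrow>
     (\<exists>T \<in> O(f). \<forall>K. \<exists>y t. runs P (encode_knapsack d K) y t \<and>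
        real t \<le> T (length (encode_knapsack d K)))"


section \<open>3-SAT with bounded occurrences and Gap-ETH\<close>

text \<open>A literal is a variable together with the truth value satisfying it; the variables are
  \<open>0, \<dots>, num_vars - 1\<close>.  A clause is given by a list of its three literals, a set of clauses by a
  list of pairwise different clauses, where clauses are compared as sets of literals.\<close>

type_synonym literal = "nat \<times> bool"

record cnf =
  num_vars :: nat
  clauses :: "literal list list"

definition is_3sat :: "nat \<Rightarrow> cnf \<Rightarrow> bool" where
  "is_3sat D \<phi> \<longleftrightarrow>
     distinct (map set (clauses \<phi>)) \<and>
     (\<forall>c \<in> set (clauses \<phi>). length c = 3 \<and> fst ` set c \<subseteq> {..<num_vars \<phi>}) \<and>
     (\<forall>v < num_vars \<phi>. card {c \<in> set (clauses \<phi>). v \<in> fst ` set c} \<le> D)"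

definition satisfies :: "(nat \<Rightarrow> bool) \<Rightarrow> literal list \<Rightarrow> bool" where
  "satisfies a c \<longleftrightarrow> (\<exists>(v, b) \<in> set c. a v = b)"

definition SAT :: "cnf \<Rightarrow> nat" where
  "SAT \<phi> = Max (range (\<lambda>a. card {c \<in> set (clauses \<phi>). satisfies a c}))"

definition encode_cnf :: "cnf \<Rightarrow> bool list" where
  "encode_cnf \<phi> =
     encode_nat (num_vars \<phi>) @ encode_nat (length (clauses \<phi>))
     @ concat (map (\<lambda>c. concat (map (\<lambda>(v, b). encode_nat v @ [b]) c)) (clauses \<phi>))"

text \<open>The time bound applies to every instance; the answer is constrained only on the two sides of
  the gap.\<close>

definition distinguishes_in_time :: "nat \<Rightarrow> real \<Rightarrow> com \<Rightarrow> (nat \<Rightarrow> real) \<Rightarrow> bool" where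
  "distinguishes_in_time D \<epsilon> P f \<longleftrightarrow>
     (\<exists>T \<in> O(f). \<forall>\<phi>. is_3sat D \<phi> \<longrightarrow>
        (\<exists>y t. runs P (encode_cnf \<phi>) y t \<and> real t \<le> T (num_vars \<phi>) \<and>
           (SAT \<phi> = length (clauses \<phi>) \<longrightarrow> y = [True]) \<and>
           (real (SAT \<phi>) < (1 - \<epsilon>) * real (length (clauses \<phi>)) \<longrightarrow> y = [False])))"

definition Gap_ETH :: bool where
  "Gap_ETH \<longleftrightarrow>
     (\<exists>(D::nat) (\<delta>::real) (\<epsilon>::real). \<delta> \<in> {0<..<1} \<and> \<epsilon> \<in> {0<..<1} \<and>
        \<not> (\<exists>P. distinguishes_in_time D \<epsilon> P (\<lambda>n. 2 powr (\<delta> * real n))))"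

end

theory Submission
  imports Defs "HOL-Library.FuncSet" "HOL-Real_Asymp.Real_Asymp"
begin

text \<open>
  A \<open>3-SAT(D)\<close> instance with \<open>m\<close> clauses is covered by \<open>k\<close> subfamilies of about \<open>m/q\<close> clauses each, of
  which any \<open>r\<close> contain all but a fraction \<open>(1 - 1/q)^r \<le> \<epsilon>\<close> of the clauses.  The items are the
  pairs of a subfamily and an assignment of its variables satisfying it, all of profit 1; one pair of
  coordinates for each pair of subfamilies forces the chosen assignments to agree, so there are
  \<open>d \<approx> 2k\<^sup>2\<close> coordinates.  If the formula is satisfiable, then \<open>k\<close> items can be chosen; if fewer
  than \<open>(1 - \<epsilon>)m\<close> clauses are satisfiable, then fewer than \<open>r\<close> items can, since \<open>r\<close> chosen items
  would combine to an assignment satisfying almost everything.  As \<open>r\<close> depends only on \<open>\<epsilon>\<close> and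
  \<open>q\<close>, and not on \<open>d\<close>, the gap is of order \<open>k/r\<close>, that is, \<open>\<surd>d\<close> up to a constant.  There are \<open>2^O(m/q)\<close>
  items for constant \<open>k\<close>, so with \<open>q\<close> large against the exponent \<open>C\<close> a knapsack algorithm
  running in time \<open>n^C\<close> decides the gap in time \<open>2^(\<delta>n)\<close>.
\<close>

section \<open>Clean programs\<close>

text \<open>Algorithms are concrete programs, so the reduction has to be realised by one, with a
  time bound. Almost all of it is polynomial time, assembled from closure rules for programs that
  leave their scratch variables nil; the single exponential stage lists the truth-value strings for
  the literals of a largest subfamily. The language has no arithmetic and no equality test, so
  numbers are handled as digit lists or in unary, and loops are folds over lists. Knapsack
  constraints are upper bounds on sums, so equality of two assignments is expressed by two opposite
  comparisons of binary numbers, with one digit for each pair of literal occurrences; such costs are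
  huge in value but short in binary. For fixed \<open>d\<close> the tables describing the
  subfamilies are constants of the program, so nothing has to compute them. Given \<open>C\<close>,
  the order of choice is: the exponents of the reduction and of the final test, then
  \<open>q\<close> from these and \<delta>, then \<open>r\<close> from \<epsilon> and
  \<open>q\<close>. Only \<open>k\<close>, the padding and the tables depend on \<open>d\<close>, so
  \<rho> = 3r does not.\<close>

abbreviation seq_com (infixr ";;" 60) where "P ;; Q \<equiv> Seq P Q"

definition clean_store :: "tree \<Rightarrow> store" where
  "clean_store a = (\<lambda>_. Leaf)(0 := a)"

primrec expr_bd :: "expr \<Rightarrow> nat" where
  "expr_bd (Var x) = Suc x"
| "expr_bd NilE = 0"
| "expr_bd (ConsE e f) = max (expr_bd e) (expr_bd f)"
| "expr_bd (HdE e) = expr_bd e"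
| "expr_bd (TlE e) = expr_bd e"

primrec com_bd :: "com \<Rightarrow> nat" where
  "com_bd (Assign x e) = max (Suc x) (expr_bd e)"
| "com_bd (Seq P Q) = max (com_bd P) (com_bd Q)"
| "com_bd (If e P Q) = max (expr_bd e) (max (com_bd P) (com_bd Q))"
| "com_bd (While e P) = max (expr_bd e) (com_bd P)"

lemma eval_expr_cong:
  "expr_bd e \<le> K \<Longrightarrow> (\<And>i. i < K \<Longrightarrow> s i = r i) \<Longrightarrow> eval_expr e s = eval_expr e r"
  by (induction e) auto

text \<open>Variables from \<open>K\<close> on are neither read nor written, so a run transfers to
  every store with the same contents below \<open>K\<close>, and whatever lies above survives. This
  makes registers beyond a program safe.\<close>

lemma exec_frame:
  assumes "exec P s t s'" "com_bd P \<le> K" "\<And>i. i < K \<Longrightarrow> s i = r i"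
  shows "exec P r t (\<lambda>i. if i < K then s' i else r i)"
  using assms
proof (induction arbitrary: r rule: exec.induct)
  case (exec_Assign x e s)
  have "eval_expr e s = eval_expr e r"
    using exec_Assign by (intro eval_expr_cong[of e K]) auto
  then have "(\<lambda>i. if i < K then (s(x := eval_expr e s)) i else r i) = r(x := eval_expr e r)"
    using exec_Assign by auto
  then show ?case by (metis exec.exec_Assign)
next
  case (exec_Seq P s t s' Q u s'')
  let ?r = "\<lambda>i. if i < K then s' i else r i"
  have 1: "exec P r t ?r" using exec_Seq by auto
  have "exec Q ?r u (\<lambda>i. if i < K then s'' i else ?r i)"
    using exec_Seq by (intro exec_Seq.IH(2)) auto
  moreover have "(\<lambda>i. if i < K then s'' i else ?r i) = (\<lambda>i. if i < K then s'' i else r i)"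
    by auto
  ultimately show ?case using 1 exec.exec_Seq by metis
next
  case (exec_IfTrue e s P t s' Q)
  have "eval_expr e s = eval_expr e r"
    using exec_IfTrue by (intro eval_expr_cong[of e K]) auto
  then show ?case using exec_IfTrue by (intro exec.exec_IfTrue) auto
next
  case (exec_IfFalse e s Q t s' P)
  have "eval_expr e s = eval_expr e r"
    using exec_IfFalse by (intro eval_expr_cong[of e K]) auto
  then show ?case using exec_IfFalse by (intro exec.exec_IfFalse) auto
next
  case (exec_WhileFalse e s P)
  have "eval_expr e s = eval_expr e r"
    using exec_WhileFalse by (intro eval_expr_cong[of e K]) auto
  moreover have "(\<lambda>i. if i < K then s i else r i) = r" using exec_WhileFalse by auto
  ultimately show ?case using exec_WhileFalse exec.exec_WhileFalse by metis
next
  case (exec_WhileTrue e s P t s' u s'')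
  let ?r = "\<lambda>i. if i < K then s' i else r i"
  have 0: "eval_expr e r = eval_expr e s"
    using exec_WhileTrue by (intro eval_expr_cong[of e K]) auto
  have 1: "exec P r t ?r" using exec_WhileTrue by auto
  have "exec (While e P) ?r u (\<lambda>i. if i < K then s'' i else ?r i)"
    using exec_WhileTrue by (intro exec_WhileTrue.IH(2)) auto
  moreover have "(\<lambda>i. if i < K then s'' i else ?r i) = (\<lambda>i. if i < K then s'' i else r i)"
    by auto
  ultimately show ?case
    using 0 1 exec_WhileTrue.hyps(1) exec.exec_WhileTrue by metis
qed

lemma exec_frame_clean:
  assumes "exec P (clean_store a) t (clean_store b)" "com_bd P \<le> K" "\<And>i. 0 < i \<Longrightarrow> i < K \<Longrightarrow> r i = Leaf"
    "r 0 = a" "0 < K"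
  shows "exec P r t (r(0 := b))"
proof -
  have "exec P r t (\<lambda>i. if i < K then clean_store b i else r i)"
    by (rule exec_frame[OF assms(1,2)]) (use assms in \<open>auto simp: clean_store_def\<close>)
  moreover have "(\<lambda>i. if i < K then clean_store b i else r i) = r(0 := b)"
    using assms by (auto simp: clean_store_def fun_eq_iff)
  ultimately show ?thesis by simp
qed

lemma exec_Assign_eq:
  "s' = s(x := eval_expr e s) \<Longrightarrow> exec (Assign x e) s (1 + expr_cost e) s'"
  by (simp only: exec_Assign)

text \<open>Variable 0 holds the output and is kept. The language has no skip, hence the
  self-assignment as base case.\<close>

primrec clear_vars :: "nat \<Rightarrow> com" where
  "clear_vars 0 = Assign 0 (Var 0)"
| "clear_vars (Suc n) = clear_vars n ;; Assign (Suc n) NilE"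

lemma exec_clear_vars:
  "exec (clear_vars n) s (2 + 2 * n) (\<lambda>i. if 0 < i \<and> i \<le> n then Leaf else s i)"
proof (induction n)
  case 0
  have "(\<lambda>i. if 0 < i \<and> i \<le> 0 then Leaf else s i) = s(0 := eval_expr (Var 0) s)" by auto
  from exec_Assign_eq[OF this] show ?case by (simp add: numeral_2_eq_2)
next
  case (Suc n)
  let ?s = "\<lambda>i. if 0 < i \<and> i \<le> n then Leaf else s i"
  have eq: "(\<lambda>i. if 0 < i \<and> i \<le> Suc n then Leaf else s i) = ?s(Suc n := eval_expr NilE ?s)"
    by auto
  have "2 + 2 * Suc n = (2 + 2 * n) + (1 + expr_cost NilE)"
    by simp
  then show ?case
    unfolding clear_vars.simps using exec_Seq[OF Suc exec_Assign_eq[OF eq]] by metis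
qed

text \<open>Makes an arbitrary program composable, in particular the assumed knapsack algorithm. The
  extra time \<open>k\<close> depends on the program only.\<close>

lemma runs_clean_program:
  "\<exists>Q k. \<forall>x y t. runs P x y t \<longrightarrow> exec Q (clean_store (tree_of_bits x)) (t + k) (clean_store (tree_of_bits y))"
proof (intro exI allI impI)
  fix x y t
  let ?K = "com_bd P"
  assume "runs P x y t"
  then obtain s where s: "exec P (clean_store (tree_of_bits x)) t s" "s 0 = tree_of_bits y"
    by (auto simp: runs_def clean_store_def)
  \<comment> \<open>The frame property applied to the run itself: by determinism both final stores
    coincide, so variables from \<open>?K\<close> on are still nil and clearing up to
    \<open>?K\<close> suffices.\<close>
  have "exec P (clean_store (tree_of_bits x)) t (\<lambda>i. if i < ?K then s i else clean_store (tree_of_bits x) i)"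
    (is "exec P _ t ?s")
    by (rule exec_frame[OF s(1)]) auto
  then have s': "?s = s" by (rule conjunct2[OF exec_deterministic[OF s(1)]])
  have out: "s i = Leaf" if "i \<ge> ?K" "i > 0" for i
    using fun_cong[OF s', of i] that by (simp add: clean_store_def)
  have "(\<lambda>i. if 0 < i \<and> i \<le> ?K then Leaf else s i) = clean_store (tree_of_bits y)"
  proof
    fix i show "(if 0 < i \<and> i \<le> ?K then Leaf else s i) = clean_store (tree_of_bits y) i"
      using out[of i] s(2) by (cases "i = 0") (auto simp: clean_store_def)
  qed
  then have "exec (clear_vars ?K) s (2 + 2 * ?K) (clean_store (tree_of_bits y))"
    using exec_clear_vars[of ?K s] by simp
  then show "exec (P ;; clear_vars ?K) (clean_store (tree_of_bits x)) (t + (2 + 2 * ?K)) (clean_store (tree_of_bits y))"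
    using s(1) exec_Seq by blast
qed

section \<open>Encoding of data\<close>

class enc =
  fixes enc :: "'a \<Rightarrow> tree"

definition sz :: "'a::enc \<Rightarrow> nat" where
  "sz x = size (enc x)"

instantiation bool :: enc
begin
definition enc_bool :: "bool \<Rightarrow> tree" where
  "enc_bool b = (if b then Node Leaf Leaf else Leaf)"
instance ..
end

instantiation prod :: (enc, enc) enc
begin
definition enc_prod :: "'a \<times> 'b \<Rightarrow> tree" where
  "enc_prod p = Node (enc (fst p)) (enc (snd p))"
instance ..
end

instantiation list :: (enc) enc
begin
primrec enc_list :: "'a list \<Rightarrow> tree" where
  "enc_list [] = Leaf"
| "enc_list (x # xs) = Node (enc x) (enc_list xs)"
instance ..
end

lemma enc_simps [simp]:
  "enc True = Node Leaf Leaf" "enc False = Leaf" "enc (a, b) = Node (enc a) (enc b)"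
  by (auto simp: enc_bool_def enc_prod_def)

text \<open>On bit lists the generic encoding is the machine's own format for words; this links
  clean programs to \<open>runs\<close>.\<close>

lemma enc_eq_tree_of_bits: "enc xs = tree_of_bits xs"
  by (induction xs) (auto simp: enc_bool_def)

lemma sz_simps [simp]:
  "sz True = 1" "sz False = 0" "sz (a, b) = sz a + sz b + 1"
  "sz [] = 0" "sz (x # xs) = sz x + sz xs + 1"
  by (auto simp: sz_def)

lemma sz_bool: "sz (b::bool) \<le> 1"
  by (cases b) auto

lemma sz_append [simp]: "sz (xs @ ys) = sz xs + sz ys"
  by (induction xs) auto

lemma length_le_sz: "length xs \<le> sz xs"
  by (induction xs) auto

lemma sz_fst_le: "sz (fst p) \<le> sz p" and sz_snd_le: "sz (snd p) \<le> sz p"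
  by (cases p; simp)+

lemma sz_tl_le: "sz (tl xs) \<le> sz xs"
  by (cases xs) auto

section \<open>Polynomially bounded functions\<close>

text \<open>One exponent represents a polynomial: the offset 2 lets powers absorb constants and
  sums, as 2 * y ^ c \<le> y ^ (c + 1) for y \<ge> 2. The base is a parameter because the complete
  reduction is polynomial only in the size plus an exponential term.\<close>

definition poly_bd :: "('a \<Rightarrow> nat) \<Rightarrow> ('a \<Rightarrow> nat) \<Rightarrow> bool" where
  "poly_bd b g \<longleftrightarrow> (\<exists>c. \<forall>x. g x \<le> (b x + 2) ^ c)"

abbreviation poly_bounded :: "('a::enc \<Rightarrow> nat) \<Rightarrow> bool" where
  "poly_bounded \<equiv> poly_bd sz"

lemma poly_bd_mono: "poly_bd b g \<Longrightarrow> (\<And>x. f x \<le> g x) \<Longrightarrow> poly_bd b f"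
  unfolding poly_bd_def by (meson le_trans)

lemma poly_bd_const: "poly_bd b (\<lambda>_. n)"
proof -
  have "n \<le> (b x + 2) ^ n" for x
    by (rule order.trans[OF less_imp_le[OF less_exp]]) (simp add: power_mono)
  then show ?thesis unfolding poly_bd_def by blast
qed

lemma poly_bd_base: "poly_bd b b"
  unfolding poly_bd_def by (rule exI[of _ 1]) auto

lemmas poly_bd_sz = poly_bd_base[of sz]

lemma poly_bd_mult: "poly_bd b f \<Longrightarrow> poly_bd b g \<Longrightarrow> poly_bd b (\<lambda>x. f x * g x)"
  unfolding poly_bd_def by (metis power_add mult_le_mono)

lemma poly_bd_add:
  assumes "poly_bd b f" "poly_bd b g" shows "poly_bd b (\<lambda>x. f x + g x)"
proof -
  obtain m n where mn: "\<And>x. f x \<le> (b x + 2) ^ m" "\<And>x. g x \<le> (b x + 2) ^ n"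
    using assms unfolding poly_bd_def by blast
  have "f x + g x \<le> (b x + 2) ^ (Suc (max m n))" for x
  proof -
    have "f x \<le> (b x + 2) ^ max m n" "g x \<le> (b x + 2) ^ max m n"
      by (rule order.trans[OF mn(1)] order.trans[OF mn(2)], rule power_increasing; simp)+
    then have "f x + g x \<le> 2 * (b x + 2) ^ max m n" by simp
    also have "\<dots> \<le> (b x + 2) * (b x + 2) ^ max m n" by (intro mult_le_mono) auto
    finally show ?thesis by simp
  qed
  then show ?thesis unfolding poly_bd_def by blast
qed

lemma poly_bd_power: "poly_bd b f \<Longrightarrow> poly_bd b (\<lambda>x. f x ^ n)"
  by (induction n) (auto intro: poly_bd_const poly_bd_mult)

lemma poly_bd_comp:
  assumes "poly_bd b g" "poly_bd b' (\<lambda>x. b (f x))" shows "poly_bd b' (\<lambda>x. g (f x))"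
proof -
  obtain c where "\<And>y. g y \<le> (b y + 2) ^ c" using assms(1) unfolding poly_bd_def by blast
  moreover have "poly_bd b' (\<lambda>x. (b (f x) + 2) ^ c)" by (intro poly_bd_power poly_bd_add assms(2) poly_bd_const)
  ultimately show ?thesis by (rule poly_bd_mono[rotated])
qed

lemma poly_bd_length: "poly_bounded (\<lambda>x. sz (f x)) \<Longrightarrow> poly_bounded (\<lambda>x. length (f x))"
  by (erule poly_bd_mono) (rule length_le_sz)

lemma poly_bd_sz_pair: "poly_bounded (\<lambda>x. sz (f x)) \<Longrightarrow> poly_bounded (\<lambda>x. sz (g x)) \<Longrightarrow> poly_bounded (\<lambda>x. sz (f x, g x))"
  unfolding sz_simps by (intro poly_bd_add poly_bd_const)

section \<open>Functions computed by clean programs in bounded time\<close>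

definition computes :: "('a::enc \<Rightarrow> 'b::enc) \<Rightarrow> ('a \<Rightarrow> nat) \<Rightarrow> bool" where
  "computes f T \<longleftrightarrow> (\<exists>P. \<forall>x. \<exists>t\<le>T x. exec P (clean_store (enc x)) t (clean_store (enc (f x))))"

lemma computes_mono: "computes f T \<Longrightarrow> (\<And>x. T x \<le> U x) \<Longrightarrow> computes f U"
  unfolding computes_def by (meson le_trans)

lemma computes_expr:
  assumes "\<And>x. eval_expr e (clean_store (enc x)) = enc (f x)"
  shows "computes f (\<lambda>_. 1 + expr_cost e)"
proof -
  have "exec (Assign 0 e) (clean_store (enc x)) (1 + expr_cost e) (clean_store (enc (f x)))" for x
    by (rule exec_Assign_eq) (subst assms, simp add: clean_store_def)
  then show ?thesis unfolding computes_def by blast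
qed

lemma computes_comp:
  assumes "computes f T" "computes g U" shows "computes (\<lambda>x. g (f x)) (\<lambda>x. T x + U (f x))"
proof -
  obtain P Q where P: "\<And>x. \<exists>t\<le>T x. exec P (clean_store (enc x)) t (clean_store (enc (f x)))"
    and Q: "\<And>x. \<exists>t\<le>U x. exec Q (clean_store (enc x)) t (clean_store (enc (g x)))"
    using assms unfolding computes_def by blast
  have "\<exists>t\<le>T x + U (f x). exec (P ;; Q) (clean_store (enc x)) t (clean_store (enc (g (f x))))" for x
    using P[of x] Q[of "f x"] exec_Seq add_mono by metis
  then show ?thesis unfolding computes_def by blast
qed

text \<open>Each program consumes variable 0, so the input waits in register \<open>K\<close> while
  \<open>P\<close> runs, and the result of \<open>P\<close> in \<open>Suc K\<close> while
  \<open>Q\<close> runs. The 20 generously covers the register moves.\<close>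

lemma computes_pair:
  assumes "computes f T" "computes g U" shows "computes (\<lambda>x. (f x, g x)) (\<lambda>x. T x + U x + 20)"
proof -
  obtain P Q where P: "\<And>x. \<exists>t\<le>T x. exec P (clean_store (enc x)) t (clean_store (enc (f x)))"
    and Q: "\<And>x. \<exists>t\<le>U x. exec Q (clean_store (enc x)) t (clean_store (enc (g x)))"
    using assms unfolding computes_def by blast
  define K where "K = Suc (max (com_bd P) (com_bd Q))"
  let ?R = "Assign K (Var 0) ;; P ;; Assign (Suc K) (Var 0) ;; Assign 0 (Var K) ;; Assign K NilE
    ;; Q ;; Assign 0 (ConsE (Var (Suc K)) (Var 0)) ;; Assign (Suc K) NilE"
  have K: "K > 0" "com_bd P \<le> K" "com_bd Q \<le> K" by (auto simp: K_def)
  have "\<exists>t\<le>T x + U x + 20. exec ?R (clean_store (enc x)) t (clean_store (enc (f x, g x)))" for x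
  proof -
    obtain t u where t: "t \<le> T x" "exec P (clean_store (enc x)) t (clean_store (enc (f x)))"
      and u: "u \<le> U x" "exec Q (clean_store (enc x)) u (clean_store (enc (g x)))" using P Q by blast
    define s0 where "s0 = clean_store (enc x)"
    define s1 where "s1 = s0(K := enc x)"
    define s2 where "s2 = s1(0 := enc (f x))"
    define s3 where "s3 = s2(Suc K := enc (f x))"
    define s4 where "s4 = s3(0 := enc x)"
    define s5 where "s5 = s4(K := Leaf)"
    define s6 where "s6 = s5(0 := enc (g x))"
    define s7 where "s7 = s6(0 := enc (f x, g x))"
    define s8 where "s8 = s7(Suc K := Leaf)"
    note defs = s0_def s1_def s2_def s3_def s4_def s5_def s6_def s7_def s8_def
    have e1: "exec (Assign K (Var 0)) s0 (1 + expr_cost (Var 0)) s1"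
      by (rule exec_Assign_eq) (auto simp: defs clean_store_def)
    have e2: "exec P s1 t s2" unfolding s2_def
      by (rule exec_frame_clean[OF t(2) K(2)]) (use K in \<open>auto simp: defs clean_store_def\<close>)
    have e3: "exec (Assign (Suc K) (Var 0)) s2 (1 + expr_cost (Var 0)) s3"
      by (rule exec_Assign_eq) (use K in \<open>auto simp: defs clean_store_def\<close>)
    have e4: "exec (Assign 0 (Var K)) s3 (1 + expr_cost (Var K)) s4"
      by (rule exec_Assign_eq) (use K in \<open>auto simp: defs clean_store_def\<close>)
    have e5: "exec (Assign K NilE) s4 (1 + expr_cost NilE) s5"
      by (rule exec_Assign_eq) (use K in \<open>auto simp: defs clean_store_def\<close>)
    have e6: "exec Q s5 u s6" unfolding s6_def
      by (rule exec_frame_clean[OF u(2) K(3)]) (use K in \<open>auto simp: defs clean_store_def\<close>)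
    have e7: "exec (Assign 0 (ConsE (Var (Suc K)) (Var 0))) s6
        (1 + expr_cost (ConsE (Var (Suc K)) (Var 0))) s7"
      by (rule exec_Assign_eq) (use K in \<open>auto simp: defs clean_store_def\<close>)
    have e8: "exec (Assign (Suc K) NilE) s7 (1 + expr_cost NilE) s8"
      by (rule exec_Assign_eq) (use K in \<open>auto simp: defs clean_store_def\<close>)
    have "s8 = clean_store (enc (f x, g x))"
      using K by (auto simp: defs clean_store_def fun_eq_iff)
    then obtain n where n: "n = (1 + expr_cost (Var 0)) + (t + ((1 + expr_cost (Var 0))
        + ((1 + expr_cost (Var K)) + ((1 + expr_cost NilE) + (u
        + ((1 + expr_cost (ConsE (Var (Suc K)) (Var 0))) + (1 + expr_cost NilE)))))))" "exec ?R (clean_store (enc x)) n (clean_store (enc (f x, g x)))"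
      using exec_Seq[OF e1 exec_Seq[OF e2 exec_Seq[OF e3 exec_Seq[OF e4 exec_Seq[OF e5
        exec_Seq[OF e6 exec_Seq[OF e7 e8]]]]]]] unfolding s0_def by metis
    then show ?thesis using t(1) u(1) by (intro exI[of _ n]) simp
  qed
  then show ?thesis unfolding computes_def by blast
qed

lemma computes_If:
  assumes "computes b S" "computes f T" "computes g U"
  shows "computes (\<lambda>x. if b x then f x else g x) (\<lambda>x. S x + T x + U x + 20)"
proof -
  obtain R P Q where R: "\<And>x. \<exists>t\<le>S x. exec R (clean_store (enc x)) t (clean_store (enc (b x)))"
    and P: "\<And>x. \<exists>t\<le>T x. exec P (clean_store (enc x)) t (clean_store (enc (f x)))"
    and Q: "\<And>x. \<exists>t\<le>U x. exec Q (clean_store (enc x)) t (clean_store (enc (g x)))"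
    using assms unfolding computes_def by blast
  define K where "K = Suc (com_bd R)"
  let ?B = "\<lambda>P. Assign 0 (Var K) ;; Assign K NilE ;; P"
  let ?R = "Assign K (Var 0) ;; R ;; If (Var 0) (?B P) (?B Q)"
  have K: "K > 0" "com_bd R \<le> K" by (auto simp: K_def)
  have "\<exists>t\<le>S x + T x + U x + 20. exec ?R (clean_store (enc x)) t (clean_store (enc (if b x then f x else g x)))" for x
  proof -
    obtain s where s: "s \<le> S x" "exec R (clean_store (enc x)) s (clean_store (enc (b x)))" using R by blast
    obtain t u where t: "t \<le> T x" "exec P (clean_store (enc x)) t (clean_store (enc (f x)))"
      and u: "u \<le> U x" "exec Q (clean_store (enc x)) u (clean_store (enc (g x)))" using P Q by blast
    define s0 where "s0 = clean_store (enc x)"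
    define s1 where "s1 = s0(K := enc x)"
    define s2 where "s2 = s1(0 := enc (b x))"
    define s3 where "s3 = s2(0 := enc x)"
    note defs = s0_def s1_def s2_def s3_def
    have 1: "exec (Assign K (Var 0)) s0 (1 + expr_cost (Var 0)) s1"
      by (rule exec_Assign_eq) (auto simp: defs clean_store_def)
    have 2: "exec R s1 s s2" unfolding s2_def
      by (rule exec_frame_clean[OF s(2) K(2)]) (use K in \<open>auto simp: defs clean_store_def\<close>)
    have 3: "exec (Assign 0 (Var K)) s2 (1 + expr_cost (Var K)) s3"
      by (rule exec_Assign_eq) (use K in \<open>auto simp: defs clean_store_def\<close>)
    have 4: "exec (Assign K NilE) s3 (1 + expr_cost NilE) s0"
      by (rule exec_Assign_eq) (use K in \<open>auto simp: defs clean_store_def fun_eq_iff\<close>)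
    show ?thesis
    proof (cases "b x")
      case True
      have "exec (?B P) s2 (2 + (2 + t)) (clean_store (enc (f x)))"
        using exec_Seq[OF 3 exec_Seq[OF 4 t(2)[folded s0_def]]] by simp
      then have "exec (If (Var 0) (?B P) (?B Q)) s2 (1 + expr_cost (Var 0) + (2 + (2 + t)))
          (clean_store (enc (f x)))"
        by (rule exec_IfTrue[rotated]) (use True in \<open>auto simp: s2_def\<close>)
      then have "exec ?R s0 ((1 + expr_cost (Var 0)) + (s + (1 + expr_cost (Var 0) + (2 + (2 + t)))))
          (clean_store (enc (f x)))"
        using 1 2 by (blast intro: exec_Seq)
      then show ?thesis using True s(1) t(1) unfolding s0_def by (intro exI conjI) auto
    next
      case False
      have "exec (?B Q) s2 (2 + (2 + u)) (clean_store (enc (g x)))"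
        using exec_Seq[OF 3 exec_Seq[OF 4 u(2)[folded s0_def]]] by simp
      then have "exec (If (Var 0) (?B P) (?B Q)) s2 (1 + expr_cost (Var 0) + (2 + (2 + u)))
          (clean_store (enc (g x)))"
        by (rule exec_IfFalse[rotated]) (use False in \<open>auto simp: s2_def\<close>)
      then have "exec ?R s0 ((1 + expr_cost (Var 0)) + (s + (1 + expr_cost (Var 0) + (2 + (2 + u)))))
          (clean_store (enc (g x)))"
        using 1 2 by (blast intro: exec_Seq)
      then show ?thesis using False s(1) u(1) unfolding s0_def by (intro exI conjI) auto
    qed
  qed
  then show ?thesis unfolding computes_def by blast
qed

text \<open>Register \<open>K\<close> holds the remaining list, \<open>Suc K\<close> the parameter,
  variable 0 the accumulator. The accumulator may outgrow the input, so \<open>H\<close> bounds the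
  time of a step at the accumulators that actually occur, the folds over proper prefixes.\<close>

lemma computes_foldl:
  fixes g :: "('x::enc \<times> 'e::enc) \<times> 'a::enc \<Rightarrow> 'a"
  assumes "computes g G"
    and G: "\<And>x a xs ys e zs. xs = ys @ e # zs \<Longrightarrow>
      G ((x, e), foldl (\<lambda>a e. g ((x, e), a)) a ys) \<le> H (x, a, xs)"
  shows "computes (\<lambda>z. foldl (\<lambda>a e. g ((fst z, e), a)) (fst (snd z)) (snd (snd z)))
    (\<lambda>z. length (snd (snd z)) * (H z + 20) + 20)"
proof -
  obtain P where P: "\<And>x. \<exists>t\<le>G x. exec P (clean_store (enc x)) t (clean_store (enc (g x)))"
    using assms unfolding computes_def by blast
  define K where "K = Suc (com_bd P)"
  have K: "K > 0" "com_bd P \<le> K" by (auto simp: K_def)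
  let ?E = "ConsE (ConsE (Var (Suc K)) (HdE (Var K))) (Var 0)"
  let ?L = "Assign 0 ?E ;; P ;; Assign K (TlE (Var K))"
  let ?R = "Assign K (TlE (TlE (Var 0))) ;; Assign (Suc K) (HdE (Var 0)) ;;
    Assign 0 (HdE (TlE (Var 0))) ;; While (Var K) ?L ;; Assign (Suc K) NilE"
  define S where "S x a xs = (clean_store (enc a))(K := enc xs, Suc K := enc x)" for x :: 'x and a :: 'a and xs :: "'e list"
  have loop: "\<exists>t\<le>length zs * (h + 20) + 2.
      exec (While (Var K) ?L) (S x (foldl (\<lambda>a e. g ((x, e), a)) a ys) zs) t
        (S x (foldl (\<lambda>a e. g ((x, e), a)) a (ys @ zs)) [])"
    if "\<And>us e vs. ys @ zs = us @ e # vs \<Longrightarrow> G ((x, e), foldl (\<lambda>a e. g ((x, e), a)) a us) \<le> h"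
    for x a ys zs h
    using that
  proof (induction zs arbitrary: ys)
    case Nil
    have "exec (While (Var K) ?L) (S x (foldl (\<lambda>a e. g ((x, e), a)) a ys) []) (1 + expr_cost (Var K))
        (S x (foldl (\<lambda>a e. g ((x, e), a)) a ys) [])"
      by (rule exec_WhileFalse) (simp add: S_def)
    then show ?case by (intro exI conjI) auto
  next
    case (Cons e zs)
    let ?a = "foldl (\<lambda>a e. g ((x, e), a)) a ys"
    let ?b = "foldl (\<lambda>a e. g ((x, e), a)) a (ys @ [e])"
    let ?s = "(S x ?a (e # zs))(0 := enc ((x, e), ?a))"
    let ?s' = "(S x ?a (e # zs))(0 := enc ?b)"
    obtain t where t: "t \<le> G ((x, e), ?a)" "exec P (clean_store (enc ((x, e), ?a))) t (clean_store (enc ?b))"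
      using P[of "((x, e), ?a)"] by auto
    have 1: "exec (Assign 0 ?E) (S x ?a (e # zs)) (1 + expr_cost ?E) ?s"
      by (rule exec_Assign_eq) (use K in \<open>auto simp: S_def clean_store_def\<close>)
    have "exec P ?s t (?s(0 := enc ?b))"
      by (rule exec_frame_clean[OF t(2) K(2)]) (use K in \<open>auto simp: S_def clean_store_def\<close>)
    then have 2: "exec P ?s t ?s'" by simp
    have 3: "exec (Assign K (TlE (Var K))) ?s' (1 + expr_cost (TlE (Var K))) (S x ?b zs)"
      by (rule exec_Assign_eq) (use K in \<open>auto simp: S_def clean_store_def fun_eq_iff\<close>)
    obtain u where u: "u \<le> length zs * (h + 20) + 2"
      "exec (While (Var K) ?L) (S x ?b zs) u (S x (foldl (\<lambda>a e. g ((x, e), a)) a (ys @ e # zs)) [])"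
      using Cons.IH[of "ys @ [e]"] Cons.prems by auto
    have "exec (While (Var K) ?L) (S x ?a (e # zs))
        (1 + expr_cost (Var K) + (1 + expr_cost ?E + (t + (1 + expr_cost (TlE (Var K))))) + u)
        (S x (foldl (\<lambda>a e. g ((x, e), a)) a (ys @ e # zs)) [])"
      by (rule exec_WhileTrue[OF _ exec_Seq[OF 1 exec_Seq[OF 2 3]] u(2)]) (simp add: S_def)
    moreover have "t \<le> h" using t(1) Cons.prems[of ys e zs] by simp
    ultimately show ?case using u(1) by (intro exI conjI) auto
  qed
  have "\<exists>t\<le>length (snd (snd z)) * (H z + 20) + 20. exec ?R (clean_store (enc z)) t
      (clean_store (enc (foldl (\<lambda>a e. g ((fst z, e), a)) (fst (snd z)) (snd (snd z)))))" for z
  proof -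
    obtain x a xs where z: "z = (x, a, xs)" by (cases z)
    let ?s0 = "clean_store (enc z)"
    let ?s1 = "?s0(K := enc xs)"
    let ?s2 = "?s1(Suc K := enc x)"
    let ?r = "foldl (\<lambda>a e. g ((x, e), a)) a xs"
    have 1: "exec (Assign K (TlE (TlE (Var 0)))) ?s0 (1 + expr_cost (TlE (TlE (Var 0)))) ?s1"
      by (rule exec_Assign_eq) (auto simp: clean_store_def z)
    have 2: "exec (Assign (Suc K) (HdE (Var 0))) ?s1 (1 + expr_cost (HdE (Var 0))) ?s2"
      by (rule exec_Assign_eq) (use K in \<open>auto simp: clean_store_def z\<close>)
    have 3: "exec (Assign 0 (HdE (TlE (Var 0)))) ?s2 (1 + expr_cost (HdE (TlE (Var 0)))) (S x a xs)"
      by (rule exec_Assign_eq) (use K in \<open>auto simp: clean_store_def z S_def fun_eq_iff\<close>)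
    obtain t where t: "t \<le> length xs * (H z + 20) + 2"
      "exec (While (Var K) ?L) (S x a xs) t (S x ?r [])"
      using loop[of "[]" xs x a "H z"] G[of xs] by (auto simp: z)
    have 4: "exec (Assign (Suc K) NilE) (S x ?r []) (1 + expr_cost NilE) (clean_store (enc ?r))"
      by (rule exec_Assign_eq) (use K in \<open>auto simp: clean_store_def S_def fun_eq_iff\<close>)
    have "exec ?R ?s0 (1 + expr_cost (TlE (TlE (Var 0))) + (1 + expr_cost (HdE (Var 0)) +
      (1 + expr_cost (HdE (TlE (Var 0))) + (t + (1 + expr_cost NilE))))) (clean_store (enc ?r))"
      by (intro exec_Seq[OF 1 exec_Seq[OF 2 exec_Seq[OF 3 exec_Seq[OF t(2) 4]]]])
    then show ?thesis using t(1) unfolding z by (intro exI conjI) auto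
  qed
  then show ?thesis unfolding computes_def by blast
qed

section \<open>Polynomial-time functions\<close>

text \<open>The size of the result needs its own bound: \<open>ConsE (Var 0) (Var 0)\<close> doubles
  a tree at constant cost, so a polynomial number of steps can build an exponentially large value.
  Closure under composition rests on the first conjunct.\<close>

definition poly_time :: "('a::enc \<Rightarrow> 'b::enc) \<Rightarrow> bool" where
  "poly_time f \<longleftrightarrow> poly_bounded (\<lambda>x. sz (f x)) \<and> (\<exists>T. poly_bounded T \<and> computes f T)"

named_theorems poly_time_intros

lemma poly_time_pb: "poly_time f \<Longrightarrow> poly_bounded (\<lambda>x. sz (f x))"
  by (simp add: poly_time_def)

lemma poly_time_comp:
  assumes "poly_time g" "poly_time f" shows "poly_time (\<lambda>x. g (f x))"
proof -
  obtain T U where T: "poly_bounded T" "computes f T" and U: "poly_bounded U" "computes g U"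
    using assms unfolding poly_time_def by blast
  have "poly_bounded (\<lambda>x. T x + U (f x))" by (intro poly_bd_add T poly_bd_comp[OF U(1)] poly_time_pb[OF assms(2)])
  with computes_comp[OF T(2) U(2)] poly_bd_comp[OF poly_time_pb[OF assms(1)] poly_time_pb[OF assms(2)]] show ?thesis
    unfolding poly_time_def by blast
qed

lemma poly_time_expr:
  assumes "\<And>x. eval_expr e (clean_store (enc x)) = enc (f x)" "poly_bounded (\<lambda>x. sz (f x))"
  shows "poly_time f"
  unfolding poly_time_def using assms(2) computes_expr[of e f, OF assms(1)] poly_bd_const by blast

primrec tree_expr :: "tree \<Rightarrow> expr" where
  "tree_expr Leaf = NilE"
| "tree_expr (Node l r) = ConsE (tree_expr l) (tree_expr r)"

lemma eval_tree_expr [simp]: "eval_expr (tree_expr t) s = t"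
  by (induction t) auto

lemma poly_time_const [poly_time_intros]: "poly_time (\<lambda>_. c)"
  by (rule poly_time_expr[of "tree_expr (enc c)"]) (auto intro: poly_bd_const)

lemma poly_time_id [poly_time_intros]: "poly_time (\<lambda>x. x)"
  by (rule poly_time_expr[of "Var 0"]) (auto simp: clean_store_def intro: poly_bd_sz)

lemma poly_time_fst [poly_time_intros]: "poly_time f \<Longrightarrow> poly_time (\<lambda>x. fst (f x))"
  by (rule poly_time_comp[of fst], rule poly_time_expr[of "HdE (Var 0)"])
     (auto simp: clean_store_def enc_prod_def intro: poly_bd_mono[OF poly_bd_sz sz_fst_le])

lemma poly_time_snd [poly_time_intros]: "poly_time f \<Longrightarrow> poly_time (\<lambda>x. snd (f x))"
  by (rule poly_time_comp[of snd], rule poly_time_expr[of "TlE (Var 0)"])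
     (auto simp: clean_store_def enc_prod_def intro: poly_bd_mono[OF poly_bd_sz sz_snd_le])

lemma poly_time_pair [poly_time_intros]:
  assumes "poly_time f" "poly_time g" shows "poly_time (\<lambda>x. (f x, g x))"
proof -
  obtain T U where T: "poly_bounded T" "computes f T" and U: "poly_bounded U" "computes g U"
    using assms unfolding poly_time_def by blast
  have "poly_bounded (\<lambda>x. T x + U x + 20)" by (intro poly_bd_add T U poly_bd_const)
  with computes_pair[OF T(2) U(2)] poly_bd_sz_pair[OF assms[THEN poly_time_pb]] show ?thesis
    unfolding poly_time_def by blast
qed

lemma poly_time_If [poly_time_intros]:
  assumes "poly_time b" "poly_time f" "poly_time g" shows "poly_time (\<lambda>x. if b x then f x else g x)"
proof -
  obtain S T U where S: "poly_bounded S" "computes b S" and T: "poly_bounded T" "computes f T" and U: "poly_bounded U" "computes g U"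
    using assms unfolding poly_time_def by blast
  have "poly_bounded (\<lambda>x. S x + T x + U x + 20)" by (intro poly_bd_add S T U poly_bd_const)
  moreover have "poly_bounded (\<lambda>x. sz (if b x then f x else g x))"
    by (rule poly_bd_mono[OF poly_bd_add[OF poly_time_pb[OF assms(2)] poly_time_pb[OF assms(3)]]]) auto
  ultimately show ?thesis using computes_If[OF S(2) T(2) U(2)] unfolding poly_time_def by blast
qed

lemma poly_time_Cons [poly_time_intros]:
  assumes "poly_time f" "poly_time g" shows "poly_time (\<lambda>x. f x # g x)"
proof -
  have "eval_expr (Var 0) (clean_store (enc p)) = enc (fst p # snd p)" for p :: "'b \<times> 'b list"
    by (cases p) (simp add: clean_store_def)
  moreover have "sz (fst p # snd p) = sz p" for p :: "'b \<times> 'b list"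
    by (cases p) simp
  ultimately have "poly_time (\<lambda>p. fst p # snd p :: 'b list)"
    using poly_bd_sz by (intro poly_time_expr[of "Var 0"]) simp_all
  from poly_time_comp[OF this poly_time_pair[OF assms]] show ?thesis by simp
qed

lemma poly_time_tl [poly_time_intros]:
  assumes "poly_time f" shows "poly_time (\<lambda>x. tl (f x))"
proof -
  have "eval_expr (TlE (Var 0)) (clean_store (enc xs)) = enc (tl xs)" for xs :: "'b list"
    by (cases xs) (auto simp: clean_store_def)
  from poly_time_comp[OF poly_time_expr[OF this poly_bd_mono[OF poly_bd_sz sz_tl_le]] assms] show ?thesis .
qed

text \<open>The default \<open>False\<close> agrees with the selector of the machine, since
  \<open>hd_tree Leaf = Leaf\<close> is the code of \<open>False\<close>.\<close>

definition hdb :: "bool list \<Rightarrow> bool" where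
  "hdb bs \<longleftrightarrow> bs \<noteq> [] \<and> hd bs"

lemma hdb_simps [simp]: "hdb [] = False" "hdb (b # bs) = b"
  by (auto simp: hdb_def)

lemma poly_bd_sz_bool: "poly_bounded (\<lambda>x. sz (b x :: bool))"
  by (rule poly_bd_mono[OF poly_bd_const[where n = 1]]) (rule sz_bool)

lemma poly_time_hdb [poly_time_intros]:
  assumes "poly_time f" shows "poly_time (\<lambda>x. hdb (f x))"
proof -
  have "eval_expr (HdE (Var 0)) (clean_store (enc bs)) = enc (hdb bs)" for bs
    by (cases bs) (auto simp: clean_store_def)
  from poly_time_comp[OF poly_time_expr[OF this poly_bd_sz_bool] assms] show ?thesis .
qed

text \<open>Branching on a list works because a nonempty list, like \<open>True\<close>, is a nonempty tree.\<close>

lemma poly_time_null [poly_time_intros]: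
  fixes f :: "'a::enc \<Rightarrow> 'b::enc list"
  assumes "poly_time f" shows "poly_time (\<lambda>x. f x = [])"
proof -
  let ?P = "If (Var 0) (Assign 0 NilE) (Assign 0 (ConsE NilE NilE))"
  have "\<exists>t\<le>10. exec ?P (clean_store (enc xs)) t (clean_store (enc (xs = [])))" for xs :: "'b list"
  proof (cases xs)
    case Nil
    have "exec (Assign 0 (ConsE NilE NilE)) (clean_store (enc xs)) (1 + expr_cost (ConsE NilE NilE))
        (clean_store (enc (xs = [])))"
      by (rule exec_Assign_eq) (auto simp: clean_store_def Nil)
    from exec_IfFalse[OF _ this, of "Var 0"]
    have "exec ?P (clean_store (enc xs)) (1 + expr_cost (Var 0) + (1 + expr_cost (ConsE NilE NilE)))
        (clean_store (enc (xs = [])))" by (simp add: clean_store_def Nil)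
    then show ?thesis by - (rule exI, rule conjI[rotated], assumption, simp)
  next
    case (Cons y ys)
    have "exec (Assign 0 NilE) (clean_store (enc xs)) (1 + expr_cost NilE) (clean_store (enc (xs = [])))"
      by (rule exec_Assign_eq) (auto simp: clean_store_def Cons)
    from exec_IfTrue[OF _ this, of "Var 0"]
    have "exec ?P (clean_store (enc xs)) (1 + expr_cost (Var 0) + (1 + expr_cost NilE))
        (clean_store (enc (xs = [])))" by (simp add: clean_store_def Cons)
    then show ?thesis by - (rule exI, rule conjI[rotated], assumption, simp)
  qed
  then have "poly_time (\<lambda>xs::'b list. xs = [])"
    unfolding poly_time_def computes_def by (intro conjI exI poly_bd_sz_bool) (rule poly_bd_const[where n = 10], blast)
  from poly_time_comp[OF this assms] show ?thesis .
qed

lemma poly_time_conj [poly_time_intros]: "poly_time f \<Longrightarrow> poly_time g \<Longrightarrow> poly_time (\<lambda>x. f x \<and> g x)"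
  by (rule back_subst[where P = poly_time, OF poly_time_If[of f g "\<lambda>_. False", OF _ _ poly_time_const]]) auto

lemma poly_time_not [poly_time_intros]: "poly_time f \<Longrightarrow> poly_time (\<lambda>x. \<not> f x)"
  by (rule back_subst[where P = poly_time, OF poly_time_If[of f "\<lambda>_. False" "\<lambda>_. True", OF _ poly_time_const poly_time_const]]) auto

lemma poly_time_disj [poly_time_intros]: "poly_time f \<Longrightarrow> poly_time g \<Longrightarrow> poly_time (\<lambda>x. f x \<or> g x)"
  using poly_time_not[OF poly_time_conj[OF poly_time_not poly_time_not], of f g] by simp

lemma poly_time_imp [poly_time_intros]: "poly_time f \<Longrightarrow> poly_time g \<Longrightarrow> poly_time (\<lambda>x. f x \<longrightarrow> g x)"
  by (rule back_subst[where P = poly_time, OF poly_time_disj[OF poly_time_not, of f g]]) auto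

lemma poly_time_iff [poly_time_intros]: "poly_time f \<Longrightarrow> poly_time g \<Longrightarrow> poly_time (\<lambda>x. f x = (g x :: bool))"
  by (rule back_subst[where P = poly_time, OF poly_time_If[of f g "\<lambda>x. \<not> g x", OF _ _ poly_time_not]]) auto

lemma sz_elem_le: "e \<in> set xs \<Longrightarrow> sz e \<le> sz xs"
  by (induction xs) auto

text \<open>The bound mentions the actual sizes of the intermediate accumulators, so that it also
  covers a fold whose accumulator grows exponentially. The sum over all prefixes stands in for a
  maximum.\<close>

lemma computes_foldl_poly_time:
  fixes g :: "'x::enc \<Rightarrow> 'a::enc \<Rightarrow> 'e::enc \<Rightarrow> 'a"
  assumes g: "poly_time (\<lambda>p. g (fst (fst p)) (snd p) (snd (fst p)))"
  shows "\<exists>c. computes (\<lambda>z. foldl (g (fst z)) (fst (snd z)) (snd (snd z)))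
    (\<lambda>z. length (snd (snd z)) * ((\<Sum>j<length (snd (snd z)). (sz (fst z) + sz (snd (snd z))
      + sz (foldl (g (fst z)) (fst (snd z)) (take j (snd (snd z)))) + 4) ^ c) + 20) + 20)"
proof -
  let ?g = "\<lambda>p. g (fst (fst p)) (snd p) (snd (fst p))"
  obtain G where G: "poly_bounded G" "computes ?g G"
    using g unfolding poly_time_def by blast
  obtain c where c: "\<And>p. G p \<le> (sz p + 2) ^ c"
    using G(1) unfolding poly_bd_def by blast
  define H where "H z = (\<Sum>j<length (snd (snd z)). (sz (fst z) + sz (snd (snd z))
      + sz (foldl (g (fst z)) (fst (snd z)) (take j (snd (snd z)))) + 4) ^ c)"
    for z :: "'x \<times> 'a \<times> 'e list"
  have H: "G ((x, e), foldl (g x) b ys) \<le> H (x, b, es)" if "es = ys @ e # zs" for x b es ys e zs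
  proof -
    have "sz e \<le> sz es" by (rule sz_elem_le) (simp add: that)
    then have "G ((x, e), foldl (g x) b ys) \<le> (sz x + sz es + sz (foldl (g x) b (take (length ys) es)) + 4) ^ c"
      by (intro order.trans[OF c] power_mono) (simp_all add: that)
    also have "\<dots> \<le> H (x, b, es)"
      unfolding H_def fst_conv snd_conv
      by (rule member_le_sum[where i = "length ys"]) (use that in auto)
    finally show ?thesis .
  qed
  have "computes (\<lambda>z. foldl (g (fst z)) (fst (snd z)) (snd (snd z)))
      (\<lambda>z. length (snd (snd z)) * (H z + 20) + 20)"
    using computes_foldl[OF G(2), of H] H by simp
  then show ?thesis unfolding H_def by blast
qed

text \<open>Iterating a polynomial-time step may double the accumulator each time, hence the
  hypothesis on every intermediate accumulator.\<close>

lemma poly_time_foldl_bounded: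
  fixes g :: "'x::enc \<Rightarrow> 'a::enc \<Rightarrow> 'e::enc \<Rightarrow> 'a"
  assumes g: "poly_time (\<lambda>p. g (fst (fst p)) (snd p) (snd (fst p)))"
    and a: "poly_time a" and xs: "poly_time xs" and B: "poly_bounded B"
    and bound: "\<And>x ys zs. xs x = ys @ zs \<Longrightarrow> sz (foldl (g x) (a x) ys) \<le> B x"
  shows "poly_time (\<lambda>x. foldl (g x) (a x) (xs x))"
proof -
  obtain c where TM1: "computes (\<lambda>z. foldl (g (fst z)) (fst (snd z)) (snd (snd z)))
    (\<lambda>z. length (snd (snd z)) * ((\<Sum>j<length (snd (snd z)). (sz (fst z) + sz (snd (snd z))
      + sz (foldl (g (fst z)) (fst (snd z)) (take j (snd (snd z)))) + 4) ^ c) + 20) + 20)"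
    using computes_foldl_poly_time[OF g] by blast
  have "poly_time (\<lambda>x. (x, a x, xs x))"
    by (intro poly_time_pair poly_time_id a xs)
  then obtain T where T: "poly_bounded T" "computes (\<lambda>x. (x, a x, xs x)) T"
    unfolding poly_time_def by blast
  have "(\<Sum>j<length (xs x). (sz x + sz (xs x) + sz (foldl (g x) (a x) (take j (xs x))) + 4) ^ c)
      \<le> length (xs x) * (sz x + sz (xs x) + B x + 4) ^ c" for x
  proof -
    have "sz (foldl (g x) (a x) (take j (xs x))) \<le> B x" for j
      by (rule bound[of _ _ "drop j (xs x)"]) simp
    then have "(sz x + sz (xs x) + sz (foldl (g x) (a x) (take j (xs x))) + 4) ^ c
        \<le> (sz x + sz (xs x) + B x + 4) ^ c" for j
      by (intro power_mono) simp_all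
    from sum_bounded_above[of "{..<length (xs x)}", OF this] show ?thesis by simp
  qed
  note le = this
  have "poly_bounded (\<lambda>x. T x + (length (xs x) * (length (xs x) * (sz x + sz (xs x) + B x + 4) ^ c + 20) + 20))"
    by (intro poly_bd_add poly_bd_mult poly_bd_power poly_bd_const T poly_bd_length poly_time_pb[OF xs] poly_bd_sz B)
  moreover have "computes (\<lambda>x. foldl (g x) (a x) (xs x))
      (\<lambda>x. T x + (length (xs x) * (length (xs x) * (sz x + sz (xs x) + B x + 4) ^ c + 20) + 20))"
    using computes_comp[OF T(2) TM1] unfolding fst_conv snd_conv
    by (rule computes_mono) (intro add_mono mult_mono le order_refl; simp)
  moreover have "poly_bounded (\<lambda>x. sz (foldl (g x) (a x) (xs x)))"
    by (rule poly_bd_mono[OF B]) (rule bound[of _ _ "[]"], simp)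
  ultimately show ?thesis unfolding poly_time_def by blast
qed

text \<open>If a step adds at most an amount depending on parameter and element but not on the
  accumulator, then the increments sum up to a polynomial. Most folds below are of this
  kind.\<close>

lemma poly_time_foldl:
  fixes g :: "'x::enc \<Rightarrow> 'a::enc \<Rightarrow> 'e::enc \<Rightarrow> 'a"
  assumes g: "poly_time (\<lambda>p. g (fst (fst p)) (snd p) (snd (fst p)))"
    and a: "poly_time a" and xs: "poly_time xs"
    and h: "poly_bounded (\<lambda>p. h (fst p) (snd p))"
    and growth: "\<And>x b e. sz (g x b e) \<le> sz b + h x e"
  shows "poly_time (\<lambda>x. foldl (g x) (a x) (xs x))"
proof -
  obtain c where c: "\<And>p. h (fst p) (snd p) \<le> (sz p + 2) ^ c"
    using h unfolding poly_bd_def by blast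
  let ?B = "\<lambda>x. sz (a x) + length (xs x) * (sz x + sz (xs x) + 3) ^ c"
  have *: "sz (foldl (g x) (a x) ys) \<le> sz (a x) + length ys * (sz x + m + 3) ^ c"
    if "\<And>e. e \<in> set ys \<Longrightarrow> sz e \<le> m" for x ys m
    using that
  proof (induction ys rule: rev_induct)
    case (snoc e ys)
    have "sz (foldl (g x) (a x) (ys @ [e])) \<le> sz (foldl (g x) (a x) ys) + h x e"
      using growth by simp
    also have "h x e \<le> (sz x + m + 3) ^ c"
      using c[of "(x, e)"] snoc.prems[of e] by (auto intro!: order.trans[OF c[of "(x, e)", simplified]] power_mono)
    finally show ?case using snoc by simp
  qed simp
  show ?thesis
  proof (rule poly_time_foldl_bounded[OF g a xs])
    show "poly_bounded ?B"
      by (intro poly_bd_add poly_bd_mult poly_bd_power poly_bd_const poly_bd_length poly_time_pb[OF xs] poly_time_pb[OF a] poly_bd_sz)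
    fix x ys zs assume xs: "xs x = ys @ zs"
    have "sz (foldl (g x) (a x) ys) \<le> sz (a x) + length ys * (sz x + sz (xs x) + 3) ^ c"
      by (rule *) (use xs in \<open>auto dest: sz_elem_le\<close>)
    also have "\<dots> \<le> ?B x" using xs by simp
    finally show "sz (foldl (g x) (a x) ys) \<le> ?B x" .
  qed
qed

lemma poly_time_foldl_bool:
  assumes "poly_time (\<lambda>p. g (fst (fst p)) (snd p) (snd (fst p)))" "poly_time a" "poly_time xs"
  shows "poly_time (\<lambda>x. foldl (g x) (a x) (xs x) :: bool)"
  by (rule poly_time_foldl[OF assms poly_bd_const[where n = 1]]) (auto intro: le_trans[OF sz_bool])

section \<open>List operations and quantifiers as folds\<close>

lemma poly_time_rev [poly_time_intros]:
  assumes "poly_time xs" shows "poly_time (\<lambda>x. rev (xs x))"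
proof -
  have "poly_time (\<lambda>x. foldl (\<lambda>a e. e # a) [] (xs x))"
    by (rule poly_time_foldl[where h = "\<lambda>_ e. sz e + 1"])
       (intro poly_time_intros assms poly_bd_add poly_bd_const poly_time_pb | simp)+
  then show ?thesis by (simp add: foldl_conv_fold fold_Cons_rev)
qed

lemma poly_time_append [poly_time_intros]:
  assumes "poly_time xs" "poly_time ys" shows "poly_time (\<lambda>x. xs x @ ys x)"
proof -
  have "poly_time (\<lambda>x. foldl (\<lambda>a e. e # a) (ys x) (rev (xs x)))"
    by (rule poly_time_foldl[where h = "\<lambda>_ e. sz e + 1"])
       (intro poly_time_intros assms poly_bd_add poly_bd_const poly_time_pb | simp)+
  then show ?thesis by (simp add: foldl_conv_fold fold_Cons_rev)
qed

lemma foldl_map_rev: "foldl (\<lambda>a e. h e # a) ys xs = rev (map h xs) @ ys"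
  by (induction xs arbitrary: ys) auto

lemma poly_time_map [poly_time_intros]:
  assumes h: "poly_time (\<lambda>p. h (fst p) (snd p))" and xs: "poly_time xs"
  shows "poly_time (\<lambda>x. map (h x) (xs x))"
proof -
  have "poly_time (\<lambda>p. h (fst (fst p)) (snd (fst p)))"
    using poly_time_comp[OF h poly_time_fst[OF poly_time_id]] .
  then have "poly_time (\<lambda>x. foldl (\<lambda>a e. h x e # a) [] (xs x))"
    by (intro poly_time_foldl[where h = "\<lambda>x e. sz (h x e) + 1"] poly_time_Cons poly_time_snd poly_time_id poly_time_const xs
        poly_bd_add poly_bd_const poly_time_pb[OF h]) simp_all
  from poly_time_rev[OF this] show ?thesis by (simp add: foldl_map_rev)
qed

lemma foldl_filter_rev: "foldl (\<lambda>a e. if h e then e # a else a) ys xs = rev (filter h xs) @ ys"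
  by (induction xs arbitrary: ys) auto

lemma poly_time_filter [poly_time_intros]:
  assumes h: "poly_time (\<lambda>p. h (fst p) (snd p))" and xs: "poly_time xs"
  shows "poly_time (\<lambda>x. filter (h x) (xs x))"
proof -
  have "poly_time (\<lambda>p. h (fst (fst p)) (snd (fst p)))"
    using poly_time_comp[OF h poly_time_fst[OF poly_time_id]] .
  then have "poly_time (\<lambda>x. foldl (\<lambda>a e. if h x e then e # a else a) [] (xs x))"
    by (intro poly_time_foldl[where h = "\<lambda>x e. sz e + 1"] poly_time_intros xs poly_bd_add poly_bd_const poly_time_pb) simp_all
  from poly_time_rev[OF this] show ?thesis by (simp add: foldl_filter_rev)
qed

lemma poly_time_concat [poly_time_intros]:
  assumes "poly_time xs" shows "poly_time (\<lambda>x. concat (xs x))"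
proof -
  have "poly_time (\<lambda>x. foldl (\<lambda>a e. a @ e) [] (xs x))"
    by (rule poly_time_foldl[where h = "\<lambda>_ e. sz e"]) (intro poly_time_intros assms poly_time_pb | simp)+
  moreover have "foldl (\<lambda>a e. a @ e) ys xss = ys @ concat xss" for ys and xss :: "'b list list"
    by (induction xss arbitrary: ys) auto
  ultimately show ?thesis by simp
qed

lemma foldl_conj: "foldl (\<lambda>a e. a \<and> h e) b xs \<longleftrightarrow> b \<and> (\<forall>e\<in>set xs. h e)"
  by (induction xs arbitrary: b) auto

lemma poly_time_ball [poly_time_intros]:
  assumes h: "poly_time (\<lambda>p. h (fst p) (snd p))" and xs: "poly_time xs"
  shows "poly_time (\<lambda>x. \<forall>e\<in>set (xs x). h x e)"
proof -
  have "poly_time (\<lambda>p. h (fst (fst p)) (snd (fst p)))"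
    using poly_time_comp[OF h poly_time_fst[OF poly_time_id]] .
  then have "poly_time (\<lambda>x. foldl (\<lambda>a e. a \<and> h x e) True (xs x))"
    by (intro poly_time_foldl_bool poly_time_intros xs)
  then show ?thesis by (simp add: foldl_conj)
qed

lemma poly_time_bex [poly_time_intros]:
  assumes h: "poly_time (\<lambda>p. h (fst p) (snd p))" and xs: "poly_time xs"
  shows "poly_time (\<lambda>x. \<exists>e\<in>set (xs x). h x e)"
  using poly_time_not[OF poly_time_ball[OF poly_time_not[OF h] xs]] by simp

lemma poly_time_drop [poly_time_intros]:
  assumes "poly_time xs" "poly_time ys" shows "poly_time (\<lambda>x. drop (length (xs x)) (ys x))"
proof -
  have "foldl (\<lambda>a e. tl a) ys xs = drop (length xs) ys" for xs :: "'b list" and ys :: "'c list"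
    by (induction xs arbitrary: ys) (auto simp: drop_Suc)
  moreover have "poly_time (\<lambda>x. foldl (\<lambda>a e. tl a) (ys x) (xs x))"
    by (rule poly_time_foldl[where h = "\<lambda>_ e. 0"]) (intro poly_time_intros assms poly_time_pb poly_bd_const | simp add: sz_tl_le)+
  ultimately show ?thesis by simp
qed

text \<open>The language cannot compare trees, so two words are compared by a fold over one that
  consumes the other. The test \<open>snd s \<noteq> []\<close> notices a second word that is too
  short, the final \<open>zs = []\<close> one that is too long.\<close>

lemma foldl_eq_bools:
  "foldl (\<lambda>s e. (fst s \<and> snd s \<noteq> [] \<and> hdb (snd s) = e, tl (snd s))) (b, ys) xs = (c, zs)
    \<Longrightarrow> (c \<and> zs = []) \<longleftrightarrow> (b \<and> xs = ys)"
proof (induction xs arbitrary: b ys)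
  case (Cons x xs)
  from Cons.IH[OF Cons.prems[simplified]] show ?case by (cases ys) auto
qed auto

lemma poly_time_eq_bools [poly_time_intros]:
  assumes "poly_time xs" "poly_time ys" shows "poly_time (\<lambda>x. xs x = (ys x :: bool list))"
proof -
  let ?f = "\<lambda>xs ys. foldl (\<lambda>s e. (fst s \<and> snd s \<noteq> [] \<and> hdb (snd s) = e, tl (snd s))) (True, ys) xs"
  have growth: "sz (fst s \<and> snd s \<noteq> [] \<and> hdb (snd s) = e, tl (snd s)) \<le> sz s + 1" for s e
  proof -
    have "sz s = sz (fst s) + sz (snd s) + 1" by (cases s) simp
    then show ?thesis
      unfolding sz_simps(3) using sz_bool[of "fst s \<and> snd s \<noteq> [] \<and> hdb (snd s) = e"]
        sz_tl_le[of "snd s"] by linarith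
  qed
  have *: "poly_time (\<lambda>x. ?f (xs x) (ys x))"
    by (rule poly_time_foldl[where h = "\<lambda>_ _. 1"]) (rule growth | intro poly_time_intros assms poly_bd_const)+
  have "(fst (?f xs ys) \<and> snd (?f xs ys) = []) \<longleftrightarrow> xs = ys" for xs ys
    using foldl_eq_bools[OF prod.collapse[symmetric], of True ys xs] by simp
  moreover have "poly_time (\<lambda>x. fst (?f (xs x) (ys x)) \<and> snd (?f (xs x) (ys x)) = [])"
    by (intro poly_time_conj poly_time_fst poly_time_null poly_time_snd *)
  ultimately show ?thesis by simp
qed

lemma poly_time_comp2:
  assumes "poly_time (\<lambda>p. F (fst p) (snd p))" "poly_time f" "poly_time g" shows "poly_time (\<lambda>x. F (f x) (g x))"
  using poly_time_comp[OF assms(1) poly_time_pair[OF assms(2,3)]] by simp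

lemma poly_time_comp3:
  assumes "poly_time (\<lambda>p. F (fst p) (fst (snd p)) (snd (snd p)))" "poly_time f" "poly_time g" "poly_time h"
  shows "poly_time (\<lambda>x. F (f x) (g x) (h x))"
  using poly_time_comp[OF assms(1) poly_time_pair[OF assms(2) poly_time_pair[OF assms(3,4)]]] by simp

section \<open>The reduction as a polynomial-time function\<close>

definition num_step :: "bool list \<times> bool list \<Rightarrow> bool list \<times> bool list" where
  "num_step s = (if hdb (snd s) then (fst s @ [True, hdb (tl (snd s))], tl (tl (snd s))) else s)"

text \<open>\<open>bs\<close> doubles as the loop counter. It is long enough for any number coded at
  its beginning, and \<open>num_step\<close> is the identity once the terminator is reached.\<close>

definition num_loop :: "bool list \<Rightarrow> bool list \<times> bool list" where
  "num_loop bs = foldl (\<lambda>s _. num_step s) ([], bs) bs"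

text \<open>The number is never evaluated: a variable stays its code word, with the terminator
  restored, and comparing words is sound because \<open>encode_nat\<close> is injective. The
  \<open>tl\<close> skips the terminator in the rest.\<close>

definition parse_num :: "bool list \<Rightarrow> bool list \<times> bool list" where
  "parse_num bs = (fst (num_loop bs) @ [False], tl (snd (num_loop bs)))"

type_synonym lit = "bool list \<times> bool"

definition parse_lit :: "bool list \<Rightarrow> lit \<times> bool list" where
  "parse_lit bs = ((fst (parse_num bs), hdb (snd (parse_num bs))), tl (snd (parse_num bs)))"

definition parse_clause :: "bool list \<Rightarrow> lit list \<times> bool list" where
  "parse_clause bs =
    ([fst (parse_lit bs), fst (parse_lit (snd (parse_lit bs))),
      fst (parse_lit (snd (parse_lit (snd (parse_lit bs)))))],
     snd (parse_lit (snd (parse_lit (snd (parse_lit bs))))))"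

definition clause_step :: "lit list list \<times> bool list \<Rightarrow> lit list list \<times> bool list" where
  "clause_step s = (if snd s = [] then s
    else (fst s @ [fst (parse_clause (snd s))], snd (parse_clause (snd s))))"

definition parse_clauses :: "bool list \<Rightarrow> lit list list" where
  "parse_clauses bs = fst (foldl (\<lambda>s _. clause_step s) ([], bs) bs)"

text \<open>Both header numbers are skipped: the clauses fill the rest of the word, so its end marks
  the last clause.\<close>

definition parse_cnf :: "bool list \<Rightarrow> lit list list" where
  "parse_cnf bs = parse_clauses (snd (parse_num (snd (parse_num bs))))"

text \<open>The table \<open>w\<close> is applied periodically, after an initial segment \<open>r\<close>.  With an all-true
  initial segment of the same length, the last, incomplete period does no harm to the coverage.\<close>

primrec select :: "bool list \<Rightarrow> bool list \<Rightarrow> 'a list \<Rightarrow> 'a list" where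
  "select w r [] = []"
| "select w r (c # cs) = (let r' = (if r = [] then w else r)
    in if hdb r' then c # select w (tl r') cs else select w (tl r') cs)"

text \<open>One bit for each literal occurrence rather than each variable, which avoids collecting
  the variables; occurrences of a variable with different values are rejected by
  \<open>valid\<close>. Surplus bits are ignored, so strings of one common length serve all
  groups.\<close>

primrec assign :: "lit list \<Rightarrow> bool list \<Rightarrow> lit list" where
  "assign [] bs = []"
| "assign (l # ls) bs = (fst l, hdb bs) # assign ls (tl bs)"

definition valid :: "lit list list \<Rightarrow> lit list \<Rightarrow> bool" where
  "valid S t \<longleftrightarrow> (\<forall>c\<in>set S. \<exists>l\<in>set c. \<exists>x\<in>set t. fst x = fst l \<and> snd x = snd l)
    \<and> (\<forall>x\<in>set t. \<forall>y\<in>set t. fst x = fst y \<longrightarrow> snd x = snd y)"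

text \<open>The first component is a name. Different tables may select the same clauses, so groups
  are told apart by their names.\<close>

type_synonym group = "bool list \<times> lit list list"

definition groups :: "bool list \<Rightarrow> (bool list \<times> bool list) list \<Rightarrow> lit list list \<Rightarrow> group list" where
  "groups ones J cls = map (\<lambda>j. (fst j, select (snd j) ones cls)) J"

type_synonym item = "bool list \<times> lit list"

text \<open>Strings that differ only beyond the literals of a short group yield the same item
  several times. This does no harm, as a solution contains at most one item of each group.\<close>

definition items :: "bool list list \<Rightarrow> group list \<Rightarrow> item list" where
  "items A Q = concat (map (\<lambda>q. map (Pair (fst q))
    (filter (valid (snd q)) (map (assign (concat (snd q))) A))) Q)"

text \<open>The diagonal is included: in the coordinates with \<open>a = b\<close> the items of that
  group cost 1 each and the budget is 1, so at most one of them is chosen.\<close>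

definition dims :: "group list \<Rightarrow> (bool \<times> group \<times> group) list" where
  "dims Q = concat (map (\<lambda>f. concat (map (\<lambda>a. map (\<lambda>b. (f, a, b)) Q) Q)) [True, False])"

text \<open>\<open>row\<close> and \<open>col\<close> run through the pairs of literal occurrences
  in the same order. At equal variables the entry is the truth value given by the left, respectively
  the right assignment; elsewhere it is \<open>False\<close>. \<open>row\<close> reads only the
  variables of its second argument and \<open>col\<close> only those of its first, so the cost of an
  item needs no assignment of the other group.\<close>

definition row :: "lit list \<Rightarrow> lit list \<Rightarrow> bool list" where
  "row t us = concat (map (\<lambda>l. map (\<lambda>l'. fst l = fst l' \<and> snd l) us) t)"

definition col :: "lit list \<Rightarrow> lit list \<Rightarrow> bool list" where
  "col us t = concat (map (\<lambda>l. map (\<lambda>l'. fst l = fst l' \<and> snd l') t) us)"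

text \<open>For \<open>a \<noteq> b\<close> the coordinate \<open>(True, a, b)\<close> compares the truth values \<open>X\<close> and \<open>Y\<close> that an item
  of each subfamily gives to the shared variables: the costs are \<open>X\<close> and the complement of \<open>Y\<close>, so
  the budget allows both items iff \<open>X \<le> Y\<close> as numbers.  In \<open>(False, a, b)\<close> the complement is taken of \<open>X\<close>
  instead, which gives \<open>Y \<le> X\<close>.  The appended digit \<open>True\<close> only rules out leading zeros.\<close>

definition cost_bits :: "item \<Rightarrow> bool \<times> group \<times> group \<Rightarrow> bool list" where
  "cost_bits it fab = (if fst it = fst (fst (snd fab)) then
      (if fst it = fst (snd (snd fab)) then [True]
       else map (\<lambda>x. x = fst fab) (row (snd it) (concat (snd (snd (snd fab))))) @ [True])
    else if fst it = fst (snd (snd fab)) then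
      map (\<lambda>x. x \<noteq> fst fab) (col (concat (snd (fst (snd fab)))) (snd it)) @ [True]
    else [])"

text \<open>For different groups with N pairs of occurrences the value is (2^N - 1) + 2 * 2^N: the
  all-ones number, to which X and its complement add up, plus the digits appended to the two
  costs.\<close>

definition budget_bits :: "bool \<times> group \<times> group \<Rightarrow> bool list" where
  "budget_bits fab = (if fst (fst (snd fab)) = fst (snd (snd fab)) then [True]
    else concat (map (\<lambda>l. map (\<lambda>l'. True) (concat (snd (snd (snd fab)))))
      (concat (snd (fst (snd fab))))) @ [False, True])"

definition encode_bits :: "bool list \<Rightarrow> bool list" where
  "encode_bits bs = concat (map (\<lambda>b. [True, b]) bs) @ [False]"

primrec incr :: "bool list \<Rightarrow> bool list" where
  "incr [] = [True]"
| "incr (b # bs) = (if b then False # incr bs else True # bs)"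

definition length_bits :: "'a list \<Rightarrow> bool list" where
  "length_bits xs = foldl (\<lambda>a _. incr a) [] xs"

text \<open>\<open>Z\<close> is meant for padding coordinates with zero budget and costs, each zero
  being coded by a single \<open>False\<close>.\<close>

definition knapsack_bits :: "bool list list \<Rightarrow> group list \<Rightarrow> bool list \<Rightarrow> bool list" where
  "knapsack_bits A Q Z = encode_bits (length_bits (items A Q))
    @ (concat (map (\<lambda>ab. encode_bits (budget_bits ab)) (dims Q)) @ Z)
    @ concat (map (\<lambda>it. encode_bits [True]
        @ (concat (map (\<lambda>ab. encode_bits (cost_bits it ab)) (dims Q)) @ Z)) (items A Q))"

text \<open>Lengths are compared by dropping, without counting. The resulting list is itself the
  unary length of the truth-value strings.\<close>

definition longest :: "'a list list \<Rightarrow> 'a list" where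
  "longest xss = foldl (\<lambda>a b. if drop (length b) a = [] then b else a) [] xss"

text \<open>\<open>us\<close> acts as a unary counter. The accumulator doubles in each round: this
  is the one stage beyond polynomial time.\<close>

definition strings :: "'a list \<Rightarrow> bool list list" where
  "strings us = foldl (\<lambda>A _. map (Cons True) A @ map (Cons False) A) [[]] us"

section \<open>Polynomial time bounds for the stages of the reduction\<close>

lemma num_step_sz: "sz (num_step s) \<le> sz s + 4"
proof -
  have "sz (tl (tl (snd s))) \<le> sz (snd s)" by (meson sz_tl_le le_trans)
  moreover have "sz s = sz (fst s) + sz (snd s) + 1" by (cases s) simp
  ultimately show ?thesis
    using sz_bool[of "hdb (tl (snd s))"] by (auto simp: num_step_def)
qed

lemma poly_time_num_loop [poly_time_intros]:
  assumes "poly_time f" shows "poly_time (\<lambda>x. num_loop (f x))"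
proof -
  have "poly_time num_loop"
    unfolding num_loop_def num_step_def
    by (rule poly_time_foldl[where h = "\<lambda>_ _. 4"])
       (intro poly_time_intros poly_bd_const | rule num_step_sz[unfolded num_step_def])+
  from poly_time_comp[OF this assms] show ?thesis .
qed

lemma poly_time_parse_clause [poly_time_intros]: "poly_time f \<Longrightarrow> poly_time (\<lambda>x. parse_clause (f x))"
  unfolding parse_clause_def parse_lit_def parse_num_def by (intro poly_time_intros)

lemma num_loop_sz: "sz (snd (num_loop bs)) \<le> sz bs"
proof -
  have step: "sz (snd (num_step s)) \<le> sz (snd s)" for s
    by (auto simp: num_step_def intro: le_trans[OF sz_tl_le sz_tl_le])
  have "sz (snd (foldl (\<lambda>s _. num_step s) s xs)) \<le> sz (snd s)" for s and xs :: "bool list"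
  proof (induction xs arbitrary: s)
    case (Cons x xs)
    show ?case using le_trans[OF Cons step] by simp
  qed simp
  from this[of "([], bs)" bs] show ?thesis by (simp add: num_loop_def)
qed

lemma parse_lit_sz: "sz (snd (parse_lit bs)) \<le> sz bs"
  unfolding parse_lit_def parse_num_def snd_conv
  using num_loop_sz[of bs] sz_tl_le[of "snd (num_loop bs)"] sz_tl_le[of "tl (snd (num_loop bs))"]
  by linarith

lemma parse_clause_sz: "sz (snd (parse_clause bs)) \<le> sz bs"
  unfolding parse_clause_def snd_conv by (meson parse_lit_sz le_trans)

lemma poly_time_Pair: "poly_time (Pair c)"
  using poly_time_pair[OF poly_time_const poly_time_id] .

text \<open>The parsed clause is bounded by a polynomial in the unread word, which is part of the
  accumulator, so the rule for additive growth does not fit. Instead an invariant keeps the unread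
  word within the size of the input.\<close>

lemma poly_time_parse_clauses: "poly_time parse_clauses"
proof -
  have "poly_bounded (\<lambda>bs. sz (fst (parse_clause bs)))" by (intro poly_time_pb poly_time_intros)
  then obtain c where c: "\<And>bs. sz (fst (parse_clause bs)) \<le> (sz bs + 2) ^ c"
    unfolding poly_bd_def by blast
  let ?B = "\<lambda>bs. length bs * ((sz bs + 2) ^ c + 1) + sz bs + 1"
  have *: "sz (fst (foldl (\<lambda>s _. clause_step s) ([], bs) ys)) \<le> length ys * ((sz bs + 2) ^ c + 1)
      \<and> sz (snd (foldl (\<lambda>s _. clause_step s) ([], bs) ys)) \<le> sz bs" for bs and ys :: "bool list"
  proof (induction ys rule: rev_induct)
    case (snoc y ys)
    let ?s = "foldl (\<lambda>s _. clause_step s) ([], bs) ys"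
    have "sz (fst (parse_clause (snd ?s))) \<le> (sz bs + 2) ^ c"
      by (rule le_trans[OF c power_mono]) (use snoc in auto)
    then show ?case
      using snoc le_trans[OF parse_clause_sz, of "snd ?s" "sz bs"] by (auto simp: clause_step_def)
  qed simp
  have "poly_time (\<lambda>bs. foldl (\<lambda>s _. clause_step s) ([], bs) bs)"
  proof (rule poly_time_foldl_bounded[where B = ?B])
    show "poly_bounded ?B" by (intro poly_bd_add poly_bd_mult poly_bd_power poly_bd_const poly_bd_length poly_bd_sz)
    fix bs ys zs :: "bool list" assume "bs = ys @ zs"
    then have "length ys \<le> length bs" by simp
    then have "length ys * ((sz bs + 2) ^ c + 1) \<le> length bs * ((sz bs + 2) ^ c + 1)"
      by (rule mult_le_mono1)
    moreover have "sz s = sz (fst s) + sz (snd s) + 1" for s :: "lit list list \<times> bool list"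
      by (cases s) simp
    note this[of "foldl (\<lambda>s _. clause_step s) ([], bs) ys"]
    ultimately show "sz (foldl (\<lambda>s _. clause_step s) ([], bs) ys) \<le> ?B bs"
      using *[of bs ys] by linarith
  qed ((unfold clause_step_def)?, intro poly_time_intros poly_time_Pair)+
  from poly_time_fst[OF this] show ?thesis unfolding parse_clauses_def .
qed

lemma poly_time_parse_cnf [poly_time_intros]:
  assumes "poly_time f" shows "poly_time (\<lambda>x. parse_cnf (f x))"
  unfolding parse_cnf_def parse_num_def by (rule poly_time_comp[OF poly_time_parse_clauses]) (intro poly_time_intros assms)

lemma select_eq_foldl:
  "out @ select w r cs = snd (foldl (\<lambda>s c. (tl (if fst s = [] then w else fst s),
      if hdb (if fst s = [] then w else fst s) then snd s @ [c] else snd s)) (r, out) cs)"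
proof (induction cs arbitrary: r out)
  case (Cons c cs)
  show ?case
    using Cons[of "out @ [c]" "tl (if r = [] then w else r)"] Cons[of out "tl (if r = [] then w else r)"]
    by (simp add: Let_def)
qed simp

lemma poly_time_select [poly_time_intros]:
  assumes "poly_time w" "poly_time r" "poly_time cs" shows "poly_time (\<lambda>x. select (w x) (r x) (cs x))"
proof -
  have "sz (tl (if fst s = [] then w else fst s),
      if hdb (if fst s = [] then w else fst s) then snd s @ [c] else snd s) \<le> sz s + (sz w + sz c + 1)"
    for s :: "bool list \<times> 'b list" and w c
  proof -
    have "sz s = sz (fst s) + sz (snd s) + 1" by (cases s) simp
    then show ?thesis using sz_tl_le[of w] sz_tl_le[of "fst s"] by auto
  qed
  note growth = this
  have "poly_time (\<lambda>x. snd (foldl (\<lambda>s c. (tl (if fst s = [] then w x else fst s),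
      if hdb (if fst s = [] then w x else fst s) then snd s @ [c] else snd s)) (r x, []) (cs x)))"
    by (rule poly_time_snd, rule poly_time_foldl[where h = "\<lambda>x c. sz (w x) + sz c + 1"])
       (rule growth | intro poly_time_intros assms poly_bd_add poly_bd_const poly_time_pb poly_time_comp[OF assms(1)])+
  then show ?thesis by (simp add: select_eq_foldl[of "[]", simplified, symmetric])
qed

lemma assign_eq_foldl:
  "out @ assign ls bs = snd (foldl (\<lambda>s l. (tl (fst s), snd s @ [(fst l, hdb (fst s))])) (bs, out) ls)"
proof (induction ls arbitrary: bs out)
  case (Cons l ls)
  show ?case using Cons[of "out @ [(fst l, hdb bs)]" "tl bs"] by simp
qed simp

lemma poly_time_assign [poly_time_intros]:
  assumes "poly_time ls" "poly_time bs" shows "poly_time (\<lambda>x. assign (ls x) (bs x))"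
proof -
  have "sz (tl (fst s), snd s @ [(fst l, hdb (fst s))]) \<le> sz s + (sz l + 3)"
    for s :: "bool list \<times> lit list" and l :: lit
  proof -
    have "sz s = sz (fst s) + sz (snd s) + 1" by (cases s) simp
    then show ?thesis
      using sz_tl_le[of "fst s"] sz_fst_le[of l] sz_bool[of "hdb (fst s)"] by simp
  qed
  note growth = this
  have "poly_time (\<lambda>x. snd (foldl (\<lambda>s l. (tl (fst s), snd s @ [(fst l, hdb (fst s))])) (bs x, []) (ls x)))"
    by (rule poly_time_snd, rule poly_time_foldl[where h = "\<lambda>x l. sz l + 3"])
       (rule growth | intro poly_time_intros assms poly_bd_add poly_bd_const poly_time_pb)+
  then show ?thesis by (simp add: assign_eq_foldl[of "[]", simplified, symmetric])
qed

lemma poly_time_valid [poly_time_intros]: "poly_time S \<Longrightarrow> poly_time t \<Longrightarrow> poly_time (\<lambda>x. valid (S x) (t x))"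
  by (rule poly_time_comp2, unfold valid_def, intro poly_time_intros)

lemma poly_time_groups [poly_time_intros]: "poly_time w \<Longrightarrow> poly_time J \<Longrightarrow> poly_time cls \<Longrightarrow> poly_time (\<lambda>x. groups (w x) (J x) (cls x))"
  by (rule poly_time_comp3, unfold groups_def, intro poly_time_intros)

lemma poly_time_items [poly_time_intros]: "poly_time A \<Longrightarrow> poly_time Q \<Longrightarrow> poly_time (\<lambda>x. items (A x) (Q x))"
  by (rule poly_time_comp2, unfold items_def, intro poly_time_intros)

lemma poly_time_dims [poly_time_intros]: "poly_time Q \<Longrightarrow> poly_time (\<lambda>x. dims (Q x))"
  by (rule poly_time_comp[of dims], unfold dims_def, intro poly_time_intros)

lemma poly_time_cost_bits [poly_time_intros]: "poly_time it \<Longrightarrow> poly_time ab \<Longrightarrow> poly_time (\<lambda>x. cost_bits (it x) (ab x))"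
  by (rule poly_time_comp2, unfold cost_bits_def row_def col_def, intro poly_time_intros)

lemma poly_time_budget_bits [poly_time_intros]: "poly_time ab \<Longrightarrow> poly_time (\<lambda>x. budget_bits (ab x))"
  by (rule poly_time_comp[of budget_bits], unfold budget_bits_def, intro poly_time_intros)

lemma poly_time_encode_bits [poly_time_intros]: "poly_time bs \<Longrightarrow> poly_time (\<lambda>x. encode_bits (bs x))"
  by (rule poly_time_comp[of encode_bits], unfold encode_bits_def, intro poly_time_intros)

text \<open>One column of adding 1 in binary: the Boolean is the carry, and inequality of Booleans
  is the exclusive or.\<close>

definition carry_step :: "bool \<times> bool list \<Rightarrow> bool \<Rightarrow> bool \<times> bool list" where
  "carry_step s b = (fst s \<and> b, snd s @ [b \<noteq> fst s])"

lemma incr_eq_foldl: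
  "(let s = foldl carry_step (c, out) bs in snd s @ (if fst s then [True] else []))
    = out @ (if c then incr bs else bs)"
  by (induction bs arbitrary: c out) (auto simp: carry_step_def)

lemma poly_time_incr [poly_time_intros]:
  assumes "poly_time bs" shows "poly_time (\<lambda>x. incr (bs x))"
proof -
  have growth: "sz (carry_step s b) \<le> sz s + 3" for s b
  proof -
    have "sz s = sz (fst s) + sz (snd s) + 1" by (cases s) simp
    then show ?thesis
      using sz_bool[of "fst s \<and> b"] sz_bool[of "b \<noteq> fst s"] by (simp add: carry_step_def)
  qed
  have "poly_time (\<lambda>x. foldl carry_step (True, []) (bs x))"
    by (rule poly_time_foldl[where h = "\<lambda>_ _. 3"])
       (unfold carry_step_def, (rule growth[unfolded carry_step_def] | intro poly_time_intros assms poly_bd_const)+)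
  from this have "poly_time (\<lambda>x. snd (foldl carry_step (True, []) (bs x)) @
      (if fst (foldl carry_step (True, []) (bs x)) then [True] else []))"
    by (intro poly_time_append poly_time_If poly_time_const poly_time_snd poly_time_fst)
  then show ?thesis using incr_eq_foldl[of True "[]"] by (simp add: Let_def)
qed

lemma poly_time_length_bits [poly_time_intros]:
  assumes "poly_time xs" shows "poly_time (\<lambda>x. length_bits (xs x))"
proof -
  have growth: "sz (incr bs) \<le> sz bs + 2" for bs
    by (induction bs) auto
  show ?thesis unfolding length_bits_def
    by (rule poly_time_foldl[where h = "\<lambda>_ _. 2"]) (rule growth | intro poly_time_intros assms poly_bd_const)+
qed

lemma poly_time_longest [poly_time_intros]:
  assumes "poly_time xss" shows "poly_time (\<lambda>x. longest (xss x))"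
  unfolding longest_def
  by (rule poly_time_foldl[where h = "\<lambda>_ b. sz b"]) (intro poly_time_intros assms poly_time_pb | simp)+

type_synonym tables = "(bool list \<times> (bool list \<times> bool list) list) \<times> bool list"

definition prepare :: "tables \<times> bool list \<Rightarrow> (group list \<times> bool list) \<times> lit list" where
  "prepare z = ((groups (fst (fst (fst z))) (snd (fst (fst z))) (parse_cnf (snd z)), snd (fst z)),
    longest (map (\<lambda>q. concat (snd q))
      (groups (fst (fst (fst z))) (snd (fst (fst z))) (parse_cnf (snd z)))))"

definition produce :: "(group list \<times> bool list) \<times> bool list list \<Rightarrow> bool list" where
  "produce z = knapsack_bits (snd z) (fst (fst z)) (snd (fst z))"

text \<open>The threshold is a unary list from which each chosen item removes one element; it is
  used up iff at least that many items were chosen.\<close>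

definition decide :: "bool list \<times> bool list \<Rightarrow> bool list" where
  "decide z = [foldl (\<lambda>r b. if b then tl r else r) (fst z) (snd z) = []]"

lemma poly_time_prepare: "poly_time prepare"
  unfolding prepare_def by (intro poly_time_intros)

lemma poly_time_produce: "poly_time produce"
  unfolding produce_def knapsack_bits_def by (intro poly_time_intros)

lemma poly_time_decide: "poly_time decide"
proof -
  have "poly_time (\<lambda>z. foldl (\<lambda>r b. if b then tl r else r) (fst z) (snd z) :: bool list)"
    by (rule poly_time_foldl[where h = "\<lambda>_ _. 0"]) (intro poly_time_intros poly_bd_const | simp add: sz_tl_le)+
  then show ?thesis unfolding decide_def by (intro poly_time_Cons poly_time_null poly_time_const)
qed

section \<open>Correctness of the encodings\<close>

definition code_lit :: "literal \<Rightarrow> lit" where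
  "code_lit l = (encode_nat (fst l), snd l)"

definition clause_bits :: "literal list \<Rightarrow> bool list" where
  "clause_bits c = concat (map (\<lambda>(v, b). encode_nat v @ [b]) c)"

lemma num_loop_stuck:
  "\<not> hdb (snd s) \<Longrightarrow> foldl (\<lambda>s _. num_step s) s xs = s"
  by (induction xs) (auto simp: num_step_def)

text \<open>\<open>p\<close> is the code without its terminator. A round consumes two bits, so
  \<open>length p\<close> rounds are ample, and the surplus rounds are idle.\<close>

lemma foldl_num_step_encode_nat:
  "\<exists>p. encode_nat v = p @ [False] \<and> (\<forall>acc rest xs. length p \<le> length xs \<longrightarrow>
    foldl (\<lambda>s _. num_step s) (acc, encode_nat v @ rest) (xs :: 'a list) = (acc @ p, False # rest))"
proof (induction v rule: less_induct)
  case (less v)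
  show ?case
  proof (cases "v = 0")
    case True
    then show ?thesis
      by (intro exI[of _ "[]"]) (auto simp: encode_nat.simps[of 0] num_loop_stuck)
  next
    case False
    then have v: "encode_nat v = True # odd v # encode_nat (v div 2)"
      by (subst encode_nat.simps) simp
    obtain p where p: "encode_nat (v div 2) = p @ [False]"
      "\<And>acc rest xs. length p \<le> length xs \<Longrightarrow> foldl (\<lambda>s _. num_step s)
         (acc, encode_nat (v div 2) @ rest) (xs :: 'a list) = (acc @ p, False # rest)"
      using less[of "v div 2"] False by auto
    have "foldl (\<lambda>s _. num_step s) (acc, encode_nat v @ rest) xs
        = (acc @ True # odd v # p, False # rest)"
      if len: "Suc (Suc (length p)) \<le> length xs" for acc rest and xs :: "'a list"
    proof -
      obtain y ys where "xs = y # ys" "length p \<le> length ys" using len by (cases xs) auto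
      then show ?thesis using p(2)[of ys "acc @ [True, odd v]" rest] by (simp add: v num_step_def)
    qed
    with p(1) show ?thesis by (intro exI[of _ "True # odd v # p"]) (simp add: v)
  qed
qed

lemma parse_num_encode_nat [simp]: "parse_num (encode_nat v @ rest) = (encode_nat v, rest)"
proof -
  obtain p where p: "encode_nat v = p @ [False]"
    "\<And>acc rest xs. length p \<le> length xs \<Longrightarrow> foldl (\<lambda>s _. num_step s)
         (acc, encode_nat v @ rest) (xs :: bool list) = (acc @ p, False # rest)"
    using foldl_num_step_encode_nat[of v] by blast
  have "num_loop (encode_nat v @ rest) = ([] @ p, False # rest)"
    unfolding num_loop_def by (rule p(2)) (simp add: p(1))
  then show ?thesis by (simp add: parse_num_def p(1))
qed

lemma inj_encode_nat: "inj encode_nat"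
proof (rule injI)
  fix v w assume "encode_nat v = encode_nat w"
  then show "v = w"
  proof (induction v arbitrary: w rule: less_induct)
    case (less v)
    show ?case
    proof (cases "v = 0 \<or> w = 0")
      case True
      then show ?thesis using less.prems
        by (auto simp: encode_nat.simps[of 0] encode_nat.simps[of v] encode_nat.simps[of w] split: if_splits)
    next
      case False
      then have "odd v = odd w" "encode_nat (v div 2) = encode_nat (w div 2)"
        using less.prems by (simp_all add: encode_nat.simps[of v] encode_nat.simps[of w])
      with less.IH[of "v div 2" "w div 2"] False have "v div 2 = w div 2" by simp
      with \<open>odd v = odd w\<close> show ?thesis by presburger
    qed
  qed
qed

lemma parse_lit_bits: "parse_lit (encode_nat v @ b # rest) = (code_lit (v, b), rest)"
  by (simp add: parse_lit_def code_lit_def)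

lemma parse_clause_bits:
  assumes "length c = 3"
  shows "parse_clause (clause_bits c @ rest) = (map code_lit c, rest)"
proof -
  obtain v1 b1 v2 b2 v3 b3 where "c = [(v1, b1), (v2, b2), (v3, b3)]"
    using assms by (auto simp: numeral_3_eq_3 length_Suc_conv)
  then show ?thesis by (simp add: clause_bits_def parse_clause_def parse_lit_bits)
qed

lemma encode_nat_neq_Nil [simp]: "encode_nat v \<noteq> []"
  by (subst encode_nat.simps) simp

lemma foldl_clause_step:
  assumes "\<And>c. c \<in> set cs \<Longrightarrow> length c = 3" "length cs \<le> length xs"
  shows "foldl (\<lambda>s _. clause_step s) (acc, concat (map clause_bits cs)) xs
    = (acc @ map (map code_lit) cs, [])"
  using assms
proof (induction xs arbitrary: cs acc)
  case (Cons x xs)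
  show ?case
  proof (cases cs)
    case Nil
    then show ?thesis using Cons.IH[of "[]" acc] by (simp add: clause_step_def)
  next
    case c: (Cons c cs')
    have "clause_bits c \<noteq> []"
      using Cons.prems(1)[of c] by (cases c) (auto simp: c clause_bits_def)
    then have "clause_step (acc, clause_bits c @ concat (map clause_bits cs'))
        = (acc @ [map code_lit c], concat (map clause_bits cs'))"
      using Cons.prems(1)[of c] by (simp add: clause_step_def parse_clause_bits c)
    then show ?thesis using Cons.IH[of cs'] Cons.prems by (simp add: c)
  qed
qed simp

lemma parse_cnf_encode:
  assumes "\<And>c. c \<in> set (clauses \<phi>) \<Longrightarrow> length c = 3"
  shows "parse_cnf (encode_cnf \<phi>) = map (map code_lit) (clauses \<phi>)"
proof -
  let ?b = "concat (map clause_bits (clauses \<phi>))"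
  have enc: "encode_cnf \<phi> = encode_nat (num_vars \<phi>) @ encode_nat (length (clauses \<phi>)) @ ?b"
    by (simp add: encode_cnf_def clause_bits_def[abs_def])
  have "clause_bits c \<noteq> []" if "c \<in> set (clauses \<phi>)" for c
    using assms[OF that] by (cases c) (auto simp: clause_bits_def)
  then have "length cs \<le> length (concat (map clause_bits cs))"
    if "set cs \<subseteq> set (clauses \<phi>)" for cs
    using that
  proof (induction cs)
    case (Cons c cs)
    then have "clause_bits c \<noteq> []" by auto
    then have "Suc 0 \<le> length (clause_bits c)" by (simp add: Suc_le_eq)
    moreover have "length cs \<le> length (concat (map clause_bits cs))" using Cons by simp
    ultimately show ?case using add_mono by fastforce
  qed simp
  then have "length (clauses \<phi>) \<le> length ?b" by blast
  then show ?thesis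
    using foldl_clause_step[OF assms, of "clauses \<phi>" ?b "[]"]
    by (simp add: parse_cnf_def parse_clauses_def enc)
qed

section \<open>Binary numbers as digit lists\<close>

primrec val :: "bool list \<Rightarrow> nat" where
  "val [] = 0"
| "val (b # bs) = of_bool b + 2 * val bs"

lemma val_append [simp]: "val (xs @ ys) = val xs + 2 ^ length xs * val ys"
  by (induction xs) auto

lemma val_all_True: "False \<notin> set xs \<Longrightarrow> val xs + 1 = 2 ^ length xs"
  by (induction xs) auto

text \<open>A number and its digitwise complement add up to all ones. The parameter \<open>f\<close>
  says which of the summands is the complement, so that one statement serves both
  comparisons.\<close>

lemma val_complement: "val (map (\<lambda>x. x = f) xs) + val (map (\<lambda>x. x \<noteq> f) xs) + 1 = 2 ^ length xs"
proof (induction xs)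
  case (Cons x xs)
  have "of_bool (x = f) + of_bool (x \<noteq> f) = (1 :: nat)" by simp
  with Cons show ?case by simp
qed simp

lemma val_inject: "length xs = length ys \<Longrightarrow> val xs = val ys \<Longrightarrow> xs = ys"
proof (induction xs ys rule: list_induct2)
  case (Cons x xs y ys)
  have "x = y" using Cons.prems by (cases x; cases y) (simp_all, presburger+)
  with Cons show ?case by simp
qed simp

text \<open>Digits are least significant first, so the side condition excludes leading zeros, which
  \<open>encode_nat\<close> never writes. Huge numbers can thus be output digit by digit, without
  arithmetic.\<close>

lemma encode_nat_val: "bs = [] \<or> last bs \<Longrightarrow> encode_nat (val bs) = encode_bits bs"
proof (induction bs)
  case Nil
  then show ?case by (simp add: encode_nat.simps[of 0] encode_bits_def)
next
  case (Cons b bs)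
  have "val bs > 0" if "bs \<noteq> []" "last bs"
    using that by (induction bs) (auto split: if_splits)
  then have "val (b # bs) > 0" using Cons.prems by (cases bs) (auto split: if_splits)
  moreover have "odd (val (b # bs)) = b" "val (b # bs) div 2 = val bs"
    by auto
  ultimately show ?case
    using Cons by (subst encode_nat.simps) (auto simp: encode_bits_def split: if_splits)
qed

lemma val_incr: "val (incr bs) = Suc (val bs)" and incr_last: "incr bs \<noteq> []" "last bs \<or> bs = [] \<Longrightarrow> last (incr bs)"
  by (induction bs) (auto split: if_splits)

lemma encode_length_bits: "encode_bits (length_bits xs) = encode_nat (length xs)"
proof -
  have "val (length_bits xs) = length xs \<and> (length_bits xs = [] \<or> last (length_bits xs))"
    unfolding length_bits_def
    by (induction xs rule: rev_induct) (auto simp: val_incr incr_last)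
  with encode_nat_val[of "length_bits xs"] show ?thesis by simp
qed

lemma encode_coordinates:
  assumes "\<And>x. x \<in> set D \<Longrightarrow> g x = [] \<or> last (g x)"
  shows "concat (map (\<lambda>j. encode_nat (if j \<le> length D then val (g (D ! (j - 1))) else 0))
      [1..<length D + z + 1]) = concat (map (\<lambda>x. encode_bits (g x)) D) @ replicate z False"
proof -
  let ?f = "\<lambda>j. encode_nat (if j \<le> length D then val (g (D ! (j - 1))) else 0)"
  have "[1..<length D + z + 1] = map Suc [0..<length D] @ [length D + 1..<length D + 1 + z]"
    using upt_add_eq_append[of 1 "length D + 1" z] by (simp add: map_Suc_upt del: upt_Suc)
  moreover have "map ?f (map Suc [0..<length D]) = map (\<lambda>x. encode_bits (g x)) D"
    by (rule nth_equalityI) (simp_all add: assms encode_nat_val)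
  moreover have "concat (map ?f [n + 1..<n + 1 + z]) = replicate z False" if "n = length D" for n
    using that by (induction z) (simp_all add: encode_nat.simps[of 0] replicate_append_same)
  ultimately show ?thesis by simp
qed

section \<open>The knapsack instance of a list of groups\<close>

definition knap :: "bool list list \<Rightarrow> group list \<Rightarrow> knapsack" where
  "knap A Q = \<lparr>num_items = length (items A Q), profit = (\<lambda>_. 1),
    cost = (\<lambda>j i. if j \<le> length (dims Q) then val (cost_bits (items A Q ! i) (dims Q ! (j - 1))) else 0),
    budget = (\<lambda>j. if j \<le> length (dims Q) then val (budget_bits (dims Q ! (j - 1))) else 0)\<rparr>"

lemma encode_knap:
  "encode_knapsack (length (dims Q) + z) (knap A Q) = knapsack_bits A Q (replicate z False)"
proof -
  have "cost_bits it fab = [] \<or> last (cost_bits it fab)" for it fab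
    by (simp add: cost_bits_def)
  note c = encode_coordinates[of "dims Q" "cost_bits it" z for it, OF this]
  have "budget_bits fab = [] \<or> last (budget_bits fab)" for fab
    by (simp add: budget_bits_def)
  note b = encode_coordinates[of "dims Q" budget_bits z, OF this]
  have 1: "encode_nat (Suc 0) = encode_bits [True]"
    using encode_nat_val[of "[True]"] by simp
  have cost: "concat (map (\<lambda>j. encode_nat (cost (knap A Q) j i)) [1..<length (dims Q) + z + 1])
      = concat (map (\<lambda>ab. encode_bits (cost_bits (items A Q ! i) ab)) (dims Q)) @ replicate z False"
    for i using c[of "items A Q ! i"] by (simp add: knap_def del: upt_Suc)
  have "map (\<lambda>i. encode_nat (profit (knap A Q) i) @ concat (map (\<lambda>j. encode_nat
      (cost (knap A Q) j i)) [1..<length (dims Q) + z + 1])) [0..<length (items A Q)]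
    = map (\<lambda>i. encode_bits [True] @ (concat (map (\<lambda>ab. encode_bits
        (cost_bits (items A Q ! i) ab)) (dims Q)) @ replicate z False)) [0..<length (items A Q)]"
    unfolding cost by (simp add: knap_def 1)
  also have "\<dots> = map (\<lambda>it. encode_bits [True]
        @ (concat (map (\<lambda>ab. encode_bits (cost_bits it ab)) (dims Q)) @ replicate z False)) (items A Q)"
    (is "_ = map ?F _")
    using map_map[of ?F "\<lambda>i. items A Q ! i" "[0..<length (items A Q)]"]
    unfolding map_nth comp_def by (rule sym)
  finally show ?thesis
    using b by (simp add: encode_knapsack_def knapsack_bits_def encode_length_bits knap_def del: upt_Suc)
qed

lemma set_dims: "set (dims Q) = UNIV \<times> set Q \<times> set Q"
  by (auto simp: dims_def)

lemma length_dims: "length (dims Q) = 2 * (length Q)\<^sup>2"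
  by (simp add: dims_def length_concat sum_list_triv comp_def power2_eq_square)

lemma is_solution_knap:
  "is_solution (length (dims Q) + z) (knap A Q) S \<longleftrightarrow> S \<subseteq> {..<length (items A Q)} \<and>
    (\<forall>x\<in>set (dims Q). (\<Sum>i\<in>S. val (cost_bits (items A Q ! i) x)) \<le> val (budget_bits x))"
  (is "?L = ?R")
proof
  assume L: ?L
  have le: "(\<Sum>i\<in>S. val (cost_bits (items A Q ! i) (dims Q ! k))) \<le> val (budget_bits (dims Q ! k))"
    if "k < length (dims Q)" for k
    using L that unfolding is_solution_def by (auto dest!: bspec[of _ _ "Suc k"] simp: knap_def)
  have "S \<subseteq> {..<length (items A Q)}" using L by (auto simp: is_solution_def knap_def)
  then show ?R
  proof (intro conjI ballI)
    fix x assume "x \<in> set (dims Q)"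
    then obtain k where "k < length (dims Q)" "x = dims Q ! k" unfolding in_set_conv_nth by blast
    then show "(\<Sum>i\<in>S. val (cost_bits (items A Q ! i) x)) \<le> val (budget_bits x)"
      using le by simp
  qed
next
  assume R: ?R
  have "(\<Sum>i\<in>S. cost (knap A Q) j i) \<le> budget (knap A Q) j" if "j \<ge> 1" for j
    using R that by (cases "j \<le> length (dims Q)") (simp_all add: knap_def)
  then show ?L using R by (simp add: is_solution_def knap_def)
qed

lemma map_fst_assign [simp]: "map fst (assign ls s) = map fst ls"
  by (induction ls arbitrary: s) auto

lemma row_cong:
  assumes "map fst us = map fst vs" shows "row t us = row t vs"
proof -
  have "row t us = concat (map (\<lambda>l. map (\<lambda>v. fst l = v \<and> snd l) (map fst us)) t)" for us
    by (simp add: row_def comp_def)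
  from this[of us] this[of vs] show ?thesis by (simp only: assms)
qed

lemma col_cong:
  assumes "map fst us = map fst vs" shows "col us t = col vs t"
proof -
  have "col us t = concat (map (\<lambda>v. map (\<lambda>l'. v = fst l' \<and> snd l') t) (map fst us))" for us
    by (simp add: col_def comp_def)
  from this[of us] this[of vs] show ?thesis by (simp only: assms)
qed

lemma length_row [simp]: "length (row t us) = length t * length us"
  and length_col [simp]: "length (col us t) = length us * length t"
  by (simp_all add: row_def col_def length_concat comp_def sum_list_triv)

definition agree :: "lit list \<Rightarrow> lit list \<Rightarrow> bool" where
  "agree s t \<longleftrightarrow> (\<forall>x\<in>set s. \<forall>y\<in>set t. fst x = fst y \<longrightarrow> snd x = snd y)"

text \<open>At pairs of different variables both lists carry \<open>False\<close>; at the other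
  pairs the entries are just the truth values to be compared.\<close>

lemma row_eq_col_iff: "row s t = col s t \<longleftrightarrow> agree s t"
proof (induction s)
  case (Cons l s)
  have "row (l # s) t = map (\<lambda>l'. fst l = fst l' \<and> snd l) t @ row s t"
    "col (l # s) t = map (\<lambda>l'. fst l = fst l' \<and> snd l') t @ col s t"
    by (simp_all add: row_def col_def)
  then have "row (l # s) t = col (l # s) t \<longleftrightarrow>
      (\<forall>y\<in>set t. fst l = fst y \<longrightarrow> snd l = snd y) \<and> row s t = col s t"
    by auto
  with Cons show ?case by (auto simp: agree_def)
qed (simp add: row_def col_def agree_def)

lemma in_items:
  "it \<in> set (items A Q) \<longleftrightarrow> (\<exists>q\<in>set Q. \<exists>s\<in>set A. it = (fst q, assign (concat (snd q)) s)
    \<and> valid (snd q) (assign (concat (snd q)) s))"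
  by (auto simp: items_def)

lemma val_budget_bits:
  assumes "fst a \<noteq> fst b"
  shows "val (budget_bits (f, a, b)) + 1
    = 3 * 2 ^ (length (concat (snd a)) * length (concat (snd b)))"
proof -
  let ?xs = "concat (map (\<lambda>l. map (\<lambda>l'. True) (concat (snd b))) (concat (snd a)))"
  have "val ?xs + 1 = 2 ^ length ?xs" by (rule val_all_True) auto
  moreover have "length ?xs = length (concat (snd a)) * length (concat (snd b))"
    by (simp add: length_concat comp_def sum_list_triv)
  ultimately show ?thesis using assms by (simp add: budget_bits_def)
qed

lemma sum_two_le:
  fixes f :: "nat \<Rightarrow> nat"
  assumes "finite S" "i \<in> S" "j \<in> S" "i \<noteq> j"
  shows "f i + f j \<le> sum f S"
  using sum_mono2[of S "{i, j}" f] assms by simp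

lemma val_cost_bits_row:
  assumes "fst a \<noteq> fst b" "map fst t = map fst (concat (snd b))"
  shows "val (cost_bits (fst a, s) (f, a, b))
    = val (map (\<lambda>x. x = f) (row s t)) + 2 ^ (length s * length (concat (snd b)))"
proof -
  have "row s t = row s (concat (snd b))" by (rule row_cong[OF assms(2)])
  then show ?thesis using assms(1) by (simp add: cost_bits_def)
qed

lemma val_cost_bits_col:
  assumes "fst a \<noteq> fst b" "map fst s = map fst (concat (snd a))"
  shows "val (cost_bits (fst b, t) (f, a, b))
    = val (map (\<lambda>x. x \<noteq> f) (col s t)) + 2 ^ (length (concat (snd a)) * length t)"
proof -
  have "col s t = col (concat (snd a)) t" by (rule col_cong[OF assms(2)])
  then show ?thesis using assms(1) by (simp add: cost_bits_def)
qed

text \<open>Costs are nonnegative, so each budget bounds the costs of \<open>i\<close> and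
  \<open>j\<close> alone. Two items of one group exceed a diagonal coordinate. For different groups
  the two comparisons give equal numbers, and digit lists of equal length and value are
  equal.\<close>

lemma solution_consistent:
  assumes sol: "is_solution (length (dims Q) + z) (knap A Q) S"
    and Q: "distinct (map fst Q)" and ij: "i \<in> S" "j \<in> S" "i \<noteq> j"
  shows "fst (items A Q ! i) \<noteq> fst (items A Q ! j)" "agree (snd (items A Q ! i)) (snd (items A Q ! j))"
proof -
  let ?it = "\<lambda>i. items A Q ! i"
  have S: "S \<subseteq> {..<length (items A Q)}"
    and le: "\<And>x. x \<in> set (dims Q) \<Longrightarrow> (\<Sum>i\<in>S. val (cost_bits (?it i) x)) \<le> val (budget_bits x)"
    using sol unfolding is_solution_knap by auto
  have fin: "finite S" using S finite_subset by blast
  have "?it i \<in> set (items A Q)" "?it j \<in> set (items A Q)" using S ij by auto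
  then obtain a b s t where a: "a \<in> set Q" "?it i = (fst a, s)" "map fst s = map fst (concat (snd a))"
    and b: "b \<in> set Q" "?it j = (fst b, t)" "map fst t = map fst (concat (snd b))"
    unfolding in_items by (metis map_fst_assign)
  have two: "val (cost_bits (?it i) (f, c, d)) + val (cost_bits (?it j) (f, c, d))
      \<le> val (budget_bits (f, c, d))" if "c \<in> set Q" "d \<in> set Q" for f c d
    by (rule order.trans[OF sum_two_le[OF fin ij] le]) (use that in \<open>auto simp: set_dims\<close>)
  show ne: "fst (?it i) \<noteq> fst (?it j)"
  proof
    assume "fst (?it i) = fst (?it j)"
    with two[OF a(1) a(1), of True] a(2) b(2) show False
      by (simp add: cost_bits_def budget_bits_def)
  qed
  have len: "length s = length (concat (snd a))" "length t = length (concat (snd b))"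
    using a(3) b(3) by (metis length_map)+
  have ne': "fst a \<noteq> fst b" using ne a(2) b(2) by simp
  \<comment> \<open>The appended digits use up 2 * 2 ^ N of the budget 3 * 2 ^ N - 1, with N the
    number of pairs. What remains is the all-ones number, which turns the sum with a complement into
    a comparison below.\<close>
  have cmp: "val (map (\<lambda>x. x = f) (row s t)) + val (map (\<lambda>x. x \<noteq> f) (col s t))
      + 1 \<le> 2 ^ (length s * length t)" for f
    using two[OF a(1) b(1), of f] val_budget_bits[OF ne', of f]
      val_cost_bits_row[OF ne' b(3), of s f] val_cost_bits_col[OF ne' a(3), of t f]
    by (simp add: a(2) b(2) flip: len)
  have "val (map (\<lambda>x. x = f) (row s t)) \<le> val (map (\<lambda>x. x = f) (col s t))" for f
    using cmp[of f] val_complement[of f "col s t"] by simp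
  from this[of True] this[of False]
  have "val (row s t) \<le> val (col s t)" "val (map Not (row s t)) \<le> val (map Not (col s t))"
    by simp_all
  then have "val (row s t) = val (col s t)"
    using val_complement[of True "row s t"] val_complement[of True "col s t"] by simp
  then have "row s t = col s t" by (intro val_inject) simp_all
  then show "agree (snd (?it i)) (snd (?it j))" by (simp add: row_eq_col_iff a(2) b(2))
qed

lemma agree_map: "agree (map (\<lambda>l. (fst l, \<alpha> (fst l))) us) (map (\<lambda>l. (fst l, \<alpha> (fst l))) vs)"
  by (auto simp: agree_def)

lemma assign_take: "assign ls (map (\<lambda>l. \<alpha> (fst l)) ls @ bs) = map (\<lambda>l. (fst l, \<alpha> (fst l))) ls"
  by (induction ls) auto

text \<open>Each group contributes the restriction of \<alpha> to its variables. In an off-diagonal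
  coordinate only two of these items have a cost, and since they agree, a number and its complement
  fill the budget exactly. The strings in \<open>A\<close> may be longer than the group requires,
  hence the extension \<open>bs\<close>.\<close>

lemma solution_of_assignment:
  fixes \<alpha> :: "bool list \<Rightarrow> bool"
  assumes Q: "distinct (map fst Q)"
    and sat: "\<And>q c. q \<in> set Q \<Longrightarrow> c \<in> set (snd q) \<Longrightarrow> \<exists>l\<in>set c. \<alpha> (fst l) = snd l"
    and A: "\<And>q. q \<in> set Q \<Longrightarrow> \<exists>bs. map (\<lambda>l. \<alpha> (fst l)) (concat (snd q)) @ bs \<in> set A"
  shows "\<exists>S. is_solution (length (dims Q) + z) (knap A Q) S \<and> card S = length Q"
proof -
  let ?it = "\<lambda>i. items A Q ! i"
  let ?t = "\<lambda>q. map (\<lambda>l. (fst l, \<alpha> (fst l))) (concat (snd q))"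
  have mem: "(fst q, ?t q) \<in> set (items A Q)" if q: "q \<in> set Q" for q
  proof -
    obtain bs where bs: "map (\<lambda>l. \<alpha> (fst l)) (concat (snd q)) @ bs \<in> set A" using A[OF q] by blast
    have "valid (snd q) (?t q)"
      using sat[OF q] agree_map[of \<alpha> "concat (snd q)" "concat (snd q)"]
      unfolding valid_def agree_def by fastforce
    then have "assign (concat (snd q)) (map (\<lambda>l. \<alpha> (fst l)) (concat (snd q)) @ bs) = ?t q
      \<and> valid (snd q) (?t q)" by (simp only: assign_take simp_thms)
    then show ?thesis unfolding in_items using bs q
      by (intro bexI[of _ q] bexI[of _ "map (\<lambda>l. \<alpha> (fst l)) (concat (snd q)) @ bs"]) simp_all
  qed
  have "\<forall>q\<in>set Q. \<exists>i. i < length (items A Q) \<and> ?it i = (fst q, ?t q)"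
    using mem[unfolded in_set_conv_nth[of "(_, _)"]] by blast
  from bchoice[OF this] obtain h where h: "\<And>q. q \<in> set Q \<Longrightarrow> h q < length (items A Q)"
    "\<And>q. q \<in> set Q \<Longrightarrow> ?it (h q) = (fst q, ?t q)"
    by blast
  have inj_fst: "inj_on fst (set Q)" using Q by (simp add: distinct_map)
  have inj: "inj_on h (set Q)"
  proof (rule inj_onI)
    fix p q assume pq: "p \<in> set Q" "q \<in> set Q" "h p = h q"
    then have "fst (?it (h p)) = fst (?it (h q))" by simp
    then have "fst p = fst q" unfolding h(2)[OF pq(1)] h(2)[OF pq(2)] fst_conv .
    then show "p = q" by (rule inj_onD[OF inj_fst _ pq(1,2)])
  qed
  define S where "S = h ` set Q"
  have "(\<Sum>i\<in>S. val (cost_bits (?it i) x)) \<le> val (budget_bits x)" if "x \<in> set (dims Q)" for x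
  proof -
    obtain f a b where x: "x = (f, a, b)" by (cases x)
    have ab: "a \<in> set Q" "b \<in> set Q" using that by (auto simp: set_dims x)
    have "(\<Sum>i\<in>S. val (cost_bits (?it i) x)) = (\<Sum>q\<in>set Q. val (cost_bits (fst q, ?t q) x))"
      unfolding S_def by (subst sum.reindex[OF inj]) (simp add: h(2))
    also have "\<dots> = (\<Sum>q\<in>{a, b}. val (cost_bits (fst q, ?t q) x))"
    proof (rule sum.mono_neutral_right)
      show "\<forall>q\<in>set Q - {a, b}. val (cost_bits (fst q, ?t q) x) = 0"
      proof
        fix q assume "q \<in> set Q - {a, b}"
        then have "fst q \<noteq> fst a" "fst q \<noteq> fst b"
          using inj_fst ab unfolding inj_on_def by blast+
        then show "val (cost_bits (fst q, ?t q) x) = 0" by (simp add: x cost_bits_def)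
      qed
    qed (use ab in auto)
    also have "\<dots> \<le> val (budget_bits x)"
    proof (cases "a = b")
      case True
      then show ?thesis by (simp add: x cost_bits_def budget_bits_def)
    next
      case False
      then have ne: "fst a \<noteq> fst b" using inj_fst ab unfolding inj_on_def by blast
      have "row (?t a) (?t b) = col (?t a) (?t b)"
        using agree_map row_eq_col_iff by blast
      then show ?thesis
        using False val_budget_bits[OF ne, of f] val_complement[of f "row (?t a) (?t b)"]
          val_cost_bits_row[OF ne, of "?t b" "?t a" f] val_cost_bits_col[OF ne, of "?t a" "?t b" f]
        by (simp add: x comp_def)
    qed
    finally show ?thesis .
  qed
  moreover have "S \<subseteq> {..<length (items A Q)}" using h(1) by (auto simp: S_def)
  moreover have "card S = length Q"
    using card_image[OF inj] distinct_card[of Q] Q by (simp add: S_def distinct_map)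
  ultimately show ?thesis unfolding is_solution_knap by blast
qed

section \<open>Subfamilies of clauses with good joint coverage\<close>

text \<open>The blocks are indexed by the functions \<open>f : {..<k} \<rightarrow> {..<q}\<close>, and the \<open>i\<close>-th table marks
  the blocks with \<open>f i = 0\<close>.  These events are independent, so \<open>r\<close> tables jointly miss exactly
  the fraction \<open>(1 - 1/q)^r\<close> of the blocks.\<close>

lemma tables_exist:
  fixes q k :: nat
  assumes "q \<ge> 1"
  shows "\<exists>L W. L > 0 \<and> (\<forall>i<k. length (W i) = L \<and> q * card {p. p < L \<and> W i ! p} = L)
    \<and> (\<forall>I\<subseteq>{..<k}. q ^ card I * card {p. p < L \<and> (\<forall>i\<in>I. \<not> W i ! p)} = (q - 1) ^ card I * L)"
proof -
  let ?F = "{..<k} \<rightarrow>\<^sub>E {..<q}"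
  have "finite ?F" by (intro finite_PiE) auto
  from finite_distinct_list[OF this] obtain xs where xs: "set xs = ?F" "distinct xs"
    by (elim exE conjE)
  define L where "L = length xs"
  define W where "W i = map (\<lambda>f. f i = 0) xs" for i
  have L: "L = q ^ k"
    using distinct_card[OF xs(2)] by (simp add: L_def xs(1) card_PiE)
  have count: "card {p. p < L \<and> P (xs ! p)} = card {f\<in>?F. P f}" for P
  proof -
    have "card {p. p < L \<and> P (xs ! p)} = length (filter P xs)"
      by (simp add: L_def length_filter_conv_card)
    also have "\<dots> = card (set (filter P xs))" using distinct_card[of "filter P xs"] xs(2) by simp
    finally show ?thesis by (simp add: xs(1))
  qed
  have miss: "q ^ card I * card {p. p < L \<and> (\<forall>i\<in>I. \<not> W i ! p)} = (q - 1) ^ card I * L"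
    if I: "I \<subseteq> {..<k}" for I
  proof -
    have fin: "finite I" using I finite_subset by blast
    have "card {p. p < L \<and> (\<forall>i\<in>I. \<not> W i ! p)} = card {p. p < L \<and> (\<forall>i\<in>I. (xs ! p) i \<noteq> 0)}"
      by (rule arg_cong[where f = card]) (auto simp: W_def L_def)
    also have "\<dots> = card {f\<in>?F. \<forall>i\<in>I. f i \<noteq> 0}" by (rule count)
    \<comment> \<open>The events become a box with \<open>q - 1\<close> choices at the coordinates
      in \<open>I\<close> and \<open>q\<close> at all others, which is the independence.\<close>
    also have "{f\<in>?F. \<forall>i\<in>I. f i \<noteq> 0} = (\<Pi>\<^sub>E i\<in>{..<k}. if i \<in> I then {1..<q} else {..<q})"
    proof (rule set_eqI)
      fix f :: "nat \<Rightarrow> nat"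
      have "f i \<in> (if i \<in> I then {1..<q} else {..<q}) \<longleftrightarrow> f i < q \<and> (i \<in> I \<longrightarrow> f i \<noteq> 0)" for i
        by auto
      then show "f \<in> {f\<in>?F. \<forall>i\<in>I. f i \<noteq> 0} \<longleftrightarrow>
          f \<in> (\<Pi>\<^sub>E i\<in>{..<k}. if i \<in> I then {1..<q} else {..<q})"
        unfolding PiE_iff mem_Collect_eq lessThan_iff using I by blast
    qed
    also have "card \<dots> = (\<Prod>i<k. if i \<in> I then q - 1 else q)"
      by (simp add: card_PiE if_distrib cong: if_cong)
    also have "\<dots> = (q - 1) ^ card I * q ^ card ({..<k} - I)"
      using I by (simp add: prod.If_cases Int_absorb1 Diff_eq)
    also have "card ({..<k} - I) = k - card I" using I fin by (simp add: card_Diff_subset)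
    finally show ?thesis
      using card_mono[OF _ I] by (simp add: L power_add[symmetric])
  qed
  have "q * card {p. p < L \<and> W i ! p} = L" if "i < k" for i
  proof -
    have "card {p. p < L \<and> W i ! p} + card {p. p < L \<and> \<not> W i ! p} = card {..<L}"
      by (subst card_Un_disjoint[symmetric]) (auto intro!: arg_cong[where f = card] simp del: card_lessThan)
    moreover have "q * card {p. p < L \<and> \<not> W i ! p} = (q - 1) * L"
      using miss[of "{i}"] that by simp
    ultimately have "q * card {p. p < L \<and> W i ! p} + (q - 1) * L = q * L"
      by (metis add_mult_distrib2 card_lessThan)
    then show ?thesis using assms by (cases q) auto
  qed
  moreover have "L > 0" using assms by (simp add: L)
  ultimately show ?thesis using miss by (intro exI[of _ L] exI[of _ W]) (simp add: W_def L_def)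
qed

lemma select_eq: "select w r cs = map snd (filter fst (zip r cs)) @ select w [] (drop (length r) cs)"
proof (induction cs arbitrary: r)
  case (Cons c cs)
  show ?case
  proof (cases r)
    case (Cons b r')
    then show ?thesis using Cons.IH[of r'] by (simp add: Let_def)
  qed simp
qed simp

lemma select_Nil: "w \<noteq> [] \<Longrightarrow> select w [] cs = select w w cs"
  by (cases cs) auto

lemma set_select: "set (select w r cs) \<subseteq> set cs"
  by (induction cs arbitrary: r) (auto simp: Let_def)

lemma length_filter_zip: "length (filter fst (zip w cs)) \<le> card {p. p < length w \<and> w ! p}"
proof -
  have "length (filter fst (zip w cs)) \<le> length (filter id w)"
    by (induction w cs rule: list_induct2') auto
  then show ?thesis by (simp add: length_filter_conv_card)
qed

text \<open>Each period contributes at most the number of marked positions; the summand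
  \<open>length w\<close> rounds the last, incomplete period up.\<close>

lemma length_sel_Nil:
  assumes "w \<noteq> []"
  shows "length w * length (select w [] cs) \<le> card {p. p < length w \<and> w ! p} * (length cs + length w)"
proof (induction cs rule: length_induct)
  case (1 cs)
  let ?t = "card {p. p < length w \<and> w ! p}"
  show ?case
  proof (cases "cs = []")
    case False
    let ?n = "length (select w [] (drop (length w) cs))"
    have "length (select w [] cs) \<le> ?t + ?n"
      using length_filter_zip[of w cs] by (subst select_Nil[OF assms], subst select_eq) simp
    then have le: "length w * length (select w [] cs) \<le> length w * ?t + length w * ?n"
      by (metis add_mult_distrib2 mult_le_mono2)
    show ?thesis
    proof (cases "length w \<le> length cs")
      case True
      have "length (drop (length w) cs) < length cs" using assms False by simp
      then have "length w * ?n \<le> ?t * (length (drop (length w) cs) + length w)"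
        using 1 by blast
      then show ?thesis using le True by (simp add: algebra_simps)
    next
      case False
      then have "length w * length (select w [] cs) \<le> length w * ?t" using le by simp
      also have "\<dots> \<le> ?t * (length cs + length w)" by (simp add: algebra_simps)
      finally show ?thesis .
    qed
  qed simp
qed

text \<open>The initial segment selects at most \<open>length w\<close> clauses, a constant. The
  periodic part sees a list shorter by just that length, which pays for rounding its last period
  up.\<close>

lemma length_select:
  assumes "w \<noteq> []" "q * card {p. p < length w \<and> w ! p} = length w"
  shows "q * length (select w (replicate (length w) True) cs) \<le> q * length w + length cs"
proof -
  let ?L = "length w" and ?t = "card {p. p < length w \<and> w ! p}"
  let ?n = "length (select w [] (drop ?L cs))"
  have "length (filter fst (zip (replicate ?L True) cs)) \<le> ?L"
    by (rule order.trans[OF length_filter_le]) simp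
  then have le: "length (select w (replicate ?L True) cs) \<le> ?L + ?n"
    by (subst select_eq) simp
  have "?L * ?n \<le> ?t * length cs"
    using length_sel_Nil[OF assms(1), of "drop ?L cs"] by (cases "?L \<le> length cs") simp_all
  then have "q * (?L * ?n) \<le> q * (?t * length cs)" by (rule mult_le_mono2)
  then have "?L * (q * ?n) \<le> (q * ?t) * length cs"
    by (simp only: mult.assoc mult.left_commute)
  then have "?L * (q * ?n) \<le> ?L * length cs"
    unfolding assms(2) .
  then have "q * ?n \<le> length cs" using assms(1) by simp
  moreover have "q * length (select w (replicate ?L True) cs) \<le> q * ?L + q * ?n"
    using le by (metis add_mult_distrib2 mult_le_mono2)
  ultimately show ?thesis by linarith
qed

text \<open>A clause in the current period escapes all selections only if every table in
  \<open>I\<close> is \<open>False\<close> at its position. Again the summand \<open>L\<close>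
  rounds the last period up.\<close>

lemma card_missed_Nil:
  assumes "L > 0" "\<And>i. i \<in> I \<Longrightarrow> length (W i) = L"
  shows "L * card {c \<in> set cs. \<forall>i\<in>I. c \<notin> set (select (W i) [] cs)}
    \<le> card {p. p < L \<and> (\<forall>i\<in>I. \<not> W i ! p)} * (length cs + L)"
proof (induction cs rule: length_induct)
  case (1 cs)
  let ?M = "\<lambda>cs. {c \<in> set cs. \<forall>i\<in>I. c \<notin> set (select (W i) [] cs)}"
  let ?P = "{p. p < L \<and> (\<forall>i\<in>I. \<not> W i ! p)}"
  have select: "select (W i) [] cs = map snd (filter fst (zip (W i) cs)) @ select (W i) [] (drop L cs)"
    if "i \<in> I" for i
    using assms that by (subst select_Nil, force, subst select_eq) simp
  have "?M cs \<subseteq> (\<lambda>p. cs ! p) ` ?P \<union> ?M (drop L cs)"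
  proof
    fix c assume c: "c \<in> ?M cs"
    then obtain p where p: "p < length cs" "c = cs ! p" by (auto simp: in_set_conv_nth)
    show "c \<in> (\<lambda>p. cs ! p) ` ?P \<union> ?M (drop L cs)"
    proof (cases "p < L")
      case True
      have "\<not> W i ! p" if i: "i \<in> I" for i
      proof
        assume "W i ! p"
        then have "(True, c) \<in> set (zip (W i) cs)"
          using p True assms(2)[OF i] by (auto simp: in_set_conv_nth intro!: exI[of _ p])
        then have "c \<in> set (select (W i) [] cs)"
          unfolding select[OF i] by force
        with c i show False by blast
      qed
      with True p show ?thesis by blast
    next
      case False
      then have "c \<in> set (drop L cs)"
        using p by (auto simp: in_set_conv_nth intro!: exI[of _ "p - L"])
      moreover have "c \<notin> set (select (W i) [] (drop L cs))" if "i \<in> I" for i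
        using c that select[OF that] by auto
      ultimately show ?thesis by blast
    qed
  qed
  then have "card (?M cs) \<le> card ((\<lambda>p. cs ! p) ` ?P \<union> ?M (drop L cs))"
    by (intro card_mono) auto
  also have "\<dots> \<le> card ?P + card (?M (drop L cs))"
    by (rule order.trans[OF card_Un_le add_right_mono[OF card_image_le]]) simp
  finally have "L * card (?M cs) \<le> L * (card ?P + card (?M (drop L cs)))"
    by (rule mult_le_mono2)
  then have le: "L * card (?M cs) \<le> L * card ?P + L * card (?M (drop L cs))"
    by (simp only: add_mult_distrib2)
  show ?case
  proof (cases "cs = [] \<or> length cs < L")
    case True
    then have "L * card (?M (drop L cs)) = 0" by auto
    then have "L * card (?M cs) \<le> L * card ?P" using le by linarith
    also have "\<dots> \<le> card ?P * (length cs + L)" by (simp add: algebra_simps)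
    finally show ?thesis .
  next
    case False
    then have "length (drop L cs) < length cs" using assms(1) by simp
    then have "L * card (?M (drop L cs)) \<le> card ?P * (length (drop L cs) + L)"
      using 1 by blast
    with le False show ?thesis by (simp add: algebra_simps)
  qed
qed

text \<open>Every selection takes the first \<open>L\<close> clauses, so for nonempty
  \<open>I\<close> only the rest can be missed; the missing \<open>L\<close> clauses compensate the
  rounding, and no error term is left. For empty \<open>I\<close> no clause is covered and the bound
  is immediate.\<close>

lemma card_missed:
  assumes "L > 0" "\<And>i. i \<in> I \<Longrightarrow> length (W i) = L"
  shows "L * card {c \<in> set cs. \<forall>i\<in>I. c \<notin> set (select (W i) (replicate L True) cs)}
    \<le> card {p. p < L \<and> (\<forall>i\<in>I. \<not> W i ! p)} * length cs"
proof (cases "I = {}")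
  case True
  then show ?thesis by (simp add: card_length)
next
  case False
  let ?M = "{c \<in> set (drop L cs). \<forall>i\<in>I. c \<notin> set (select (W i) [] (drop L cs))}"
  have "{c \<in> set cs. \<forall>i\<in>I. c \<notin> set (select (W i) (replicate L True) cs)} \<subseteq> ?M"
  proof
    fix c assume c: "c \<in> {c \<in> set cs. \<forall>i\<in>I. c \<notin> set (select (W i) (replicate L True) cs)}"
    then obtain p where p: "p < length cs" "c = cs ! p" by (auto simp: in_set_conv_nth)
    have select: "select (W i) (replicate L True) cs
        = map snd (filter fst (zip (replicate L True) cs)) @ select (W i) [] (drop L cs)" for i
      by (subst select_eq) simp
    have "\<not> p < L"
    proof
      assume "p < L"
      then have "(True, c) \<in> set (zip (replicate L True) cs)"
        using p by (auto simp: in_set_conv_nth intro!: exI[of _ p])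
      then have "c \<in> set (select (W i) (replicate L True) cs)" for i
        unfolding select by force
      with c False show False by blast
    qed
    then have "c \<in> set (drop L cs)"
      using p by (auto simp: in_set_conv_nth intro!: exI[of _ "p - L"])
    with c show "c \<in> ?M" unfolding select by auto
  qed
  then have "card {c \<in> set cs. \<forall>i\<in>I. c \<notin> set (select (W i) (replicate L True) cs)} \<le> card ?M"
    by (intro card_mono) auto
  then have "L * card {c \<in> set cs. \<forall>i\<in>I. c \<notin> set (select (W i) (replicate L True) cs)} \<le> L * card ?M"
    by (rule mult_le_mono2)
  also have "\<dots> \<le> card {p. p < L \<and> (\<forall>i\<in>I. \<not> W i ! p)} * length cs"
    using card_missed_Nil[of L I W "drop L cs"] assms by (cases "L \<le> length cs") auto
  finally show ?thesis .
qed

section \<open>Completeness and soundness of the reduction\<close>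

definition table_list :: "nat \<Rightarrow> (nat \<Rightarrow> bool list) \<Rightarrow> (bool list \<times> bool list) list" where
  "table_list k W = map (\<lambda>i. (encode_nat i, W i)) [0..<k]"

lemma groups_table_list:
  "groups ones (table_list k W) cls = map (\<lambda>i. (encode_nat i, select (W i) ones cls)) [0..<k]"
  by (simp add: groups_def table_list_def)

lemma distinct_groups: "distinct (map fst (groups ones (table_list k W) cls))"
  using inj_encode_nat
  by (auto simp: groups_table_list comp_def distinct_map intro: inj_on_subset)

lemma finite_sat_counts: "finite (range (\<lambda>a. card {c \<in> set (clauses \<phi>). satisfies a c}))"
  by (rule finite_subset[of _ "{..card (set (clauses \<phi>))}"]) (auto intro: card_mono)

lemma SAT_ge: "card {c \<in> set (clauses \<phi>). satisfies a c} \<le> SAT \<phi>"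
  unfolding SAT_def by (rule Max_ge[OF finite_sat_counts]) auto

lemma SAT_full:
  assumes "SAT \<phi> = length (clauses \<phi>)"
  obtains a where "\<And>c. c \<in> set (clauses \<phi>) \<Longrightarrow> satisfies a c"
proof -
  have "SAT \<phi> \<in> range (\<lambda>a. card {c \<in> set (clauses \<phi>). satisfies a c})"
    unfolding SAT_def by (rule Max_in[OF finite_sat_counts]) auto
  then obtain a where "card {c \<in> set (clauses \<phi>). satisfies a c} = length (clauses \<phi>)"
    using assms by auto
  then have "card (set (clauses \<phi>)) \<le> card {c \<in> set (clauses \<phi>). satisfies a c}"
    by (simp add: card_length)
  then have "{c \<in> set (clauses \<phi>). satisfies a c} = set (clauses \<phi>)"
    by (intro card_seteq) auto
  with that[of a] show ?thesis by blast
qed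

lemma completeness:
  assumes "SAT \<phi> = length (clauses \<phi>)"
    and Q: "Q = groups ones (table_list k W) (map (map code_lit) (clauses \<phi>))"
    and A: "\<And>q. q \<in> set Q \<Longrightarrow> length (concat (snd q)) \<le> n" "set A = {bs. length bs = n}"
  shows "\<exists>S. is_solution (length (dims Q) + z) (knap A Q) S \<and> card S = k"
proof -
  obtain a where a: "\<And>c. c \<in> set (clauses \<phi>) \<Longrightarrow> satisfies a c"
    using SAT_full[OF assms(1)] by blast
  define \<alpha> where "\<alpha> bs = a (inv encode_nat bs)" for bs
  have "\<exists>l\<in>set c. \<alpha> (fst l) = snd l" if "q \<in> set Q" "c \<in> set (snd q)" for q c
  proof -
    have "c \<in> set (map (map code_lit) (clauses \<phi>))"
      using that set_select by (fastforce simp: Q groups_table_list)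
    then obtain c' where "c' \<in> set (clauses \<phi>)" "c = map code_lit c'" by auto
    with a[of c'] show ?thesis
      by (force simp: satisfies_def code_lit_def \<alpha>_def inv_f_f[OF inj_encode_nat])
  qed
  moreover have "\<exists>bs. map (\<lambda>l. \<alpha> (fst l)) (concat (snd q)) @ bs \<in> set A" if "q \<in> set Q" for q
    using A(1)[OF that] unfolding A(2)
    by (intro exI[of _ "replicate (n - length (concat (snd q))) True"]) simp
  ultimately show ?thesis
    using solution_of_assignment[of Q \<alpha> A z] distinct_groups Q
    by (metis (no_types, lifting) groups_table_list length_map length_upt minus_nat.diff_0)
qed

text \<open>Multiplied out to stay in the natural numbers, this says that at most a fraction (1 -
  1/q)^r of the clauses is lost. The \<open>r\<close> items belong to different groups, so the exact
  count for \<open>r\<close> tables applies to the clauses outside these groups.\<close>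

lemma soundness:
  assumes d: "distinct (map set (clauses \<phi>))"
    and Q: "Q = groups (replicate L True) (table_list k W) (map (map code_lit) (clauses \<phi>))"
    and W: "L > 0" "\<And>i. i < k \<Longrightarrow> length (W i) = L"
      "\<And>I. I \<subseteq> {..<k} \<Longrightarrow>
        q ^ card I * card {p. p < L \<and> (\<forall>i\<in>I. \<not> W i ! p)} = (q - 1) ^ card I * L"
    and q: "q \<ge> 1"
    and sol: "is_solution (length (dims Q) + z) (knap A Q) S" and S: "r \<le> card S"
  shows "q ^ r * length (clauses \<phi>) \<le> q ^ r * SAT \<phi> + (q - 1) ^ r * length (clauses \<phi>)"
proof -
  let ?it = "\<lambda>i. items A Q ! i"
  let ?cls = "map (map code_lit) (clauses \<phi>)"
  obtain T where T: "T \<subseteq> S" "card T = r" "finite T"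
    using obtain_subset_with_card_n[OF S] by metis
  have dQ: "distinct (map fst Q)" by (simp add: Q distinct_groups)
  have "\<exists>x<k. fst (?it i) = encode_nat x \<and> valid (select (W x) (replicate L True) ?cls) (snd (?it i))"
    if "i \<in> S" for i
  proof -
    have "?it i \<in> set (items A Q)" using sol that unfolding is_solution_knap by auto
    then show ?thesis by (auto simp: in_items Q groups_table_list)
  qed
  then obtain x where x: "\<And>i. i \<in> S \<Longrightarrow> x i < k" "\<And>i. i \<in> S \<Longrightarrow> fst (?it i) = encode_nat (x i)"
    "\<And>i. i \<in> S \<Longrightarrow> valid (select (W (x i)) (replicate L True) ?cls) (snd (?it i))"
    by metis
  have inj: "inj_on x T"
  proof (rule inj_onI)
    fix i j assume ij: "i \<in> T" "j \<in> T" "x i = x j"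
    then have "i \<in> S" "j \<in> S" using T(1) by auto
    then have "fst (?it i) = fst (?it j)" using x(2)[of i] x(2)[of j] ij(3) by simp
    then show "i = j" using solution_consistent(1)[OF sol dQ] ij T(1) by blast
  qed
  define I where "I = x ` T"
  have I: "I \<subseteq> {..<k}" "card I = r"
    using x(1) T(1) card_image[OF inj] T(2) by (auto simp: I_def)
  \<comment> \<open>The common assignment; variables set to true by no kept item become
    false.\<close>
  define a where "a v = (\<exists>i\<in>T. (encode_nat v, True) \<in> set (snd (?it i)))" for v
  have agree: "agree (snd (?it i)) (snd (?it j))" if "i \<in> T" "j \<in> T" for i j
  proof (cases "i = j")
    case True
    then show ?thesis using x(3)[of i] that T(1) by (auto simp: valid_def agree_def)
  next
    case False
    then show ?thesis using solution_consistent(2)[OF sol dQ] that T(1) by blast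
  qed
  have sat: "satisfies a c" if i: "i \<in> T"
    and c: "map code_lit c \<in> set (select (W (x i)) (replicate L True) ?cls)" for i c
  proof -
    have "valid (select (W (x i)) (replicate L True) ?cls) (snd (?it i))" using x(3) i T(1) by blast
    then obtain l where l: "l \<in> set c" "code_lit l \<in> set (snd (?it i))"
      using c unfolding valid_def by (fastforce simp: prod_eq_iff)
    have "a (fst l) = snd l"
    proof (cases "snd l")
      case True
      then show ?thesis using l i by (auto simp: a_def code_lit_def)
    next
      case False
      \<comment> \<open>A kept item making this variable true would disagree with item
        \<open>i\<close>, in which it is false. Here pairwise agreement is used.\<close>
      have "\<not> a (fst l)"
      proof
        assume "a (fst l)"
        then obtain j where "j \<in> T" "(encode_nat (fst l), True) \<in> set (snd (?it j))"
          by (auto simp: a_def)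
        with agree[OF i this(1)] l(2) False show False
          by (fastforce simp: agree_def code_lit_def)
      qed
      with False show ?thesis by simp
    qed
    then show ?thesis
      unfolding satisfies_def case_prod_beta by (rule bexI[OF _ l(1)])
  qed
  let ?M = "{c \<in> set ?cls. \<forall>i\<in>I. c \<notin> set (select (W i) (replicate L True) ?cls)}"
  have "inj code_lit"
    using inj_encode_nat by (auto simp: inj_def code_lit_def prod_eq_iff)
  then have injm: "inj (map code_lit)" by simp
  have "map code_lit ` {c \<in> set (clauses \<phi>). \<not> satisfies a c} \<subseteq> ?M"
    using sat by (force simp: I_def)
  then have "card (map code_lit ` {c \<in> set (clauses \<phi>). \<not> satisfies a c}) \<le> card ?M"
    by (intro card_mono) auto
  then have unsat: "card {c \<in> set (clauses \<phi>). \<not> satisfies a c} \<le> card ?M"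
    by (subst (asm) card_image[OF inj_on_subset[OF injm subset_UNIV]])
  have "distinct (clauses \<phi>)" using d by (simp add: distinct_map)
  then have "length (clauses \<phi>) = card (set (clauses \<phi>))" by (simp add: distinct_card)
  also have "\<dots> = card {c \<in> set (clauses \<phi>). satisfies a c} + card {c \<in> set (clauses \<phi>). \<not> satisfies a c}"
    by (subst card_Un_disjoint[symmetric]) (auto intro: arg_cong[where f = card])
  finally have m: "length (clauses \<phi>) \<le> SAT \<phi> + card ?M"
    using SAT_ge[of \<phi> a] unsat by linarith
  have "L * card ?M \<le> card {p. p < L \<and> (\<forall>i\<in>I. \<not> W i ! p)} * length (clauses \<phi>)"
    using card_missed[of L I W ?cls] W(1,2) I(1) by auto
  then have "q ^ r * (L * card ?M)
      \<le> q ^ r * (card {p. p < L \<and> (\<forall>i\<in>I. \<not> W i ! p)} * length (clauses \<phi>))"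
    by (rule mult_le_mono2)
  also have "\<dots> = (q - 1) ^ r * L * length (clauses \<phi>)"
    using W(3)[OF I(1)] unfolding I(2) by (simp only: mult.assoc[symmetric])
  finally have "L * (q ^ r * card ?M) \<le> L * ((q - 1) ^ r * length (clauses \<phi>))"
    by (simp only: mult_ac)
  then have "q ^ r * card ?M \<le> (q - 1) ^ r * length (clauses \<phi>)"
    using W(1) by simp
  moreover have "q ^ r * length (clauses \<phi>) \<le> q ^ r * SAT \<phi> + q ^ r * card ?M"
    using mult_le_mono2[OF m, of "q ^ r"] by (simp only: add_mult_distrib2)
  ultimately show ?thesis by linarith
qed

section \<open>Running time\<close>

lemma poly_bd_weaken: "poly_bd b g \<Longrightarrow> (\<And>x. b x \<le> b' x) \<Longrightarrow> poly_bd b' g"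
  unfolding poly_bd_def by (meson add_le_mono1 le_trans power_mono zero_le)

lemma strings_snoc: "strings (us @ [u]) = map (Cons True) (strings us) @ map (Cons False) (strings us)"
  by (simp add: strings_def)

lemma set_strings: "set (strings us) = {bs. length bs = length us}"
proof (induction us rule: rev_induct)
  case Nil
  then show ?case by (simp add: strings_def)
next
  case (snoc u us)
  have "{bs::bool list. length bs = Suc n} = Cons True ` {bs. length bs = n} \<union> Cons False ` {bs. length bs = n}" for n
    by (auto simp: length_Suc_conv)
  with snoc show ?case by (simp add: strings_snoc)
qed

lemma length_strings: "length (strings us) = 2 ^ length us"
  by (induction us rule: rev_induct) (simp_all add: strings_snoc strings_def)

lemma sz_map_Cons: "sz (map (Cons b) A) \<le> sz A + 2 * length (A :: bool list list)"
  using sz_bool[of b] by (induction A) auto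

lemma sz_strings: "sz (strings us) \<le> (2 * length us + 1) * 2 ^ length us"
proof (induction us rule: rev_induct)
  case Nil
  then show ?case by (simp add: strings_def)
next
  case (snoc u us)
  let ?A = "strings us"
  have f: "sz (map (Cons False) A) = sz A + length A" for A :: "bool list list"
    by (induction A) auto
  have "sz (strings (us @ [u])) \<le> 2 * sz ?A + 3 * length ?A"
    using sz_map_Cons[of True ?A] by (simp add: strings_snoc f)
  also have "\<dots> \<le> 2 * ((2 * length us + 1) * 2 ^ length us) + 4 * 2 ^ length us"
    using snoc by (simp add: length_strings)
  also have "\<dots> = (2 * length (us @ [u]) + 1) * 2 ^ length (us @ [u])"
    by (simp add: algebra_simps)
  finally show ?case .
qed

text \<open>Doubling leaves the polynomial calculus, so the fold bound with explicit accumulator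
  sizes is used; these are exponential only in the length of \<open>us\<close>.\<close>

lemma computes_strings:
  "\<exists>T. poly_bd (\<lambda>us. sz us + 2 ^ length us) T \<and> computes (strings :: 'a::enc list \<Rightarrow> bool list list) T"
proof -
  let ?b = "\<lambda>us::'a list. sz us + 2 ^ length us"
  let ?g = "\<lambda>(_::bool) A (_::'a). map (Cons True) A @ map (Cons False) A"
  have PTg: "poly_time (\<lambda>p. ?g (fst (fst p)) (snd p) (snd (fst p)))"
    by (intro poly_time_append poly_time_map poly_time_Cons poly_time_snd poly_time_const poly_time_id)
  then obtain c where c: "computes (\<lambda>z. foldl (?g (fst z)) (fst (snd z)) (snd (snd z)))
    (\<lambda>z. length (snd (snd z)) * ((\<Sum>j<length (snd (snd z)). (sz (fst z) + sz (snd (snd z))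
      + sz (foldl (?g (fst z)) (fst (snd z)) (take j (snd (snd z)))) + 4) ^ c) + 20) + 20)"
    using computes_foldl_poly_time[of ?g] by blast
  have "poly_time (\<lambda>us::'a list. (False, [[]] :: bool list list, us))"
    by (intro poly_time_pair poly_time_const poly_time_id)
  then obtain T where T: "poly_bounded T" "computes (\<lambda>us::'a list. (False, [[]] :: bool list list, us)) T"
    unfolding poly_time_def by blast
  let ?U = "\<lambda>us. T us + (length us * (length us * (sz us + (2 * length us + 1) * 2 ^ length us + 4) ^ c + 20) + 20)"
  have le: "(\<Sum>j<length us. (sz us + sz (strings (take j us)) + 4) ^ c)
      \<le> length us * (sz us + (2 * length us + 1) * 2 ^ length us + 4) ^ c" for us :: "'a list"
  proof -
    have "(sz us + sz (strings (take j us)) + 4) ^ c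
        \<le> (sz us + (2 * length us + 1) * 2 ^ length us + 4) ^ c" for j
    proof -
      have "sz (strings (take j us)) \<le> (2 * length (take j us) + 1) * 2 ^ length (take j us)"
        by (rule sz_strings)
      also have "\<dots> \<le> (2 * length us + 1) * 2 ^ length us"
        by (intro mult_le_mono power_increasing) simp_all
      finally show ?thesis by (intro power_mono) simp_all
    qed
    from sum_bounded_above[of "{..<length us}", OF this] show ?thesis by simp
  qed
  have "computes strings ?U"
    using computes_comp[OF T(2) c] unfolding fst_conv snd_conv strings_def[symmetric]
    by (rule computes_mono) (intro add_mono mult_mono le[THEN order.trans[rotated]] order_refl; simp)
  moreover have "poly_bd ?b ?U"
  proof -
    have s: "poly_bd ?b sz" and l: "poly_bd ?b length" and p: "poly_bd ?b (\<lambda>us. 2 ^ length us)"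
      by (rule poly_bd_mono[OF poly_bd_base], use length_le_sz in \<open>force intro: trans_le_add1\<close>)+
    have "poly_bd ?b T" by (rule poly_bd_weaken[OF T(1)]) simp
    then show ?thesis by (intro poly_bd_add poly_bd_mult poly_bd_power poly_bd_const s l p)
  qed
  ultimately show ?thesis by blast
qed

definition expand :: "(group list \<times> bool list) \<times> lit list \<Rightarrow> (group list \<times> bool list) \<times> bool list list" where
  "expand z = (fst z, strings (snd z))"

definition reduce :: "tables \<times> bool list \<Rightarrow> bool list" where
  "reduce z = produce (expand (prepare z))"

lemma computes_expand: "\<exists>T. poly_bd (\<lambda>z. sz z + 2 ^ length (snd z)) T \<and> computes expand T"
proof -
  let ?b = "\<lambda>z :: (group list \<times> bool list) \<times> lit list. sz z + 2 ^ length (snd z)"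
  obtain S where S: "poly_bd (\<lambda>us. sz us + 2 ^ length us) S" "computes (strings :: lit list \<Rightarrow> _) S"
    using computes_strings by blast
  obtain T U where T: "poly_bounded T" "computes (\<lambda>z :: (group list \<times> bool list) \<times> lit list. fst z) T"
    and U: "poly_bounded U" "computes (\<lambda>z :: (group list \<times> bool list) \<times> lit list. snd z) U"
    using poly_time_fst[OF poly_time_id, unfolded poly_time_def] poly_time_snd[OF poly_time_id, unfolded poly_time_def]
    by (elim conjE exE)
  have "poly_bd ?b (\<lambda>z. S (snd z))"
    by (rule poly_bd_comp[OF S(1)], rule poly_bd_mono[OF poly_bd_base]) (simp add: sz_snd_le)
  moreover have "poly_bd ?b T" "poly_bd ?b U"
    by (rule poly_bd_weaken[OF T(1)] poly_bd_weaken[OF U(1)], simp)+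
  ultimately have "poly_bd ?b (\<lambda>z. T z + (U z + S (snd z)) + 20)"
    by (intro poly_bd_add poly_bd_const)
  with computes_pair[OF T(2) computes_comp[OF U(2) S(2)]] show ?thesis
    unfolding expand_def by blast
qed

text \<open>The exponent \<open>c\<close> does not depend on the tables, because they are part of the argument.  This
  is what allows \<open>q\<close> to be chosen after \<open>c\<close>.\<close>

lemma computes_reduce:
  "\<exists>c. computes reduce (\<lambda>z. (sz z + 2 ^ length (snd (prepare z)) + 2) ^ c)
    \<and> (\<forall>z. sz (reduce z) \<le> (sz z + 2 ^ length (snd (prepare z)) + 2) ^ c)"
proof -
  let ?b = "\<lambda>z. sz z + 2 ^ length (snd (prepare z))"
  let ?e = "\<lambda>z :: (group list \<times> bool list) \<times> lit list. sz z + 2 ^ length (snd z)"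
  obtain S T U where S: "poly_bounded S" "computes prepare S" and T: "poly_bd ?e T" "computes expand T"
    and U: "poly_bounded U" "computes produce U"
    using poly_time_prepare[unfolded poly_time_def] poly_time_produce[unfolded poly_time_def] computes_expand by (elim conjE exE)
  have S': "poly_bd ?b S" by (rule poly_bd_weaken[OF S(1)]) simp
  have "poly_bd ?b (\<lambda>z. sz (prepare z))"
    by (rule poly_bd_weaken[OF poly_time_pb[OF poly_time_prepare]]) simp
  moreover have p: "poly_bd ?b (\<lambda>z. 2 ^ length (snd (prepare z)))"
    by (rule poly_bd_mono[OF poly_bd_base]) simp
  ultimately have e: "poly_bd ?b (\<lambda>z. ?e (prepare z))" by (intro poly_bd_add)
  have T': "poly_bd ?b (\<lambda>z. T (prepare z))" by (rule poly_bd_comp[OF T(1) e])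
  have "poly_bd ?e (\<lambda>z. sz (expand z))"
  proof -
    have "poly_bd ?e (\<lambda>z. sz z + (2 * sz z + 1) * 2 ^ length (snd z) + 1)"
      by (intro poly_bd_add poly_bd_mult poly_bd_const) (rule poly_bd_mono[OF poly_bd_base], simp)+
    then show ?thesis
    proof (rule poly_bd_mono)
      fix z :: "(group list \<times> bool list) \<times> lit list"
      have "length (snd z) \<le> sz z" using length_le_sz[of "snd z"] sz_snd_le[of z] by linarith
      then have "(2 * length (snd z) + 1) * 2 ^ length (snd z) \<le> (2 * sz z + 1) * 2 ^ length (snd z)"
        by (intro mult_le_mono1) simp
      then show "sz (expand z) \<le> sz z + (2 * sz z + 1) * 2 ^ length (snd z) + 1"
        using sz_strings[of "snd z"] sz_fst_le[of z] unfolding expand_def sz_simps by linarith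
    qed
  qed
  from poly_bd_comp[OF this e] have x: "poly_bd ?b (\<lambda>z. sz (expand (prepare z)))" .
  have U': "poly_bd ?b (\<lambda>z. U (expand (prepare z)))" by (rule poly_bd_comp[OF U(1) x])
  have "poly_bd ?b (\<lambda>z. (S z + T (prepare z)) + U (expand (prepare z)) + sz (reduce z))"
    unfolding reduce_def by (intro poly_bd_add S' T' U' poly_bd_comp[OF poly_time_pb[OF poly_time_produce] x])
  then obtain c where c: "\<And>z. S z + T (prepare z) + U (expand (prepare z)) + sz (reduce z) \<le> (?b z + 2) ^ c"
    unfolding poly_bd_def by blast
  have c1: "S z + T (prepare z) + U (expand (prepare z)) \<le> (?b z + 2) ^ c" for z
    by (rule order.trans[OF le_add1 c])
  have c2: "sz (reduce z) \<le> (?b z + 2) ^ c" for z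
    by (rule order.trans[OF le_add2 c])
  have "computes reduce (\<lambda>z. (?b z + 2) ^ c)"
    using computes_comp[OF computes_comp[OF S(2) T(2)] U(2)] unfolding reduce_def[symmetric]
    by (rule computes_mono[OF _ c1])
  with c2 show ?thesis by (intro exI[of _ c] conjI allI)
qed

lemma length_encode_nat: "length (encode_nat v) \<le> 2 * v + 1"
proof (induction v rule: less_induct)
  case (less v)
  show ?case
  proof (cases "v = 0")
    case False
    then have "length (encode_nat v) = 2 + length (encode_nat (v div 2))"
      by (subst encode_nat.simps) simp
    moreover have "length (encode_nat (v div 2)) \<le> 2 * (v div 2) + 1" using less False by simp
    moreover have "v div 2 + 1 \<le> v" using False by presburger
    ultimately show ?thesis by linarith
  qed (simp add: encode_nat.simps[of 0])
qed

lemma sz_bits_le: "sz (bs :: bool list) \<le> 2 * length bs"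
proof (induction bs)
  case (Cons b bs)
  then show ?case using sz_bool[of b] by simp
qed simp

text \<open>Every clause contains a variable, so counting by variables bounds the number of clauses.
  The occurrence bound thus turns an exponent of order m/q into one of order D n/q.\<close>

lemma num_clauses_le:
  assumes "is_3sat D \<phi>"
  shows "length (clauses \<phi>) \<le> D * num_vars \<phi>"
proof -
  have "distinct (clauses \<phi>)" using assms by (simp add: is_3sat_def distinct_map)
  then have "length (clauses \<phi>) = card (set (clauses \<phi>))" by (simp add: distinct_card)
  also have "set (clauses \<phi>) \<subseteq> (\<Union>v<num_vars \<phi>. {c \<in> set (clauses \<phi>). v \<in> fst ` set c})"
  proof
    fix c assume c: "c \<in> set (clauses \<phi>)"
    then have "length c = 3" "fst ` set c \<subseteq> {..<num_vars \<phi>}" using assms by (auto simp: is_3sat_def)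
    moreover from this obtain l where "l \<in> set c" by (cases c) auto
    ultimately show "c \<in> (\<Union>v<num_vars \<phi>. {c \<in> set (clauses \<phi>). v \<in> fst ` set c})"
      using c by blast
  qed
  then have "card (set (clauses \<phi>))
      \<le> card (\<Union>v<num_vars \<phi>. {c \<in> set (clauses \<phi>). v \<in> fst ` set c})"
    by (intro card_mono) auto
  also have "\<dots> \<le> (\<Sum>v<num_vars \<phi>. card {c \<in> set (clauses \<phi>). v \<in> fst ` set c})"
    by (rule card_UN_le) simp
  also have "\<dots> \<le> (\<Sum>v<num_vars \<phi>. D)"
    using assms by (intro sum_mono) (auto simp: is_3sat_def)
  finally show ?thesis by (simp add: mult.commute)
qed

lemma length_encode_cnf:
  assumes "is_3sat D \<phi>"
  shows "length (encode_cnf \<phi>) \<le> (8 * D + 2) * (num_vars \<phi> + 1) ^ 2"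
proof -
  let ?n = "num_vars \<phi>" and ?m = "length (clauses \<phi>)"
  have "length (clause_bits c) \<le> 6 * ?n + 6" if c: "c \<in> set (clauses \<phi>)" for c
  proof -
    have len: "length c = 3" and sub: "fst ` set c \<subseteq> {..<?n}"
      using assms c by (auto simp: is_3sat_def)
    have "length (encode_nat v @ [b]) \<le> 2 * ?n + 2" if "(v, b) \<in> set c" for v b
    proof -
      have "v < ?n" using sub that by force
      then show ?thesis using length_encode_nat[of v] by simp
    qed
    then have "(\<Sum>l\<leftarrow>c. length (case l of (v, b) \<Rightarrow> encode_nat v @ [b])) \<le> (\<Sum>l\<leftarrow>c. 2 * ?n + 2)"
      by (intro sum_list_mono) auto
    then show ?thesis by (simp add: clause_bits_def length_concat comp_def sum_list_triv len)
  qed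
  then have "(\<Sum>c\<leftarrow>clauses \<phi>. length (clause_bits c)) \<le> (\<Sum>c\<leftarrow>clauses \<phi>. 6 * ?n + 6)"
    by (intro sum_list_mono) auto
  then have "length (concat (map clause_bits (clauses \<phi>))) \<le> ?m * (6 * ?n + 6)"
    by (simp add: length_concat comp_def sum_list_triv)
  moreover have "encode_cnf \<phi> = encode_nat ?n @ encode_nat ?m @ concat (map clause_bits (clauses \<phi>))"
    by (simp add: encode_cnf_def clause_bits_def[abs_def])
  ultimately have "length (encode_cnf \<phi>) \<le> (2 * ?n + 1) + (2 * ?m + 1) + ?m * (6 * ?n + 6)"
    using length_encode_nat[of ?n] length_encode_nat[of ?m] by simp
  also have "\<dots> \<le> (2 * ?n + 1) + (2 * (D * ?n) + 1) + (D * ?n) * (6 * ?n + 6)"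
    using num_clauses_le[OF assms] by (intro add_mono mult_le_mono) simp_all
  also have "\<dots> \<le> (8 * D + 2) * (?n + 1) ^ 2"
    by (simp add: power2_eq_square algebra_simps)
  finally show ?thesis .
qed

lemma longest_snoc: "longest (xss @ [b]) = (if length (longest xss) \<le> length b then b else longest xss)"
  by (simp add: longest_def)

lemma length_le_longest: "xs \<in> set xss \<Longrightarrow> length xs \<le> length (longest xss)"
  and longest_mem: "longest xss \<in> set xss \<or> longest xss = []"
  by (induction xss rule: rev_induct) (auto simp: longest_snoc longest_def)

lemma length_concat_3: "(\<And>c. c \<in> set cs \<Longrightarrow> length c = 3) \<Longrightarrow> length (concat cs) = 3 * length cs"
  by (induction cs) auto

section \<open>The distinguishing algorithm\<close>

text \<open>The O-bound holds for large arguments; the finitely many other values are absorbed into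
  \<open>A\<close>. The exponent is rounded up, and the base n + 1 covers n = 0.\<close>

lemma bigo_powr_bound:
  assumes "T \<in> O(\<lambda>n. real n powr C)" "C \<ge> 0"
  shows "\<exists>A::nat. \<forall>n. T n \<le> real A * (real n + 1) ^ nat \<lceil>C\<rceil>"
proof -
  obtain a where a: "a > 0" "eventually (\<lambda>n. norm (T n) \<le> a * norm (real n powr C)) at_top"
    using landau_o.bigE[OF assms(1)] by blast
  then obtain N where N: "\<And>n. n \<ge> N \<Longrightarrow> \<bar>T n\<bar> \<le> a * (real n powr C)"
    by (auto simp: eventually_at_top_linorder)
  let ?C = "nat \<lceil>C\<rceil>"
  define A where "A = nat \<lceil>a + (\<Sum>i<N. \<bar>T i\<bar>)\<rceil>"
  have A: "a + (\<Sum>i<N. \<bar>T i\<bar>) \<le> real A" unfolding A_def by linarith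
  have s: "0 \<le> (\<Sum>i<N. \<bar>T i\<bar>)" by (intro sum_nonneg) simp
  have "T n \<le> real A * (real n + 1) ^ ?C" for n
  proof (cases "n < N")
    case True
    then have "\<bar>T n\<bar> \<le> (\<Sum>i<N. \<bar>T i\<bar>)" by (intro member_le_sum) auto
    then have "T n \<le> real A * 1" using A a(1) by linarith
    also have "\<dots> \<le> real A * (real n + 1) ^ ?C" by (intro mult_left_mono) simp_all
    finally show ?thesis .
  next
    case False
    have "real n powr C \<le> (real n + 1) powr C" using assms(2) by (intro powr_mono2) auto
    also have "\<dots> \<le> (real n + 1) powr real ?C" using assms(2) by (intro powr_mono) auto
    also have "\<dots> = (real n + 1) ^ ?C" by (simp add: powr_realpow)
    finally have "real n powr C \<le> (real n + 1) ^ ?C" .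
    moreover have "a \<le> real A" using A s by linarith
    ultimately have "a * (real n powr C) \<le> real A * (real n + 1) ^ ?C"
      by (intro mult_mono) auto
    then show ?thesis using N[of n] False by simp
  qed
  then show ?thesis by blast
qed

text \<open>The guarantee and the time bound of the knapsack algorithm are separate existence
  statements about runs; this makes them speak of the same run.\<close>

lemma runs_deterministic: "runs P x y t \<Longrightarrow> runs P x z u \<Longrightarrow> t = u"
  unfolding runs_def using exec_deterministic by blast

lemma decide_item_set:
  assumes "S \<subseteq> {..<num_items K}"
  shows "decide (rl, encode_item_set K S) = [length rl \<le> card S]"
proof -
  have "foldl (\<lambda>r b. if b then tl r else r) rl bs = drop (length (filter id bs)) rl" for rl bs :: "bool list"
    by (induction bs arbitrary: rl) (auto simp: drop_Suc)
  moreover have "length (filter id (encode_item_set K S)) = card S"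
  proof -
    have "{i. i < num_items K \<and> i \<in> S} = S" using assms by auto
    then show ?thesis by (simp add: length_filter_conv_card encode_item_set_def cong: conj_cong)
  qed
  ultimately show ?thesis by (simp add: decide_def)
qed

text \<open>Each item contributes at least one bit to the code, so the answer, one bit per item, is
  no longer than the instance.\<close>

lemma num_items_le: "num_items K \<le> length (encode_knapsack d K)"
proof -
  have "encode_nat v \<noteq> []" for v by simp
  then have "1 \<le> length (encode_nat v)" for v by (simp add: Suc_le_eq)
  then have "(\<Sum>i\<leftarrow>[0..<num_items K]. 1) \<le> (\<Sum>i\<leftarrow>[0..<num_items K]. length (encode_nat (profit K i)
      @ concat (map (\<lambda>j. encode_nat (cost K j i)) [1..<d + 1])))"
    by (intro sum_list_mono) (simp add: trans_le_add1)
  then show ?thesis by (simp add: encode_knapsack_def length_concat comp_def sum_list_triv)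
qed

lemma card_le_OPT:
  assumes "is_solution d (knap A Q) S" shows "card S \<le> OPT d (knap A Q)"
proof -
  have "finite {S. is_solution d (knap A Q) S}"
    by (rule finite_subset[of _ "Pow {..<num_items (knap A Q)}"]) (auto simp: is_solution_def)
  then have "total_profit (knap A Q) S \<le> OPT d (knap A Q)"
    unfolding OPT_def using assms by (intro Max_ge) auto
  then show ?thesis by (simp add: total_profit_def knap_def)
qed

text \<open>The first claim bounds the length of the truth-value strings, with 3 literals for each
  of at most L + m/q clauses, and thereby the exponential part of the time. The second gives both
  sides of the gap; \<open>card\<close> is the profit, as all profits are 1.\<close>

lemma reduction_correct:
  fixes \<phi> :: cnf and k q z L :: nat and W :: "nat \<Rightarrow> bool list"
  assumes phi: "is_3sat D \<phi>"
    and W: "L > 0" "\<And>i. i < k \<Longrightarrow> length (W i) = L"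
      "\<And>i. i < k \<Longrightarrow> q * card {p. p < L \<and> W i ! p} = L"
      "\<And>I. I \<subseteq> {..<k} \<Longrightarrow>
        q ^ card I * card {p. p < L \<and> (\<forall>i\<in>I. \<not> W i ! p)} = (q - 1) ^ card I * L"
    and q: "q \<ge> 1"
  defines "x \<equiv> (((replicate L True, table_list k W), replicate z False), encode_cnf \<phi>)"
  shows "q * length (snd (prepare x)) \<le> 3 * (q * L + length (clauses \<phi>))"
    and "\<exists>A Q. reduce x = encode_knapsack (2 * k\<^sup>2 + z) (knap A Q)
      \<and> (SAT \<phi> = length (clauses \<phi>) \<longrightarrow> k \<le> OPT (2 * k\<^sup>2 + z) (knap A Q))
      \<and> (\<forall>S r. is_solution (2 * k\<^sup>2 + z) (knap A Q) S \<longrightarrow> r \<le> card S \<longrightarrow>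
           q ^ r * length (clauses \<phi>) \<le> q ^ r * SAT \<phi> + (q - 1) ^ r * length (clauses \<phi>))"
proof -
  let ?cls = "map (map code_lit) (clauses \<phi>)"
  define Q where "Q = groups (replicate L True) (table_list k W) ?cls"
  have len3: "length c = 3" if "c \<in> set (clauses \<phi>)" for c
    using phi that by (auto simp: is_3sat_def)
  have parse: "parse_cnf (encode_cnf \<phi>) = ?cls" using parse_cnf_encode len3 by blast
  define u where "u = longest (map (\<lambda>q. concat (snd q)) Q)"
  have prep: "prepare x = ((Q, replicate z False), u)"
    by (simp add: prepare_def x_def parse Q_def u_def)
  have lenQ: "length (dims Q) = 2 * k\<^sup>2"
    by (simp add: length_dims Q_def groups_table_list)
  show "q * length (snd (prepare x)) \<le> 3 * (q * L + length (clauses \<phi>))"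
  proof (cases "u = []")
    case False
    then have "u \<in> set (map (\<lambda>q. concat (snd q)) Q)" using longest_mem u_def by metis
    then obtain i where i: "i < k" "u = concat (select (W i) (replicate L True) ?cls)"
      by (auto simp: Q_def groups_table_list)
    have "length u = 3 * length (select (W i) (replicate L True) ?cls)"
      unfolding i(2) using set_select[of "W i" "replicate L True" ?cls] len3
      by (intro length_concat_3) auto
    moreover have "q * length (select (W i) (replicate L True) ?cls) \<le> q * L + length ?cls"
      using length_select[of "W i" q ?cls] W(1-3) i(1) by auto
    ultimately show ?thesis by (simp add: prep)
  qed (simp add: prep)
  let ?A = "strings u"
  have "reduce x = encode_knapsack (2 * k\<^sup>2 + z) (knap ?A Q)"
    using encode_knap[of Q z ?A] by (simp add: reduce_def expand_def prep produce_def lenQ)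
  moreover have "k \<le> OPT (2 * k\<^sup>2 + z) (knap ?A Q)" if sat: "SAT \<phi> = length (clauses \<phi>)"
  proof -
    have "length (concat (snd q)) \<le> length u" if "q \<in> set Q" for q
    proof -
      have "concat (snd q) \<in> set (map (\<lambda>q. concat (snd q)) Q)" using that by auto
      then show ?thesis unfolding u_def by (rule length_le_longest)
    qed
    then obtain S where "is_solution (2 * k\<^sup>2 + z) (knap ?A Q) S" "card S = k"
      using completeness[OF sat Q_def, of "length u" ?A z] set_strings[of u] lenQ by auto
    then show ?thesis using card_le_OPT by metis
  qed
  moreover have "q ^ r * length (clauses \<phi>) \<le> q ^ r * SAT \<phi> + (q - 1) ^ r * length (clauses \<phi>)"
    if "is_solution (2 * k\<^sup>2 + z) (knap ?A Q) S" "r \<le> card S" for S r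
    using soundness[OF _ Q_def W(1,2,4) q, of z ?A S r] phi that lenQ by (auto simp: is_3sat_def)
  ultimately show "\<exists>A Q. reduce x = encode_knapsack (2 * k\<^sup>2 + z) (knap A Q)
      \<and> (SAT \<phi> = length (clauses \<phi>) \<longrightarrow> k \<le> OPT (2 * k\<^sup>2 + z) (knap A Q))
      \<and> (\<forall>S r. is_solution (2 * k\<^sup>2 + z) (knap A Q) S \<longrightarrow> r \<le> card S \<longrightarrow>
           q ^ r * length (clauses \<phi>) \<le> q ^ r * SAT \<phi> + (q - 1) ^ r * length (clauses \<phi>))"
    by blast
qed

text \<open>Half of the rate is held in reserve to absorb the polynomial factor.\<close>

lemma poly_times_exp_bigo:
  fixes \<delta> :: real
  assumes "\<delta> > 0"
  shows "(\<lambda>n. B * (real n + 1) ^ p * 2 powr (\<delta> / 2 * real n)) \<in> O(\<lambda>n. 2 powr (\<delta> * real n))"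
  using assms by real_asymp

text \<open>\<open>k\<close> is the largest number with 2k^2 \<le> d, and \<open>z\<close> counts
  the padding coordinates. For d \<ge> 2 this gives k \<ge> 1, hence d/2 < (k + 1)^2 \<le> 4k^2 and
  d < 9k^2, the origin of the 3 in \<rho>.\<close>

lemma split_dimension:
  fixes d :: nat
  assumes "d \<ge> 2"
  shows "\<exists>k z. d = 2 * k\<^sup>2 + z \<and> sqrt (real d) \<le> 3 * real k"
proof -
  define k where "k = nat \<lfloor>sqrt (real d / 2)\<rfloor>"
  have k: "real k \<le> sqrt (real d / 2)" "sqrt (real d / 2) < real k + 1"
    unfolding k_def by (simp_all add: of_nat_nat)
  have "(real k)\<^sup>2 \<le> real d / 2" using power_mono[OF k(1), of 2] by simp
  then have "real (2 * k\<^sup>2) \<le> real d" by simp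
  then have le: "2 * k\<^sup>2 \<le> d" by linarith
  have "1 \<le> sqrt (real d / 2)" using assms by simp
  then have k1: "real k \<ge> 1" unfolding k_def by (simp add: le_nat_floor)
  have "real d / 2 < (real k + 1)\<^sup>2" using power_strict_mono[OF k(2), of 2] by simp
  also have "\<dots> \<le> (2 * real k)\<^sup>2" using k1 by (intro power_mono) auto
  finally have "real d \<le> (3 * real k)\<^sup>2" by (simp add: power2_eq_square)
  then have "sqrt (real d) \<le> 3 * real k" by (simp add: real_le_lsqrt)
  with le show ?thesis by (intro exI[of _ k] exI[of _ "d - 2 * k\<^sup>2"]) simp
qed

text \<open>The four summands are the times of the reduction, of the knapsack algorithm on its output,
  of the clean-up, and of the final test; \<open>y ^ c\<close> bounds the size \<open>N\<close> of the instance.\<close>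

lemma total_time_bound:
  fixes y :: nat
  assumes "y \<ge> 2" "N \<le> y ^ c" "s \<le> 2 * N"
  shows "(k0 + y ^ c) + (A * (N + 1) ^ C) + k1 + (k2 + (h + s + 3) ^ e)
    \<le> (k0 + 1 + A * 2 ^ C + k1 + k2 + (h + 5) ^ e) * y ^ (c * (C + e + 1))"
proof -
  let ?E = "c * (C + e + 1)"
  have E: "y ^ i \<le> y ^ ?E" if "i \<le> ?E" for i using assms(1) that by (intro power_increasing) auto
  have 1: "1 \<le> y ^ i" for i using assms(1) by simp
  have "y ^ c \<le> y ^ ?E" by (rule E) simp
  moreover have "k0 * 1 \<le> k0 * y ^ ?E" by (rule mult_le_mono2[OF 1])
  ultimately have a: "k0 + y ^ c \<le> (k0 + 1) * y ^ ?E" unfolding add_mult_distrib by linarith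
  have "(N + 1) ^ C \<le> (2 * y ^ c) ^ C" using assms(2) 1[of c] by (intro power_mono) auto
  also have "\<dots> = 2 ^ C * y ^ (c * C)" by (simp add: power_mult_distrib power_mult)
  also have "\<dots> \<le> 2 ^ C * y ^ ?E" by (intro mult_le_mono2 E) simp
  finally have b: "A * (N + 1) ^ C \<le> A * 2 ^ C * y ^ ?E" by (simp add: mult.assoc)
  have "h + s + 3 \<le> (h + 3) * y ^ c + 2 * y ^ c"
  proof -
    have "(h + 3) * 1 \<le> (h + 3) * y ^ c" by (rule mult_le_mono2[OF 1])
    moreover have "s \<le> 2 * y ^ c" using assms(2,3) by simp
    ultimately have "(h + 3) * 1 + s \<le> (h + 3) * y ^ c + 2 * y ^ c" by (rule add_mono)
    then show ?thesis by (simp only: mult_1_right add_ac)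
  qed
  then have "(h + s + 3) ^ e \<le> ((h + 5) * y ^ c) ^ e" by (intro power_mono) (simp_all add: algebra_simps)
  also have "\<dots> = (h + 5) ^ e * y ^ (c * e)" by (simp add: power_mult_distrib power_mult)
  also have "\<dots> \<le> (h + 5) ^ e * y ^ ?E" by (intro mult_le_mono2 E) simp
  finally have c: "(h + s + 3) ^ e \<le> (h + 5) ^ e * y ^ ?E" .
  have "k1 \<le> k1 * y ^ ?E" "k2 \<le> k2 * y ^ ?E" using 1[of ?E] by simp_all
  with a b c show ?thesis unfolding add_mult_distrib by linarith
qed

text \<open>The rate 3D/q combines 3 bits per clause, m \<le> D n, and the share 1/q of a group. The
  initial segments contribute the factor 2 ^ (3 * L), which is constant in n.\<close>

lemma base_bound:
  fixes n m D q L l s p x :: nat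
  assumes q: "q \<ge> 1" and l: "q * l \<le> 3 * (q * L + m)" and m: "m \<le> D * n"
    and s: "s \<le> a * (n + 1)\<^sup>2"
  shows "real (p + s + 2 ^ l + 2)
    \<le> real (p + a + 2 ^ (3 * L) + 2) * (real n + 1)\<^sup>2 * 2 powr (3 * real D / real q * real n)"
proof -
  let ?X = "2 powr (3 * real D / real q * real n)"
  have "real q * real l \<le> 3 * (real q * real L + real D * real n)"
  proof -
    have "3 * (q * L + m) \<le> 3 * (q * L + D * n)" using m by simp
    with l have "q * l \<le> 3 * (q * L + D * n)" by (rule order.trans)
    then have "real (q * l) \<le> real (3 * (q * L + D * n))" by (simp only: of_nat_le_iff)
    then show ?thesis by simp
  qed
  then have "real l \<le> 3 * real L + 3 * real D / real q * real n"
    using q by (simp add: field_simps)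
  then have "2 powr real l \<le> 2 powr (3 * real L + 3 * real D / real q * real n)"
    by (intro powr_mono) auto
  then have 2: "2 ^ l \<le> 2 ^ (3 * L) * ?X"
    by (simp add: powr_add powr_realpow[symmetric])
  have X: "?X \<ge> 1" by (intro ge_one_powr_ge_zero) auto
  have n: "(real n + 1)\<^sup>2 \<ge> 1" by simp
  have nX: "(real n + 1)\<^sup>2 * ?X \<ge> ?X" "(real n + 1)\<^sup>2 * ?X \<ge> (real n + 1)\<^sup>2"
    using mult_right_mono[OF n, of ?X] mult_left_mono[OF X, of "(real n + 1)\<^sup>2"] by simp_all
  then have nX1: "(real n + 1)\<^sup>2 * ?X \<ge> 1" using X by linarith
  have "real s \<le> real a * (real n + 1)\<^sup>2" using s
    by (metis (mono_tags, opaque_lifting) of_nat_1 of_nat_add of_nat_le_iff of_nat_mult of_nat_power)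
  also have "\<dots> \<le> real a * ((real n + 1)\<^sup>2 * ?X)" using nX by (intro mult_left_mono) auto
  finally have 3: "real s \<le> real a * ((real n + 1)\<^sup>2 * ?X)" .
  have 4: "2 ^ (3 * L) * ?X \<le> 2 ^ (3 * L) * ((real n + 1)\<^sup>2 * ?X)"
    using nX by (intro mult_left_mono) auto
  have 5: "real p + 2 \<le> (real p + 2) * ((real n + 1)\<^sup>2 * ?X)"
    using mult_left_mono[OF nX1, of "real p + 2"] by simp
  have "real (p + s + 2 ^ l + 2) = (real p + 2) + real s + 2 ^ l" by simp
  also have "\<dots> \<le> (real p + 2) * ((real n + 1)\<^sup>2 * ?X) + real a * ((real n + 1)\<^sup>2 * ?X)
        + 2 ^ (3 * L) * ((real n + 1)\<^sup>2 * ?X)"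
    by (rule add_mono[OF add_mono[OF 5 3] order.trans[OF 2 4]])
  also have "\<dots> = real (p + a + 2 ^ (3 * L) + 2) * (real n + 1)\<^sup>2 * ?X"
    by (simp add: algebra_simps)
  finally show ?thesis .
qed

text \<open>The program is the reduction, the cleaned knapsack algorithm and the test for at least
  \<open>r\<close> chosen items. Its time is a constant times the power c * (C + e + 1) of a base
  that is polynomial in n times 2^(3Dn/q); the condition on \<open>q\<close> brings the exponential
  rate down to \<delta>/2.\<close>

lemma distinguisher:
  fixes \<delta> \<epsilon> :: real
  assumes red: "computes reduce (\<lambda>z. (sz z + 2 ^ length (snd (prepare z)) + 2) ^ c)"
      "\<And>z. sz (reduce z) \<le> (sz z + 2 ^ length (snd (prepare z)) + 2) ^ c"
    and dec: "computes decide (\<lambda>z. (sz z + 2) ^ e)"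
    and \<delta>: "\<delta> > 0" and q: "q \<ge> 1" "6 * real D * real (c * (C + e + 1)) \<le> \<delta> * real q"
    and r: "(real (q - 1) / real q) ^ r \<le> \<epsilon>"
    and d: "d \<ge> 2"
    and P: "knapsack_approximation_algorithm d (3 * real r / sqrt (real d)) P"
    and T: "T \<in> O(\<lambda>n. real n powr C')" "C' \<ge> 0" "nat \<lceil>C'\<rceil> = C"
      "\<And>K. \<exists>y t. runs P (encode_knapsack d K) y t \<and> real t \<le> T (length (encode_knapsack d K))"
  shows "\<exists>P'. distinguishes_in_time D \<epsilon> P' (\<lambda>n. 2 powr (\<delta> * real n))"
proof -
  obtain A :: nat where A: "\<And>n. T n \<le> real A * (real n + 1) ^ C"
    using bigo_powr_bound[OF T(1,2)] T(3) by blast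
  have alg: "\<exists>S t. runs P (encode_knapsack d K) (encode_item_set K S) t \<and> is_solution d K S \<and>
      3 * real r / sqrt (real d) * real (OPT d K) \<le> real (total_profit K S) \<and>
      t \<le> A * (length (encode_knapsack d K) + 1) ^ C" for K
  proof -
    obtain S t where S: "runs P (encode_knapsack d K) (encode_item_set K S) t" "is_solution d K S"
      "3 * real r / sqrt (real d) * real (OPT d K) \<le> real (total_profit K S)"
      using P unfolding knapsack_approximation_algorithm_def by blast
    obtain y u where u: "runs P (encode_knapsack d K) y u" "real u \<le> T (length (encode_knapsack d K))"
      using T(4) by blast
    have "t = u" by (rule runs_deterministic[OF S(1) u(1)])
    then have "real t \<le> real (A * (length (encode_knapsack d K) + 1) ^ C)"
      using order.trans[OF u(2) A] by (simp add: add.commute)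
    then show ?thesis using S by (simp only: of_nat_le_iff) blast
  qed
  obtain k z where kz: "d = 2 * k\<^sup>2 + z" "sqrt (real d) \<le> 3 * real k"
    using split_dimension[OF d] by blast
  \<comment> \<open>For fixed \<open>d\<close> and \<open>q\<close> the tables are constants: their
    existence suffices for hard-wiring them, and their size affects only constant factors.\<close>
  obtain L W where W: "L > 0" "\<And>i. i < k \<Longrightarrow> length (W i) = L"
      "\<And>i. i < k \<Longrightarrow> q * card {p. p < L \<and> W i ! p} = L"
      "\<And>I. I \<subseteq> {..<k} \<Longrightarrow>
        q ^ card I * card {p. p < L \<and> (\<forall>i\<in>I. \<not> W i ! p)} = (q - 1) ^ card I * L"
    using tables_exist[OF q(1), of k] by blast
  let ?par = "((replicate L True, table_list k W), replicate z False)"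
  let ?rl = "replicate r True"
  have pair: "\<exists>m. computes (\<lambda>x::bool list. (a, x)) (\<lambda>_. m)" for a :: "'z::enc"
    using computes_expr[of "ConsE (tree_expr (enc a)) (Var 0)" "\<lambda>x::bool list. (a, x)"]
    by (auto simp: clean_store_def)
  obtain k0 where "computes (\<lambda>x::bool list. (?par, x)) (\<lambda>_. k0)" using pair by blast
  from computes_comp[OF this red(1)] obtain P0 where P0: "\<And>x. \<exists>t\<le>k0 + (sz (?par, x)
      + 2 ^ length (snd (prepare (?par, x))) + 2) ^ c. exec P0 (clean_store (enc x)) t (clean_store (enc (reduce (?par, x))))"
    unfolding computes_def by blast
  obtain k2 where "computes (\<lambda>x::bool list. (?rl, x)) (\<lambda>_. k2)" using pair by blast
  from computes_comp[OF this dec] obtain P2 where P2: "\<And>y. \<exists>t\<le>k2 + (sz (?rl, y) + 2) ^ e.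
      exec P2 (clean_store (enc y)) t (clean_store (enc (decide (?rl, y))))"
    unfolding computes_def by blast
  obtain P1 k1 where P1: "\<And>x y t. runs P x y t \<Longrightarrow>
      exec P1 (clean_store (tree_of_bits x)) (t + k1) (clean_store (tree_of_bits y))"
    using runs_clean_program[of P] by blast
  define B where "B = k0 + 1 + A * 2 ^ C + k1 + k2 + (sz ?rl + 5) ^ e"
  define E where "E = c * (C + e + 1)"
  define a where "a = sz ?par + 1 + 2 * (8 * D + 2) + 2 ^ (3 * L) + 2"
  define U where "U n = (real B * real a ^ E) * (real n + 1) ^ (2 * E) * 2 powr (\<delta> / 2 * real n)"
    for n :: nat
  have main: "\<exists>y t. runs (P0 ;; P1 ;; P2) (encode_cnf \<phi>) y t \<and> real t \<le> U (num_vars \<phi>) \<and>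
      (SAT \<phi> = length (clauses \<phi>) \<longrightarrow> y = [True]) \<and>
      (real (SAT \<phi>) < (1 - \<epsilon>) * real (length (clauses \<phi>)) \<longrightarrow> y = [False])"
    if phi: "is_3sat D \<phi>" for \<phi>
  proof -
    let ?x = "encode_cnf \<phi>" and ?m = "length (clauses \<phi>)"
    let ?u = "snd (prepare (?par, ?x))"
    note rc = reduction_correct[OF phi W q(1), where z = z]
    obtain M Q where MQ: "reduce (?par, ?x) = encode_knapsack d (knap M Q)"
      "SAT \<phi> = ?m \<Longrightarrow> k \<le> OPT d (knap M Q)"
      "\<And>S r. is_solution d (knap M Q) S \<Longrightarrow> r \<le> card S \<Longrightarrow>
        q ^ r * ?m \<le> q ^ r * SAT \<phi> + (q - 1) ^ r * ?m"
      using rc(2) unfolding kz(1) by blast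
    let ?K = "knap M Q"
    let ?N = "length (encode_knapsack d ?K)"
    obtain S t1 where S: "runs P (encode_knapsack d ?K) (encode_item_set ?K S) t1" "is_solution d ?K S"
      "3 * real r / sqrt (real d) * real (OPT d ?K) \<le> real (total_profit ?K S)"
      "t1 \<le> A * (?N + 1) ^ C"
      using alg by blast
    have profit: "total_profit ?K S = card S" by (simp add: total_profit_def knap_def)
    have sub: "S \<subseteq> {..<num_items ?K}" using S(2) by (simp add: is_solution_def)
    define y where "y = sz (?par, ?x) + 2 ^ length ?u + 2"
    obtain t0 where t0: "t0 \<le> k0 + y ^ c" "exec P0 (clean_store (enc ?x)) t0 (clean_store (enc (encode_knapsack d ?K)))"
      using P0[of ?x] unfolding MQ(1) y_def by blast
    let ?s = "encode_item_set ?K S"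
    obtain t2 where t2: "t2 \<le> k2 + (sz (?rl, ?s) + 2) ^ e"
      "exec P2 (clean_store (enc ?s)) t2 (clean_store (enc [r \<le> card S]))"
      using P2[of ?s] unfolding decide_item_set[OF sub] by auto
    have "exec (P0 ;; P1 ;; P2) (clean_store (enc ?x)) (t0 + (t1 + k1 + t2)) (clean_store (enc [r \<le> card S]))"
      by (rule exec_Seq[OF t0(2) exec_Seq[OF P1[OF S(1), folded enc_eq_tree_of_bits] t2(2)]])
    then have "runs (P0 ;; P1 ;; P2) ?x [r \<le> card S] (t0 + (t1 + k1 + t2))"
      unfolding runs_def clean_store_def enc_eq_tree_of_bits by auto
    moreover have "real (t0 + (t1 + k1 + t2)) \<le> U (num_vars \<phi>)"
    proof -
      let ?n = "num_vars \<phi>"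
      have N: "?N \<le> y ^ c"
        using order.trans[OF length_le_sz red(2)[of "(?par, ?x)"]] unfolding MQ(1) y_def .
      have s: "sz ?s \<le> 2 * ?N"
        using sz_bits_le[of ?s] num_items_le[of ?K d] by (simp add: encode_item_set_def)
      have "t0 + (t1 + k1 + t2) \<le> (k0 + y ^ c) + (A * (?N + 1) ^ C) + k1 + (k2 + (sz ?rl + sz ?s + 3) ^ e)"
        using t0(1) S(4) t2(1) by (simp add: eval_nat_numeral)
      also have "\<dots> \<le> B * y ^ E"
        unfolding B_def E_def by (rule total_time_bound[OF _ N s]) (simp add: y_def)
      finally have "real (t0 + (t1 + k1 + t2)) \<le> real (B * y ^ E)" by (simp only: of_nat_le_iff)
      also have "\<dots> = real B * real y ^ E" by simp
      also have "\<dots> \<le> real B * (real a * (real ?n + 1)\<^sup>2 * 2 powr (3 * real D / real q * real ?n)) ^ E"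
      proof (intro mult_left_mono power_mono)
        have "sz ?x \<le> 2 * (8 * D + 2) * (?n + 1)\<^sup>2"
          using sz_bits_le[of ?x] length_encode_cnf[OF phi] by simp
        moreover have y: "y = (sz ?par + 1) + sz ?x + 2 ^ length ?u + 2"
          unfolding y_def sz_simps(3)[of ?par ?x] by simp
        ultimately have le: "sz ?x \<le> 2 * (8 * D + 2) * (?n + 1)\<^sup>2" by blast
        from base_bound[OF q(1) rc(1) num_clauses_le[OF phi] le, where p = "sz ?par + 1"]
        show "real y \<le> real a * (real ?n + 1)\<^sup>2 * 2 powr (3 * real D / real q * real ?n)"
          unfolding y a_def .
      qed simp_all
      also have "\<dots> = (real B * real a ^ E) * (real ?n + 1) ^ (2 * E)
          * 2 powr (real E * (3 * real D / real q * real ?n))"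
        by (simp add: power_mult_distrib power_mult[symmetric] powr_power mult_ac)
      also have "\<dots> \<le> U ?n"
      proof -
        have "6 * real D * real E \<le> \<delta> * real q" using q(2) by (simp add: E_def)
        then have "real E * (3 * real D / real q) \<le> \<delta> / 2"
          using q(1) by (simp add: field_simps)
        then have "real E * (3 * real D / real q) * real ?n \<le> \<delta> / 2 * real ?n"
          by (rule mult_right_mono) simp
        then have "2 powr (real E * (3 * real D / real q * real ?n)) \<le> 2 powr (\<delta> / 2 * real ?n)"
          by (intro powr_mono) (simp_all add: mult.assoc)
        then show ?thesis unfolding U_def by (intro mult_left_mono) simp_all
      qed
      finally show ?thesis .
    qed
    moreover have "r \<le> card S" if "SAT \<phi> = ?m"
    proof -
      have "sqrt (real d) > 0" using d by simp
      \<comment> \<open>The optimum is at least \<open>k\<close>, and 3k \<ge> sqrt d, so the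
        guaranteed profit is at least \<open>r\<close>.\<close>
      have "real r * sqrt (real d) \<le> real r * (3 * real k)" using kz(2) by (rule mult_left_mono) simp
      then have "real r \<le> 3 * real r / sqrt (real d) * real k"
        using \<open>sqrt (real d) > 0\<close> by (simp add: field_simps)
      also have "\<dots> \<le> 3 * real r / sqrt (real d) * real (OPT d ?K)"
        using MQ(2)[OF that] by (intro mult_left_mono) auto
      also have "\<dots> \<le> real (card S)" using S(3) by (simp add: profit)
      finally show ?thesis by simp
    qed
    moreover have "\<not> r \<le> card S" if lt: "real (SAT \<phi>) < (1 - \<epsilon>) * real ?m"
    proof
      assume "r \<le> card S"
      from MQ(3)[OF S(2) this] have "real (q ^ r * ?m) \<le> real (q ^ r * SAT \<phi> + (q - 1) ^ r * ?m)"
        by (simp only: of_nat_le_iff)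
      then have "real q ^ r * real ?m \<le> real q ^ r * real (SAT \<phi>) + real (q - 1) ^ r * real ?m"
        by simp
      then have "real ?m \<le> real (SAT \<phi>) + (real (q - 1) / real q) ^ r * real ?m"
        using q(1) by (simp add: power_divide field_simps)
      also have "\<dots> \<le> real (SAT \<phi>) + \<epsilon> * real ?m"
        using r by (intro add_left_mono mult_right_mono) auto
      finally show False using lt by (simp add: algebra_simps)
    qed
    ultimately show ?thesis by (intro exI[of _ "[r \<le> card S]"] exI conjI) auto
  qed
  have "U \<in> O(\<lambda>n. 2 powr (\<delta> * real n))"
    unfolding U_def by (rule poly_times_exp_bigo[OF \<delta>])
  with main have "distinguishes_in_time D \<epsilon> (P0 ;; P1 ;; P2) (\<lambda>n. 2 powr (\<delta> * real n))"
    unfolding distinguishes_in_time_def by blast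
  then show ?thesis by blast
qed

theorem theorem1p5:
  fixes C :: real
  assumes "Gap_ETH"
    and "C \<ge> 1"
  shows "\<exists>\<rho>::real. \<rho> > 0 \<and> (\<exists>d0::nat. \<forall>d\<ge>d0.
    \<not> (\<exists>P. knapsack_approximation_algorithm d (\<rho> / sqrt (real d)) P \<and>
           knapsack_runs_in_time d P (\<lambda>n. real n powr C)))"
proof -
  obtain D :: nat and \<delta> \<epsilon> :: real where \<delta>: "\<delta> > 0" and \<epsilon>: "0 < \<epsilon>" "\<epsilon> < 1"
    and hard: "\<not> (\<exists>P. distinguishes_in_time D \<epsilon> P (\<lambda>n. 2 powr (\<delta> * real n)))"
    using assms(1) unfolding Gap_ETH_def by auto
  obtain c where red: "computes reduce (\<lambda>z. (sz z + 2 ^ length (snd (prepare z)) + 2) ^ c)"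
      "\<And>z. sz (reduce z) \<le> (sz z + 2 ^ length (snd (prepare z)) + 2) ^ c"
    using computes_reduce by blast
  obtain V where V: "poly_bounded V" "computes decide V"
    using poly_time_decide unfolding poly_time_def by blast
  then obtain e where "\<And>z. V z \<le> (sz z + 2) ^ e" unfolding poly_bd_def by blast
  from computes_mono[OF V(2) this] have dec: "computes decide (\<lambda>z. (sz z + 2) ^ e)" .
  define E where "E = c * (nat \<lceil>C\<rceil> + e + 1)"
  \<comment> \<open>\<open>c\<close> and \<open>e\<close> are fixed before \<open>q\<close>, so the
    choice is not circular. The 6 is 3 literals per clause times 2 for the halved rate; the added 1
    makes \<open>q\<close> positive.\<close>
  define q where "q = nat \<lceil>6 * real D * real E / \<delta>\<rceil> + 1"
  have "6 * real D * real E / \<delta> \<le> real q" unfolding q_def by linarith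
  then have q: "q \<ge> 1" "6 * real D * real E \<le> \<delta> * real q"
    using \<delta> by (simp_all add: q_def field_simps)
  have "real (q - 1) / real q < 1" using q(1) by (simp add: field_simps)
  then obtain r where r: "(real (q - 1) / real q) ^ r < \<epsilon>"
    using real_arch_pow_inv[OF \<epsilon>(1)] by blast
  have "r \<noteq> 0" using r \<epsilon>(2) by (cases r) auto
  \<comment> \<open>The threshold 2 for \<open>d\<close> is what makes k \<ge> 1; the argument is
    the same whether or not the ratio is below 1.\<close>
  have "\<not> (\<exists>P. knapsack_approximation_algorithm d (3 * real r / sqrt (real d)) P \<and>
      knapsack_runs_in_time d P (\<lambda>n. real n powr C))" if d: "d \<ge> 2" for d
  proof
    assume "\<exists>P. knapsack_approximation_algorithm d (3 * real r / sqrt (real d)) P \<and>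
      knapsack_runs_in_time d P (\<lambda>n. real n powr C)"
    then obtain P T where P: "knapsack_approximation_algorithm d (3 * real r / sqrt (real d)) P"
      and T: "T \<in> O(\<lambda>n. real n powr C)"
      "\<And>K. \<exists>y t. runs P (encode_knapsack d K) y t \<and> real t \<le> T (length (encode_knapsack d K))"
      unfolding knapsack_runs_in_time_def by blast
    have "\<exists>P'. distinguishes_in_time D \<epsilon> P' (\<lambda>n. 2 powr (\<delta> * real n))"
      by (rule distinguisher[OF red dec \<delta> q(1) q(2)[unfolded E_def] less_imp_le[OF r] d P T(1) _ refl T(2)])
         (use assms(2) in simp)
    with hard show False by blast
  qed
  with \<open>r \<noteq> 0\<close> show ?thesis
    by (intro exI[of _ "3 * real r"] conjI exI[of _ 2]) auto
qed

end
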